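(* Let $X$ and $Y$ be Polish spaces with Borel $\sigma$-algebras $\mathcal A$, $\mathcal B$, each equipped with a given continuous action of the group $(\mathbb Z,+)$, and let $\mathbb Z$ act diagonally on $X\times Y$. Let $\mathcal A^{inv}\subseteq\mathcal A$ and $\mathcal B^{inv}\subseteq\mathcal B$ be the $\sigma$-subalgebras of invariant sets. Let $c\colon X\times Y\to\mathbb R$ be a lower semicontinuous and bounded below function, and let $\mu\in\mathcal P_{\mathbb Z}(X)$, $\nu\in\mathcal P_{\mathbb Z}(Y)$. Then $$\inf\Big\{\int c\,d\pi : \pi\in\mathcal P_{\mathbb Z}(X\times Y),\ \mathrm{Pr}_1(\pi)=\mu,\ \mathrm{Pr}_2(\pi)=\nu\Big\}$$ $$=\inf\Big\{\int \inf\Big\{\int c\,d\pi : \pi\in\mathcal P_{\mathbb Z}(X\times Y),\ \mathrm{Pr}_1(\pi)=\xi_\alpha,\ \mathrm{Pr}_2(\pi)=\xi_\beta\Big\}\,d\tilde\pi(\xi_\alpha,\xi_\beta) : \tilde\pi\in\tilde\Pi(\tilde\mu,\tilde\nu)\Big\},$$ where $\tilde\mu\in\mathcal P(\partial_e(\mathcal P_{\mathbb Z}(X)))$ and $\tilde\nu\in\mathcal P(\partial_e(\mathcal P_{\mathbb Z}(Y)))$ are the measures with barycenters $\mu$ and $\nu$ (equivalently, they are given by the restrictions of $\mu$ to $\mathcal A^{inv}$ and of $\nu$ to $\mathcal B^{inv}$, through the ergodic decomposition maps), and $$\tilde\Pi(\tilde\mu,\tilde\nu)=\{\tilde\pi\in\mathcal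 P(\partial_e(\mathcal P_{\mathbb Z}(X))\times\partial_e(\mathcal P_{\mathbb Z}(Y))) : \mathrm{Pr}_1(\tilde\pi)=\tilde\mu,\ \mathrm{Pr}_2(\tilde\pi)=\tilde\nu\}.$$
   Context: $\mathcal P(Z)$ denotes the set of Borel probability measures on $Z$, with the topology of weak convergence and its Borel $\sigma$-algebra. For a continuous action of $\mathbb Z$ on $Z$, $\mathcal P_{\mathbb Z}(Z)\subseteq\mathcal P(Z)$ is the set of measures $\mu$ with $\mu\circ g^{-1}=\mu$ for every $g\in\mathbb Z$, and $\partial_e(\mathcal P_{\mathbb Z}(Z))$ is the set of its extreme points, i.e. the ergodic measures. The diagonal action on $X\times Y$ is $g(x,y)=(g(x),g(y))$. $\mathrm{Pr}_k$ sends a measure on a product to its $k$-th marginal. Each $\mu\in\mathcal P_{\mathbb Z}(Z)$ is the barycenter $\mu=\int\xi\,d\tilde\mu(\xi)$ of a unique $\tilde\mu\in\mathcal P(\partial_e(\mathcal P_{\mathbb Z}(Z)))$. If $x\mapsto Q^x\in\partial_e(\mathcal P_{\mathbb Z}(Z))$ denotes the ergodic decomposition map (measurable with respect to the invariant sets, with $Q^x$ the conditional distribution given the invariant $\sigma$-algebra), then $\tilde\mu(S)=\mu(\{x: Q^x\in S\})$ for measurable $S$, so that $\tilde\mu$ corresponds to the restriction of $\mu$ to the $\sigma$-algebra of invariant sets. *)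

theory Defs
  imports "HOL-Probability.Probability"
begin

definition continuous_int_action :: "(int \<Rightarrow> 'a::topological_space \<Rightarrow> 'a) \<Rightarrow> bool" where
  "continuous_int_action a \<longleftrightarrow>
     a 0 = id \<and> (\<forall>m n. a (m + n) = a m \<circ> a n) \<and> (\<forall>n. continuous_on UNIV (a n))"

definition diag_action :: "(int \<Rightarrow> 'a \<Rightarrow> 'a) \<Rightarrow> (int \<Rightarrow> 'b \<Rightarrow> 'b) \<Rightarrow> int \<Rightarrow> 'a \<times> 'b \<Rightarrow> 'a \<times> 'b" where
  "diag_action a b n = (\<lambda>(x, y). (a n x, b n y))"

definition lower_semicontinuous :: "('a::topological_space \<Rightarrow> real) \<Rightarrow> bool" where
  "lower_semicontinuous f \<longleftrightarrow> (\<forall>t. open {x. t < f x})"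

definition borel_of :: "'a topology \<Rightarrow> 'a measure" where
  "borel_of T = sigma (topspace T) {U. openin T U}"

definition prob_measures :: "'a measure \<Rightarrow> 'a measure set" where
  "prob_measures M = {P. sets P = sets M \<and> prob_space P}"

text \<open>The coarsest topology on the Borel probability measures making \<open>P \<mapsto> \<integral>f dP\<close>
  continuous for every bounded continuous \<open>f\<close>.\<close>

definition weak_topology :: "'a::topological_space measure topology" where
  "weak_topology = topology_generated_by
     {{P \<in> prob_measures borel. (LINT x|P. f x) \<in> U} | (f :: 'a \<Rightarrow> real) U.
        continuous_on UNIV f \<and> bounded (range f) \<and> open U}"

definition invariant_probs :: "(int \<Rightarrow> 'a::topological_space \<Rightarrow> 'a) \<Rightarrow> 'a measure set" where
  "invariant_probs a = {P \<in> prob_measures borel. \<forall>n. distr P borel (a n) = P}"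

text \<open>The type of measures is not a vector space, so \<^const>\<open>extreme_point_of\<close> does not apply;
  convex combinations are taken setwise.\<close>

definition extreme_measures :: "'a measure set \<Rightarrow> 'a measure set" where
  "extreme_measures K = {P \<in> K. \<forall>Q\<in>K. \<forall>R\<in>K. \<forall>t::real. 0 < t \<longrightarrow> t < 1 \<longrightarrow>
     (\<forall>A\<in>sets P. measure P A = (1 - t) * measure Q A + t * measure R A) \<longrightarrow> Q = R}"

definition ergodic_topology :: "(int \<Rightarrow> 'a::topological_space \<Rightarrow> 'a) \<Rightarrow> 'a measure topology" where
  "ergodic_topology a = subtopology weak_topology (extreme_measures (invariant_probs a))"

definition is_barycenter :: "'a::topological_space measure measure \<Rightarrow> 'a measure \<Rightarrow> bool" where
  "is_barycenter m P \<longleftrightarrow> (\<forall>A\<in>sets borel. emeasure P A = (\<integral>\<^sup>+ Q. emeasure Q A \<partial>m))"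

text \<open>The unique Borel probability measure on the ergodic measures with barycenter \<open>P\<close>.\<close>

definition ergodic_decomposition ::
    "(int \<Rightarrow> 'a::topological_space \<Rightarrow> 'a) \<Rightarrow> 'a measure \<Rightarrow> 'a measure measure" where
  "ergodic_decomposition a P =
     (THE m. m \<in> prob_measures (borel_of (ergodic_topology a)) \<and> is_barycenter m P)"

definition couplings ::
    "'a topology \<Rightarrow> 'b topology \<Rightarrow> 'a measure \<Rightarrow> 'b measure \<Rightarrow> ('a \<times> 'b) measure set" where
  "couplings S T \<mu> \<nu> = {p \<in> prob_measures (borel_of (prod_topology S T)).
     distr p (borel_of S) fst = \<mu> \<and> distr p (borel_of T) snd = \<nu>}"

definition invariant_couplings ::
    "(int \<Rightarrow> 'a::topological_space \<Rightarrow> 'a) \<Rightarrow> (int \<Rightarrow> 'b::topological_space \<Rightarrow> 'b) \<Rightarrow>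
     'a measure \<Rightarrow> 'b measure \<Rightarrow> ('a \<times> 'b) measure set" where
  "invariant_couplings a b \<mu> \<nu> = {p \<in> invariant_probs (diag_action a b).
     distr p borel fst = \<mu> \<and> distr p borel snd = \<nu>}"

text \<open>The Lebesgue integral with values in \<open>[-\<infinity>, \<infinity>]\<close>, as positive part minus negative part
  (\<^const>\<open>e2ennreal\<close> truncates negative values to 0). It is meaningful when one part is finite, in
  particular for functions bounded below under a probability measure; \<^const>\<open>lebesgue_integral\<close>
  would give 0 where the value is \<open>\<infinity>\<close>.\<close>

definition ext_integral :: "'a measure \<Rightarrow> ('a \<Rightarrow> ereal) \<Rightarrow> ereal" where
  "ext_integral M f =
     enn2ereal (\<integral>\<^sup>+ x. e2ennreal (f x) \<partial>M) - enn2ereal (\<integral>\<^sup>+ x. e2ennreal (- f x) \<partial>M)"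

definition invariant_cost ::
    "(int \<Rightarrow> 'a::topological_space \<Rightarrow> 'a) \<Rightarrow> (int \<Rightarrow> 'b::topological_space \<Rightarrow> 'b) \<Rightarrow>
     ('a \<times> 'b \<Rightarrow> real) \<Rightarrow> 'a measure \<Rightarrow> 'b measure \<Rightarrow> ereal" where
  "invariant_cost a b c \<mu> \<nu> =
     (INF p \<in> invariant_couplings a b \<mu> \<nu>. ext_integral p (\<lambda>z. ereal (c z)))"

end

theory Submission
  imports Defs
begin

text \<open>An invariant coupling decomposes into ergodic ones, whose marginals are again ergodic; the law of
  these marginals couples the two ergodic decompositions, since a measure on the ergodic measures is
  determined by its barycenter. Conversely, a coupling of the two ergodic decompositions is
  recombined without measurable selection: on each cell of a countable partition of the pairs of
  ergodic measures a single nearly optimal invariant coupling is used, and its mixture has nearly the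
  right cost and, for the weak topology, nearly the right marginals. Prokhorov's theorem and lower
  semicontinuity of the cost allow passing to the limit as the partition gets finer.

  The ergodic decomposition comes from the empirical measures of an orbit. They converge weakly,
  almost surely along one subsequence, by the mean ergodic theorem applied to countably many test
  functions and to the indicators of countably many compact sets of nearly full measure, which give
  tightness.\<close>

text \<open>Two objects in the statement have to be reached through countable data: the Borel sets
  of the weak topology on the ergodic measures, and the ergodic cost as an integrand. For the first,
  one sequence \<open>test\<close> of bounded continuous functions is fixed such that every
  nonnegative lower semicontinuous function is the limit of an increasing sequence drawn from it;
  masses of open sets, weak convergence and measurability of measure-valued maps are then read off
  from the integrals of \<open>test j\<close>. For the second, the cost is shown to be lower
  semicontinuous on pairs of ergodic measures by the same compactness argument,
  \<open>coupling_limit\<close>, that concludes the recombination.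

  The limits of averages are taken along a subsequence that depends on the measure \<open>P\<close>.
  This does no harm, since a \<open>P\<close>-null set is null for almost every ergodic component of
  \<open>P\<close>: limits found under \<open>P\<close> hold under the components too. The
  ergodicity of the components and the uniqueness of the measure with barycenter \<open>P\<close>
  both come from this transfer.\<close>

instance prod :: (polish_space, polish_space) polish_space ..

lemma prob_measuresD:
  assumes "P \<in> prob_measures M"
  shows "prob_space P" "sets P = sets M" "space P = space M"
  using assms by (auto simp: prob_measures_def dest: sets_eq_imp_space_eq)

lemma emeasure_prob_le_1: "prob_space P \<Longrightarrow> emeasure P A \<le> 1"
  by (simp add: prob_space.emeasure_le_1)

subsection \<open>A countable determining family of test functions\<close>

text \<open>A tent of height \<open>q\<close> over the center \<open>d\<close>, vanishing from
  distance \<open>1 / k\<close> on, and the constant \<open>q\<close> for \<open>k = 0\<close>. With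
  centers from a countable dense set, the family is countable.\<close>

definition bump :: "'a::metric_space \<times> nat \<times> rat \<Rightarrow> 'a \<Rightarrow> real" where
  "bump = (\<lambda>(d, k, q) x. of_rat q * max 0 (1 - real k * dist x d))"

text \<open>The fold starts at 0, so the empty maximum is 0; this is harmless because only
  nonnegative functions are combined.\<close>

definition max_list :: "('a \<Rightarrow> real) list \<Rightarrow> 'a \<Rightarrow> real" where
  "max_list fs x = foldr (\<lambda>f r. max (f x) r) fs 0"

lemma max_list_simps [simp]: "max_list [] x = 0" "max_list (f # fs) x = max (f x) (max_list fs x)"
  by (auto simp: max_list_def)

lemma bump_bounds: "0 \<le> q \<Longrightarrow> 0 \<le> bump (d, k, q) x" "0 \<le> q \<Longrightarrow> bump (d, k, q) x \<le> of_rat q"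
  by (auto simp: bump_def mult_left_le)

lemma continuous_on_bump: "continuous_on UNIV (bump b)"
  by (cases b) (auto simp: bump_def intro!: continuous_intros)

lemma max_list_continuous:
  "(\<And>f. f \<in> set fs \<Longrightarrow> continuous_on UNIV f) \<Longrightarrow> continuous_on UNIV (max_list fs)"
proof (induction fs)
  case Nil
  have "max_list ([] :: ('a \<Rightarrow> real) list) = (\<lambda>_. 0)" by auto
  then show ?case by simp
next
  case (Cons f fs)
  have "max_list (f # fs) = (\<lambda>x. max (f x) (max_list fs x))" by auto
  then show ?case using Cons by (auto intro!: continuous_intros)
qed

lemma max_list_nonneg: "0 \<le> max_list fs x"
  by (induction fs) auto

lemma max_list_bounded:
  "(\<And>f. f \<in> set fs \<Longrightarrow> \<exists>B. \<forall>x. f x \<le> B) \<Longrightarrow> \<exists>B. \<forall>x. max_list fs x \<le> B"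
proof (induction fs)
  case (Cons f fs)
  then obtain B C where "\<forall>x. f x \<le> B" "\<forall>x. max_list fs x \<le> C" by fastforce
  then show ?case by (auto intro!: exI[of _ "max B C"] simp: max.coboundedI1 max.coboundedI2)
qed auto

lemma max_list_le: "(\<And>f. f \<in> set fs \<Longrightarrow> f x \<le> y) \<Longrightarrow> 0 \<le> y \<Longrightarrow> max_list fs x \<le> y"
  by (induction fs) auto

lemma max_list_ge: "f \<in> set fs \<Longrightarrow> f x \<le> max_list fs x"
  by (induction fs) (auto simp: max.coboundedI2)

text \<open>Indicators of open sets are among the functions \<open>c\<close>, so the integrals of
  the family determine a probability measure. The index sequence \<open>s\<close> depends on
  \<open>c\<close> but not on the point, which permits monotone convergence under the
  integral.\<close>

definition test_family :: "(nat \<Rightarrow> 'a::metric_space \<Rightarrow> real) \<Rightarrow> bool" where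
  "test_family h \<longleftrightarrow> (\<forall>i. continuous_on UNIV (h i) \<and> (\<forall>x. 0 \<le> h i x) \<and> (\<exists>B. \<forall>x. h i x \<le> B)) \<and>
     (\<forall>c. lower_semicontinuous c \<longrightarrow> (\<forall>x. 0 \<le> c x) \<longrightarrow>
       (\<exists>s. \<forall>x. incseq (\<lambda>n::nat. h (s n) x) \<and> (\<lambda>n. h (s n) x) \<longlonglongrightarrow> c x))"

text \<open>Finite maxima of tents work. The tents below \<open>c\<close> have supremum
  \<open>c\<close>: if \<open>0 \<le> t < c x\<close>, lower semicontinuity gives a ball around
  \<open>x\<close> where \<open>c\<close> exceeds a rational \<open>q > t\<close>, and a narrow tent
  of height \<open>q\<close> centered near \<open>x\<close> fits under \<open>c\<close> and exceeds
  \<open>t\<close> at \<open>x\<close>. Maxima over initial segments of an enumeration of these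
  tents increase to \<open>c\<close>.\<close>

lemma test_family_exists: "\<exists>h :: nat \<Rightarrow> 'a::{metric_space,second_countable_topology} \<Rightarrow> real. test_family h"
proof -
  obtain D :: "'a set" where D: "countable D" "\<And>X. open X \<Longrightarrow> X \<noteq> {} \<Longrightarrow> \<exists>d\<in>D. d \<in> X"
    using countable_dense_setE by blast
  define BF where "BF = bump ` (D \<times> UNIV \<times> {q. 0 \<le> q})"
  have BF: "countable BF"
    using D(1) unfolding BF_def by (intro countable_image countable_SIGMA) auto
  have BFp: "0 \<le> f x" "continuous_on UNIV f" "\<exists>B. \<forall>x. f x \<le> B" if "f \<in> BF" for f x
  proof -
    from that obtain d k q where "f = bump (d, k, q)" "0 \<le> q" by (auto simp: BF_def)
    then show "0 \<le> f x" "continuous_on UNIV f" "\<exists>B. \<forall>x. f x \<le> B"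
      using bump_bounds continuous_on_bump by blast+
  qed
  define H where "H = max_list ` lists BF"
  have "countable H" using BF by (simp add: H_def)
  have "H \<noteq> {}" by (auto simp: H_def)
  define h where "h = from_nat_into H"
  have rh: "range h = H" using \<open>countable H\<close> \<open>H \<noteq> {}\<close> by (simp add: h_def)
  have hH: "h i \<in> H" for i using rh by blast
  have "test_family h"
    unfolding test_family_def
  proof (intro conjI allI impI)
    fix i
    obtain fs where fs: "h i = max_list fs" "fs \<in> lists BF"
      using hH[of i] unfolding H_def by blast
    show "continuous_on UNIV (h i)" "\<And>x. 0 \<le> h i x" "\<exists>B. \<forall>x. h i x \<le> B"
      unfolding fs(1) using fs(2) BFp
      by (auto intro!: max_list_continuous max_list_nonneg max_list_bounded)
  next
    fix c :: "'a \<Rightarrow> real" assume lsc: "lower_semicontinuous c" and pos: "\<forall>x. 0 \<le> c x"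
    define S where "S = {f \<in> BF. \<forall>x. f x \<le> c x}"
    \<comment> \<open>The zero function is a tent below \<open>c\<close>, so \<open>S\<close> can be
      enumerated; it also settles the levels \<open>t < 0\<close>.\<close>
    obtain d0 where "d0 \<in> D" using D(2)[of UNIV] by auto
    then have "bump (d0, 0, 0) \<in> BF" by (auto simp: BF_def)
    then have "bump (d0, 0, 0) \<in> S" using pos by (auto simp: S_def bump_def)
    then have "S \<noteq> {}" by auto
    have "countable S" using BF by (auto simp: S_def intro: countable_subset)
    define e where "e = from_nat_into S"
    have re: "range e = S" using \<open>countable S\<close> \<open>S \<noteq> {}\<close> by (simp add: e_def)
    then have eS: "e n \<in> S" for n by blast
    \<comment> \<open>With the list reversed, going from \<open>n\<close> to \<open>Suc n\<close>
      puts the new tent at the head, so monotonicity is read off from the recursion of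
      \<open>max_list\<close>.\<close>
    define g where "g n = max_list (map e (rev [0..<n]))" for n
    have "g n \<in> H" for n
      unfolding g_def H_def by (rule imageI) (use eS in \<open>auto simp: S_def\<close>)
    then have "\<forall>n. \<exists>i. h i = g n" using rh by (metis imageE)
    then obtain s where s: "\<And>n. h (s n) = g n" by metis
    show "\<exists>s. \<forall>x. incseq (\<lambda>n. h (s n) x) \<and> (\<lambda>n. h (s n) x) \<longlonglongrightarrow> c x"
    proof (intro exI allI conjI)
      fix x
      show inc: "incseq (\<lambda>n. h (s n) x)"
        by (rule incseq_SucI) (simp add: s g_def)
      have le: "h (s n) x \<le> c x" for n
        unfolding s g_def using eS pos by (intro max_list_le) (auto simp: S_def)
      show "(\<lambda>n. h (s n) x) \<longlonglongrightarrow> c x"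
      proof (rule order_tendstoI)
        fix t assume t: "c x < t"
        show "\<forall>\<^sub>F n in sequentially. h (s n) x < t"
          using le le_less_trans[OF _ t] by (auto intro!: always_eventually)
      next
        fix t assume t: "t < c x"
        have "\<exists>f\<in>S. t < f x"
        proof (cases "t < 0")
          case True
          then show ?thesis using \<open>bump (d0, 0, 0) \<in> S\<close> by (auto intro!: bexI[of _ "bump (d0,0,0)"] simp: bump_def)
        next
          case False
          obtain q where q: "t < of_rat q" "of_rat q < c x" using of_rat_dense[OF t] by blast
          have q0: "0 < (of_rat q :: real)" using False q by linarith
          have "open {y. of_rat q < c y}" using lsc by (simp add: lower_semicontinuous_def)
          then obtain \<delta> where \<delta>: "\<delta> > 0" "ball x \<delta> \<subseteq> {y. of_rat q < c y}"
            using q(2) by (meson mem_Collect_eq openE)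
          obtain k :: nat where k: "2 / \<delta> < real k" using reals_Archimedean2 by blast
          then have kpos: "0 < real k" using \<delta> by (smt (verit) divide_pos_pos)
          have k2: "2 / real k < \<delta>" using k \<delta>(1) kpos by (simp add: field_simps)
          \<comment> \<open>\<open>1 / k\<close> keeps the support of the tent within distance
            \<open>2 / k < \<delta>\<close> of \<open>x\<close>; the other bound makes the value at
            \<open>x\<close> exceed \<open>t\<close>.\<close>
          define r where "r = min (1 / real k) ((1 - t / of_rat q) / real k)"
          have "r > 0" using q q0 kpos by (simp add: r_def)
          then obtain d where d: "d \<in> D" "dist x d < r" using D(2)[of "ball x r"] by auto
          have 1: "bump (d, k, q) \<in> S"
            unfolding S_def
          proof (intro CollectI conjI allI)
            show "bump (d, k, q) \<in> BF" using d q0 by (auto simp: BF_def)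
            fix y
            show "bump (d, k, q) y \<le> c y"
            proof (cases "dist y d < 1 / real k")
              case True
              have "dist x y \<le> dist x d + dist y d" by (metis dist_commute dist_triangle)
              also have "\<dots> < 1 / real k + 1 / real k" using True d(2) by (auto simp: r_def)
              also have "\<dots> < \<delta>" using k2 by simp
              finally have "of_rat q < c y" using \<delta>(2) by auto
              then show ?thesis using bump_bounds(2)[of q d k y] q0 by auto
            next
              case False
              then have "1 - real k * dist y d \<le> 0" using kpos by (simp add: field_simps)
              then show ?thesis using pos by (simp add: bump_def max_def)
            qed
          qed
          have "real k * dist x d < 1 - t / of_rat q"
            using d(2) kpos by (simp add: r_def field_simps)
          then have "t / of_rat q < 1 - real k * dist x d" by simp
          then have "t < of_rat q * (1 - real k * dist x d)" using q0 by (simp add: field_simps)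
          also have "\<dots> \<le> bump (d, k, q) x" using q0 by (auto simp: bump_def intro!: mult_left_mono)
          finally show ?thesis using 1 by blast
        qed
        then obtain i where i: "t < e i x" using re by (metis imageE)
        have "t < h (s n) x" if "i < n" for n
        proof -
          have "e i x \<le> h (s n) x" unfolding s g_def using that by (intro max_list_ge) auto
          then show ?thesis using i by linarith
        qed
        then show "\<forall>\<^sub>F n in sequentially. t < h (s n) x"
          using eventually_gt_at_top[of i] by (rule eventually_mono[rotated])
      qed
    qed
  qed
  then show ?thesis by blast
qed

definition test :: "nat \<Rightarrow> 'a::{metric_space,second_countable_topology} \<Rightarrow> real" where
  "test = (SOME h. test_family h)"

lemma test_family_test: "test_family test"
  unfolding test_def by (rule someI_ex[OF test_family_exists])

lemma continuous_test: "continuous_on UNIV (test i)"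
  and test_nonneg: "0 \<le> test i x"
  and test_bounded: "\<exists>B. \<forall>x. test i x \<le> B"
  using test_family_test unfolding test_family_def by auto

definition test_bound :: "'a::{metric_space,second_countable_topology} itself \<Rightarrow> nat \<Rightarrow> real" where
  "test_bound _ i = (SOME B. \<forall>x::'a. test i x \<le> B)"

lemma test_le_bound: "test i (x::'a) \<le> test_bound TYPE('a::{metric_space,second_countable_topology}) i"
  unfolding test_bound_def using someI_ex[OF test_bounded, of i] by blast

lemma abs_test_le_bound: "\<bar>test i (x::'a)\<bar> \<le> test_bound TYPE('a::{metric_space,second_countable_topology}) i"
  using test_le_bound[of i x] test_nonneg[of i x] by simp

lemma measurable_test [measurable]: "test i \<in> borel_measurable borel"
  by (rule borel_measurable_continuous_onI[OF continuous_test])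

lemma test_approx:
  fixes c :: "'a::{metric_space,second_countable_topology} \<Rightarrow> real"
  assumes "lower_semicontinuous c" "\<And>x. 0 \<le> c x"
  obtains s where "\<And>x. incseq (\<lambda>n::nat. test (s n) (x::'a))" "\<And>x. (\<lambda>n. test (s n) x) \<longlonglongrightarrow> c x"
proof -
  have "\<exists>s. \<forall>x. incseq (\<lambda>n::nat. test (s n) x) \<and> (\<lambda>n. test (s n) x) \<longlonglongrightarrow> c x"
    using test_family_test assms unfolding test_family_def by blast
  then show thesis using that by blast
qed

lemma integrable_test:
  fixes P :: "'a::{metric_space,second_countable_topology} measure"
  assumes "P \<in> prob_measures borel"
  shows "integrable P (test i)"
proof -
  interpret prob_space P using prob_measuresD[OF assms] by simp
  have [measurable_cong]: "sets P = sets borel" using prob_measuresD[OF assms] by simp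
  show ?thesis
    by (rule integrable_const_bound[where B="test_bound TYPE('a) i"]) (auto intro!: AE_I2 abs_test_le_bound)
qed

lemma nn_integral_test:
  assumes "P \<in> prob_measures borel"
  shows "(\<integral>\<^sup>+ x. ennreal (test i x) \<partial>P) = ennreal (LINT x|P. test i x)"
  by (rule nn_integral_eq_integral[OF integrable_test[OF assms]]) (simp add: test_nonneg)

lemma measurable_lsc: "lower_semicontinuous c \<Longrightarrow> c \<in> borel_measurable borel"
  by (auto simp: lower_semicontinuous_def borel_measurable_iff_greater)

text \<open>Monotone convergence along an increasing sequence of test functions. The sequence is
  fixed before the measure, so the integral becomes one formula in the test integrals, valid for all
  \<open>P\<close> at once.\<close>

lemma nn_integral_lsc_SUP:
  fixes c :: "'a::{metric_space,second_countable_topology} \<Rightarrow> real"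
  assumes "lower_semicontinuous c" "\<And>x. 0 \<le> c x"
  obtains s :: "nat \<Rightarrow> nat" where "\<And>P. P \<in> prob_measures borel \<Longrightarrow>
     (\<integral>\<^sup>+ x. ennreal (c x) \<partial>P) = (SUP n. ennreal (LINT x|P. test (s n) x))"
proof -
  obtain s where s: "\<And>x. incseq (\<lambda>n::nat. test (s n) (x::'a))" "\<And>x. (\<lambda>n. test (s n) x) \<longlonglongrightarrow> c x"
    using test_approx[OF assms] by blast
  show thesis
  proof (rule that[of s])
    fix P :: "'a measure" assume P: "P \<in> prob_measures borel"
    have [measurable_cong]: "sets P = sets borel" using prob_measuresD[OF P] by simp
    have "ennreal (c x) = (SUP n. ennreal (test (s n) x))" for x
    proof (rule LIMSEQ_unique)
      show "(\<lambda>n. ennreal (test (s n) x)) \<longlonglongrightarrow> ennreal (c x)" using s(2) by (simp add: tendsto_ennrealI)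
      show "(\<lambda>n. ennreal (test (s n) x)) \<longlonglongrightarrow> (SUP n. ennreal (test (s n) x))"
        using s(1)[of x] by (intro LIMSEQ_SUP) (auto simp: incseq_def intro!: ennreal_leI)
    qed
    then have "(\<integral>\<^sup>+ x. ennreal (c x) \<partial>P) = (\<integral>\<^sup>+ x. (SUP n. ennreal (test (s n) x)) \<partial>P)" by simp
    also have "\<dots> = (SUP n. \<integral>\<^sup>+ x. ennreal (test (s n) x) \<partial>P)"
      using s(1) by (intro nn_integral_monotone_convergence_SUP)
        (auto simp: incseq_def le_fun_def intro!: ennreal_leI)
    finally show "(\<integral>\<^sup>+ x. ennreal (c x) \<partial>P) = (SUP n. ennreal (LINT x|P. test (s n) x))"
      by (simp add: nn_integral_test[OF P])
  qed
qed

lemma lsc_indicator: "open U \<Longrightarrow> lower_semicontinuous (indicator U :: _ \<Rightarrow> real)"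
proof -
  assume "open U"
  have "{x. t < (indicator U x :: real)} = (if t < 0 then UNIV else if t < 1 then U else {})" for t
    by (auto simp: indicator_def split: if_splits)
  with \<open>open U\<close> show ?thesis by (simp add: lower_semicontinuous_def)
qed

lemma lsc_continuous: "continuous_on UNIV (f :: _ \<Rightarrow> real) \<Longrightarrow> lower_semicontinuous f"
  unfolding lower_semicontinuous_def by (auto intro!: open_Collect_less)

lemma emeasure_open_SUP:
  fixes U :: "'a::{metric_space,second_countable_topology} set"
  assumes "open U"
  obtains s :: "nat \<Rightarrow> nat" where "\<And>P. P \<in> prob_measures borel \<Longrightarrow>
     emeasure P U = (SUP n. ennreal (LINT x|P. test (s n) x))"
proof -
  obtain s :: "nat \<Rightarrow> nat" where s: "\<And>P::'a measure. P \<in> prob_measures borel \<Longrightarrow>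
     (\<integral>\<^sup>+ x. ennreal (indicator U x) \<partial>P) = (SUP n. ennreal (LINT x|P. test (s n) x))"
    using nn_integral_lsc_SUP[OF lsc_indicator[OF assms]] by auto
  show thesis
  proof (rule that[of s])
    fix P :: "'a measure" assume P: "P \<in> prob_measures borel"
    have "U \<in> sets P" using prob_measuresD[OF P] assms by simp
    then show "emeasure P U = (SUP n. ennreal (LINT x|P. test (s n) x))"
      using s[OF P] by (simp add: ennreal_indicator)
  qed
qed

lemma borel_prob_eqI:
  assumes "P \<in> prob_measures borel" "Q \<in> prob_measures borel"
    and "\<And>U. open U \<Longrightarrow> emeasure P U = emeasure Q U"
  shows "P = (Q :: 'a::topological_space measure)"
proof (rule measure_eqI_generator_eq[where E="{U. open U}" and \<Omega>=UNIV and A="\<lambda>_. UNIV"])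
  show "Int_stable {U::'a set. open U}" by (auto simp: Int_stable_def)
  show "emeasure P UNIV \<noteq> \<infinity>"
    using emeasure_prob_le_1[OF prob_measuresD(1)[OF assms(1)], of UNIV] by (auto simp: top_unique)
qed (use assms prob_measuresD[OF assms(1)] prob_measuresD[OF assms(2)] in \<open>auto simp: borel_def\<close>)

lemma prob_eq_if_test_eq:
  assumes P: "P \<in> prob_measures borel" and Q: "Q \<in> prob_measures borel"
    and eq: "\<And>i. (LINT x|P. test i x) = (LINT x|Q. test i x)"
  shows "P = (Q :: 'a::{metric_space,second_countable_topology} measure)"
proof (rule borel_prob_eqI[OF P Q])
  fix U :: "'a set" assume "open U"
  then obtain s :: "nat \<Rightarrow> nat" where s: "\<And>P::'a measure. P \<in> prob_measures borel \<Longrightarrow>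
     emeasure P U = (SUP n. ennreal (LINT x|P. test (s n) x))"
    using emeasure_open_SUP by blast
  show "emeasure P U = emeasure Q U" by (simp add: s P Q eq)
qed

subsection \<open>Weak convergence\<close>

text \<open>The open-set criterion of the portmanteau theorem. It passes to continuous images at
  once and fits the open superlevel sets of lower semicontinuous functions.\<close>

definition wconv :: "(nat \<Rightarrow> 'a::topological_space measure) \<Rightarrow> 'a measure \<Rightarrow> bool" where
  "wconv P Q \<longleftrightarrow> (\<forall>U. open U \<longrightarrow> emeasure Q U \<le> liminf (\<lambda>n. emeasure (P n) U))"

text \<open>One-sided bounds are enough because the mass of an open set is a supremum of test
  integrals, with the same test functions for every measure.\<close>

lemma wconvI_test:
  fixes P :: "nat \<Rightarrow> 'a::{metric_space,second_countable_topology} measure"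
  assumes P: "\<And>n. P n \<in> prob_measures borel" and Q: "Q \<in> prob_measures borel"
    and ev: "\<And>i e. 0 < e \<Longrightarrow> \<forall>\<^sub>F n in sequentially. (LINT x|Q. test i x) - e < (LINT x|P n. test i x)"
  shows "wconv P Q"
  unfolding wconv_def
proof (intro allI impI)
  fix U :: "'a set" assume "open U"
  then obtain s :: "nat \<Rightarrow> nat" where s: "\<And>P::'a measure. P \<in> prob_measures borel \<Longrightarrow>
     emeasure P U = (SUP n. ennreal (LINT x|P. test (s n) x))"
    using emeasure_open_SUP by blast
  have "ennreal (LINT x|Q. test (s m) x) \<le> liminf (\<lambda>n. emeasure (P n) U)" for m
    unfolding le_Liminf_iff
  proof (intro allI impI)
    fix y assume y: "y < ennreal (LINT x|Q. test (s m) x)"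
    then obtain r where r: "y = ennreal r" "0 \<le> r" "r < (LINT x|Q. test (s m) x)"
      by (cases y) (auto simp: ennreal_less_iff)
    have "\<forall>\<^sub>F n in sequentially. r < (LINT x|P n. test (s m) x)"
      using ev[of "(LINT x|Q. test (s m) x) - r" "s m"] r(3) by simp
    then show "\<forall>\<^sub>F n in sequentially. y < emeasure (P n) U"
    proof eventually_elim
      case (elim n)
      then have "y < ennreal (LINT x|P n. test (s m) x)" using r by (simp add: ennreal_less_iff)
      also have "\<dots> \<le> emeasure (P n) U" unfolding s[OF P] by (rule SUP_upper) simp
      finally show ?case .
    qed
  qed
  then show "emeasure Q U \<le> liminf (\<lambda>n. emeasure (P n) U)"
    unfolding s[OF Q] by (rule SUP_least)
qed

text \<open>\<open>c x\<close> is the length of the interval from 0 to \<open>c x\<close>, and the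
  two integrals are exchanged. Integrals of lower semicontinuous functions thereby reduce to masses
  of open sets.\<close>

lemma layer_cake:
  assumes P: "P \<in> prob_measures borel" and [measurable]: "c \<in> borel_measurable borel"
    and c0: "\<And>x. 0 \<le> c x"
  shows "(\<integral>\<^sup>+ x. ennreal (c x) \<partial>P) = (\<integral>\<^sup>+ t. indicator {0..} t * emeasure P {x. t < c x} \<partial>lborel)"
proof -
  interpret prob_space P using prob_measuresD[OF P] by simp
  interpret pair_sigma_finite P lborel ..
  have sp [measurable_cong]: "sets P = sets borel" and sp2: "space P = UNIV" using prob_measuresD[OF P] by auto
  have "(\<integral>\<^sup>+ x. ennreal (c x) \<partial>P) = (\<integral>\<^sup>+ x. emeasure lborel {0..<c x} \<partial>P)"
    using c0 by simp
  also have "\<dots> = (\<integral>\<^sup>+ x. (\<integral>\<^sup>+ t. indicator {0..<c x} t \<partial>lborel) \<partial>P)"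
    by simp
  also have "\<dots> = (\<integral>\<^sup>+ x. (\<integral>\<^sup>+ t. (if 0 \<le> t \<and> t < c x then 1 else 0) \<partial>lborel) \<partial>P)"
    by (intro nn_integral_cong) (auto simp: indicator_def)
  also have "\<dots> = (\<integral>\<^sup>+ t. (\<integral>\<^sup>+ x. (if 0 \<le> t \<and> t < c x then 1 else 0) \<partial>P) \<partial>lborel)"
    by (rule Fubini'[symmetric]) measurable
  also have "\<dots> = (\<integral>\<^sup>+ t. indicator {0..} t * emeasure P {x. t < c x} \<partial>lborel)"
  proof (intro nn_integral_cong)
    fix t :: real
    have "(\<integral>\<^sup>+ x. (if 0 \<le> t \<and> t < c x then 1 else 0) \<partial>P) = (\<integral>\<^sup>+ x. indicator {0..} t * indicator {x. t < c x} x \<partial>P)"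
      by (intro nn_integral_cong) (auto simp: indicator_def)
    also have "\<dots> = indicator {0..} t * emeasure P {x. t < c x}"
      by (subst nn_integral_cmult) (auto simp: sp2)
    finally show "(\<integral>\<^sup>+ x. (if 0 \<le> t \<and> t < c x then 1 else 0) \<partial>P) = indicator {0..} t * emeasure P {x. t < c x}" .
  qed
  finally show ?thesis .
qed

lemma borel_measurable_tail:
  assumes P: "P \<in> prob_measures borel" and [measurable]: "c \<in> borel_measurable borel"
  shows "(\<lambda>t::real. emeasure P {x. t < c x}) \<in> borel_measurable borel"
proof -
  have "prob_space P" "sets P = sets borel" "space P = UNIV" using prob_measuresD[OF P] by auto
  have [measurable]: "(\<lambda>t::real. P) \<in> borel \<rightarrow>\<^sub>M subprob_algebra borel"
    by (rule measurable_const)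
      (use \<open>prob_space P\<close> \<open>sets P = _\<close> in \<open>simp add: space_subprob_algebra prob_space_imp_subprob_space\<close>)
  have "Measurable.pred (borel \<Otimes>\<^sub>M borel) (\<lambda>p. fst p < c (snd p))" by measurable
  moreover have "(SIGMA t:space borel. {x. t < c x}) = {p. fst p < c (snd p)}" by auto
  ultimately have "(SIGMA t:space borel. {x. t < c x}) \<in> sets (borel \<Otimes>\<^sub>M borel)"
    by (simp add: pred_def space_pair_measure)
  then show ?thesis
    by (intro emeasure_measurable_subprob_algebra2[where N=borel]) auto
qed

text \<open>Fatou's lemma in the level variable of the layer cake formula, since each superlevel set
  is open.\<close>

lemma wconv_liminf_lsc:
  assumes P: "\<And>n. P n \<in> prob_measures borel" and Q: "Q \<in> prob_measures borel" and w: "wconv P Q"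
    and lsc: "lower_semicontinuous c" and c0: "\<And>x. 0 \<le> c x"
  shows "(\<integral>\<^sup>+ x. ennreal (c x) \<partial>Q) \<le> liminf (\<lambda>n. \<integral>\<^sup>+ x. ennreal (c x) \<partial>P n)"
proof -
  note [measurable] = measurable_lsc[OF lsc]
  note [measurable] = borel_measurable_tail[OF P measurable_lsc[OF lsc]]
  have "(\<integral>\<^sup>+ x. ennreal (c x) \<partial>Q) = (\<integral>\<^sup>+ t. indicator {0..} t * emeasure Q {x. t < c x} \<partial>lborel)"
    by (rule layer_cake[OF Q _ c0]) simp
  also have "\<dots> \<le> (\<integral>\<^sup>+ t. liminf (\<lambda>n. indicator {0..} t * emeasure (P n) {x. t < c x}) \<partial>lborel)"
  proof (intro nn_integral_mono)
    fix t :: real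
    have "emeasure Q {x. t < c x} \<le> liminf (\<lambda>n. emeasure (P n) {x. t < c x})"
      using w lsc by (simp add: wconv_def lower_semicontinuous_def)
    then show "indicator {0..} t * emeasure Q {x. t < c x} \<le>
        liminf (\<lambda>n. indicator {0..} t * emeasure (P n) {x. t < c x})"
      by (cases "0 \<le> t") auto
  qed
  also have "\<dots> \<le> liminf (\<lambda>n. \<integral>\<^sup>+ t. indicator {0..} t * emeasure (P n) {x. t < c x} \<partial>lborel)"
    by (rule nn_integral_liminf) measurable
  also have "\<dots> = liminf (\<lambda>n. \<integral>\<^sup>+ x. ennreal (c x) \<partial>P n)"
    by (simp add: layer_cake[OF P _ c0])
  finally show ?thesis .
qed

lemma integrable_bounded_borel:
  assumes P: "P \<in> prob_measures borel" and f: "f \<in> borel_measurable borel" and B: "\<And>x. \<bar>f x\<bar> \<le> (B::real)"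
  shows "integrable P f"
proof -
  interpret prob_space P using prob_measuresD[OF P] by simp
  have [measurable_cong]: "sets P = sets borel" using prob_measuresD[OF P] by simp
  show ?thesis
    using f by (intro integrable_const_bound[where B=B]) (auto intro!: AE_I2 B)
qed

text \<open>Adding the bound \<open>B\<close> makes \<open>f\<close> nonnegative, so that the liminf
  inequality applies. Used for \<open>f\<close> and for \<open>- f\<close>, this gives convergence
  of the integrals.\<close>

lemma wconv_integral_lower:
  fixes f :: "_ \<Rightarrow> real"
  assumes P: "\<And>n. P n \<in> prob_measures borel" and Q: "Q \<in> prob_measures borel" and w: "wconv P Q"
    and f: "continuous_on UNIV f" and B: "\<And>x. \<bar>f x\<bar> \<le> B" and e: "0 < e"
  shows "\<forall>\<^sub>F n in sequentially. (LINT x|Q. f x) - e < (LINT x|P n. f x)"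
proof -
  have fm: "f \<in> borel_measurable borel" by (rule borel_measurable_continuous_onI[OF f])
  have nn: "0 \<le> f x + B" for x using B[of x] by linarith
  have *: "(\<integral>\<^sup>+ x. ennreal (f x + B) \<partial>R) = ennreal ((LINT x|R. f x) + B)" "0 \<le> (LINT x|R. f x) + B"
    if R: "R \<in> prob_measures borel" for R
  proof -
    interpret prob_space R using prob_measuresD[OF R] by simp
    have i: "integrable R f" by (rule integrable_bounded_borel[OF R fm B])
    then have "(\<integral>\<^sup>+ x. ennreal (f x + B) \<partial>R) = ennreal (LINT x|R. f x + B)"
      using nn by (intro nn_integral_eq_integral) auto
    moreover have "(LINT x|R. f x + B) = (LINT x|R. f x) + B" using i by (simp add: prob_space)
    moreover have "0 \<le> (LINT x|R. f x + B)" using nn by (intro Bochner_Integration.integral_nonneg) auto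
    ultimately show "(\<integral>\<^sup>+ x. ennreal (f x + B) \<partial>R) = ennreal ((LINT x|R. f x) + B)" "0 \<le> (LINT x|R. f x) + B"
      by auto
  qed
  have "continuous_on UNIV (\<lambda>x. f x + B)" using f by (intro continuous_intros)
  then have "lower_semicontinuous (\<lambda>x. f x + B)" by (rule lsc_continuous)
  from wconv_liminf_lsc[OF P Q w this nn]
  have L: "ennreal ((LINT x|Q. f x) + B) \<le> liminf (\<lambda>n. ennreal ((LINT x|P n. f x) + B))"
    by (simp add: *[OF P] *[OF Q])
  show ?thesis
  proof (cases "(LINT x|Q. f x) - e + B < 0")
    \<comment> \<open>The target lies below the trivial lower bound \<open>- B\<close>; the case is
      separate because \<open>ennreal\<close> would truncate a negative number.\<close>
    case True
    then show ?thesis using *(2)[OF P] by (intro always_eventually allI) (smt (verit))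
  next
    case False
    then have "ennreal ((LINT x|Q. f x) - e + B) < ennreal ((LINT x|Q. f x) + B)"
      using e by (simp add: ennreal_less_iff)
    with L have "\<forall>\<^sub>F n in sequentially. ennreal ((LINT x|Q. f x) - e + B) < ennreal ((LINT x|P n. f x) + B)"
      unfolding le_Liminf_iff by blast
    then show ?thesis
      by eventually_elim (use False in \<open>simp add: ennreal_less_iff\<close>)
  qed
qed

lemma wconv_integral:
  fixes f :: "_ \<Rightarrow> real"
  assumes P: "\<And>n. P n \<in> prob_measures borel" and Q: "Q \<in> prob_measures borel" and w: "wconv P Q"
    and f: "continuous_on UNIV f" and B: "\<And>x. \<bar>f x\<bar> \<le> B"
  shows "(\<lambda>n. LINT x|P n. f x) \<longlonglongrightarrow> (LINT x|Q. f x)"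
proof (rule order_tendstoI)
  fix a assume "a < (LINT x|Q. f x)"
  then show "\<forall>\<^sub>F n in sequentially. a < (LINT x|P n. f x)"
    using wconv_integral_lower[OF P Q w f B, of "(LINT x|Q. f x) - a"] by simp
next
  fix a assume a: "(LINT x|Q. f x) < a"
  have "continuous_on UNIV (\<lambda>x. - f x)" using f by (intro continuous_intros)
  from wconv_integral_lower[OF P Q w this, of B "a - (LINT x|Q. f x)"]
  show "\<forall>\<^sub>F n in sequentially. (LINT x|P n. f x) < a" using a B by simp
qed

lemma wconv_test:
  fixes P :: "nat \<Rightarrow> 'a::{metric_space,second_countable_topology} measure"
  assumes "\<And>n. P n \<in> prob_measures borel" "Q \<in> prob_measures borel" "wconv P Q"
  shows "(\<lambda>n. LINT x|P n. test i x) \<longlonglongrightarrow> (LINT x|Q. test i x)"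
  by (rule wconv_integral[OF assms continuous_test abs_test_le_bound])

lemma wconv_unique:
  fixes P :: "nat \<Rightarrow> 'a::{metric_space,second_countable_topology} measure"
  assumes P: "\<And>n. P n \<in> prob_measures borel" and Q: "Q \<in> prob_measures borel" "wconv P Q"
    and R: "R \<in> prob_measures borel" "wconv P R"
  shows "Q = R"
  by (rule prob_eq_if_test_eq[OF Q(1) R(1)])
     (rule LIMSEQ_unique[OF wconv_test[OF P Q] wconv_test[OF P R]])

lemma distr_prob_measures:
  "P \<in> prob_measures M \<Longrightarrow> f \<in> M \<rightarrow>\<^sub>M N \<Longrightarrow> distr P N f \<in> prob_measures N"
  unfolding prob_measures_def
  using measurable_cong_sets by (auto intro!: prob_space.prob_space_distr)

lemma wconv_distr:
  fixes f :: "'a::topological_space \<Rightarrow> 'b::topological_space"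
  assumes P: "\<And>n. P n \<in> prob_measures borel" and Q: "Q \<in> prob_measures borel" and w: "wconv P Q"
    and f: "continuous_on UNIV f"
  shows "wconv (\<lambda>n. distr (P n) borel f) (distr Q borel f)"
  unfolding wconv_def
proof (intro allI impI)
  fix U assume U: "open (U :: 'b set)"
  then have o: "open (f -` U)" using f by (simp add: open_vimage)
  have m: "f \<in> R \<rightarrow>\<^sub>M borel" if "R \<in> prob_measures borel" for R
    using prob_measuresD(2)[OF that] borel_measurable_continuous_onI[OF f] measurable_cong_sets by blast
  have *: "emeasure (distr R borel f) U = emeasure R (f -` U)" if "R \<in> prob_measures borel" for R
    using emeasure_distr[OF m[OF that], of U] U prob_measuresD[OF that] by simp
  show "emeasure (distr Q borel f) U \<le> liminf (\<lambda>n. emeasure (distr (P n) borel f) U)"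
    using w o by (simp add: *[OF P] *[OF Q] wconv_def)
qed

subsection \<open>The weak topology\<close>

text \<open>Rational lower bounds on the first \<open>length qs\<close> test integrals. These
  countably many sets turn out to form a basis of the weak topology.\<close>

definition test_box :: "rat list \<Rightarrow> 'a::{metric_space,second_countable_topology} measure set" where
  "test_box qs = {P \<in> prob_measures borel. \<forall>j<length qs. of_rat (qs ! j) < (LINT x|P. test j x)}"

lemma topspace_weak [simp]: "topspace weak_topology = prob_measures (borel :: 'a::topological_space measure)"
proof -
  have "prob_measures (borel :: 'a measure) \<in> {{P \<in> prob_measures borel. (LINT x|P. f x) \<in> U} | (f :: 'a \<Rightarrow> real) U.
        continuous_on UNIV f \<and> bounded (range f) \<and> open U}"
    by (intro CollectI exI[of _ "\<lambda>_. 0"] exI[of _ UNIV]) simp_all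
  then show ?thesis unfolding weak_topology_def topology_generated_by_topspace by (intro equalityI Union_upper Union_least) auto
qed

lemma weak_open_wconv:
  assumes W: "openin weak_topology W" and Q: "Q \<in> W"
    and P: "\<And>n. P n \<in> prob_measures borel" and w: "wconv P Q"
  shows "\<forall>\<^sub>F n in sequentially. P n \<in> W"
proof -
  have QP: "Q \<in> prob_measures borel" using openin_subset[OF W] Q by auto
  show ?thesis
    using W[unfolded weak_topology_def, THEN openin_topology_generated_by] Q
  proof (induction rule: generate_topology_on.induct)
    case (Int a b)
    then show ?case by (simp add: eventually_conj)
  next
    case (UN K)
    then obtain k where "k \<in> K" "Q \<in> k" by blast
    with UN have "\<forall>\<^sub>F n in sequentially. P n \<in> k" by blast
    then show ?case by (rule eventually_mono) (use \<open>k \<in> K\<close> in blast)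
  next
    case (Basis s)
    then obtain f :: "'a \<Rightarrow> real" and U where s: "s = {P \<in> prob_measures borel. (LINT x|P. f x) \<in> U}"
      and f: "continuous_on UNIV f" "bounded (range f)" and U: "open U" by blast
    obtain B where B: "\<And>x. \<bar>f x\<bar> \<le> B" using f(2) by (auto simp: bounded_iff)
    have "(\<lambda>n. LINT x|P n. f x) \<longlonglongrightarrow> (LINT x|Q. f x)"
      by (rule wconv_integral[OF P QP w f(1) B])
    moreover have "(LINT x|Q. f x) \<in> U" using Basis s by auto
    ultimately have "\<forall>\<^sub>F n in sequentially. (LINT x|P n. f x) \<in> U" using topological_tendstoD[OF _ U] by blast
    then show ?case by (rule eventually_mono) (use P s in simp)
  qed auto
qed

text \<open>If no box around \<open>Q\<close> fitted into \<open>W\<close>, there would be measures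
  outside \<open>W\<close> in ever smaller boxes around \<open>Q\<close>; they would converge weakly
  to \<open>Q\<close> and so enter \<open>W\<close>.\<close>

lemma weak_open_box:
  assumes W: "openin weak_topology W" and Q: "Q \<in> W"
  obtains qs where "Q \<in> test_box qs" "test_box qs \<subseteq> W"
proof -
  have QP: "Q \<in> prob_measures borel" using openin_subset[OF W] Q by auto
  \<comment> \<open>Rationals below the test integrals of \<open>Q\<close> by less than
    \<open>1 / Suc n\<close>: lying in the \<open>n\<close>-th box then gives the lower bounds that
    \<open>wconvI_test\<close> asks for.\<close>
  define q :: "nat \<Rightarrow> nat \<Rightarrow> rat" where
    "q n j = (SOME q. (LINT x|Q. test j x) - 1 / Suc n < of_rat q \<and> of_rat q < (LINT x|Q. test j x))" for n j
  have "(LINT x|Q. test j x) - 1 / Suc n < of_rat (q n j) \<and> of_rat (q n j) < (LINT x|Q. test j x)" for n j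
    unfolding q_def by (rule someI_ex, rule of_rat_dense) simp
  then have q: "\<And>n j. (LINT x|Q. test j x) - 1 / Suc n < of_rat (q n j)"
    "\<And>n j. of_rat (q n j) < (LINT x|Q. test j x)" by blast+
  define qs where "qs n = map (q n) [0..<n]" for n
  have Qb: "Q \<in> test_box (qs n)" for n using QP q(2) by (auto simp: test_box_def qs_def)
  have "\<exists>n. test_box (qs n) \<subseteq> W"
  proof (rule ccontr)
    assume "\<not> ?thesis"
    then have "\<forall>n. \<exists>P. P \<in> test_box (qs n) \<and> P \<notin> W" by blast
    then obtain P where P: "\<And>n. P n \<in> test_box (qs n)" "\<And>n. P n \<notin> W" by metis
    have PP: "P n \<in> prob_measures borel" for n using P(1) by (auto simp: test_box_def)
    have "wconv P Q"
    proof (rule wconvI_test[OF PP QP])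
      fix i and e :: real assume "0 < e"
      then obtain N where N: "1 / Suc N < e" using nat_approx_posE by blast
      have "(LINT x|Q. test i x) - e < (LINT x|P n. test i x)" if "n \<ge> max N (Suc i)" for n
      proof -
        have "1 / Suc n \<le> 1 / Suc N" using that by (simp add: frac_le)
        moreover have "of_rat (q n i) < (LINT x|P n. test i x)"
          using P(1)[of n] that by (auto simp: test_box_def qs_def)
        ultimately show ?thesis using N q(1)[of i n] by linarith
      qed
      then show "\<forall>\<^sub>F n in sequentially. (LINT x|Q. test i x) - e < (LINT x|P n. test i x)"
        by (rule eventually_sequentiallyI)
    qed
    from weak_open_wconv[OF W Q PP this] P(2) show False by simp
  qed
  then show thesis using that Qb by blast
qed

lemma openin_weak_test:
  "openin weak_topology {P \<in> prob_measures (borel :: 'a::{metric_space,second_countable_topology} measure).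
     t < (LINT x|P. test j x)}"
proof -
  have b: "bounded (range (test j :: 'a \<Rightarrow> real))"
    by (rule boundedI[where B="test_bound TYPE('a) j"]) (auto simp: abs_test_le_bound)
  have "openin weak_topology {P \<in> prob_measures (borel :: 'a measure). (LINT x|P. test j x) \<in> {t<..}}"
    unfolding weak_topology_def
    by (rule topology_generated_by_Basis) (use b continuous_test open_greaterThan in blast)
  then show ?thesis by simp
qed

lemma openin_weak_emeasure:
  fixes U :: "'a::{metric_space,second_countable_topology} set"
  assumes "open U"
  shows "openin weak_topology {P \<in> prob_measures borel. t < emeasure P U}"
proof -
  obtain s :: "nat \<Rightarrow> nat" where s: "\<And>P::'a measure. P \<in> prob_measures borel \<Longrightarrow>
     emeasure P U = (SUP n. ennreal (LINT x|P. test (s n) x))"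
    using emeasure_open_SUP[OF assms] by blast
  have set_eq: "{P \<in> prob_measures borel. t < emeasure P U} =
    (\<Union>n. {P \<in> prob_measures (borel :: 'a measure). t < ennreal (LINT x|P. test (s n) x)})"
    using s by (auto simp: less_SUP_iff)
  have "openin weak_topology {P \<in> prob_measures (borel :: 'a measure). t < ennreal (LINT x|P. test (s n) x)}" for n
  proof (cases t)
    case (real u)
    have "t < ennreal r \<longleftrightarrow> u < r" for r
      using real by (cases "0 \<le> r") (auto simp: ennreal_less_iff ennreal_neg)
    then show ?thesis using openin_weak_test[of u "s n"] by simp
  next
    case top
    then show ?thesis by simp
  qed
  then have "openin weak_topology (\<Union>n. {P \<in> prob_measures (borel :: 'a measure). t < ennreal (LINT x|P. test (s n) x)})"
    by (intro openin_Union) (erule imageE, simp)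
  then show ?thesis unfolding set_eq .
qed

section \<open>Measurable maps into spaces of measures\<close>

lemma space_borel_of [simp]: "space (borel_of T) = topspace T"
  by (simp add: borel_of_def space_measure_of_conv)

lemma sets_borel_of: "sets (borel_of T) = sigma_sets (topspace T) {U. openin T U}"
  unfolding borel_of_def by (rule sets_measure_of) (auto dest: openin_subset)

lemma openin_sets_borel_of: "openin T U \<Longrightarrow> U \<in> sets (borel_of T)"
  by (simp add: sets_borel_of)

lemma measurable_borel_ofI:
  assumes "f \<in> space M \<rightarrow> topspace T" "\<And>U. openin T U \<Longrightarrow> f -` U \<inter> space M \<in> sets M"
  shows "f \<in> M \<rightarrow>\<^sub>M borel_of T"
  unfolding borel_of_def
proof (rule measurable_measure_of)
  show "{U. openin T U} \<subseteq> Pow (topspace T)" using openin_subset by blast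
qed (use assms in auto)

lemma continuous_map_measurable: "continuous_map S T f \<Longrightarrow> f \<in> borel_of S \<rightarrow>\<^sub>M borel_of T"
  by (rule measurable_borel_ofI)
    (auto simp: continuous_map_def Pi_iff Collect_conj_eq vimage_def Int_commute intro!: openin_sets_borel_of)

lemma vimage_box_sets:
  assumes "\<And>x. x \<in> space M \<Longrightarrow> f x \<in> prob_measures borel"
    and [measurable]: "\<And>i. (\<lambda>x. LINT y|f x. test i y) \<in> borel_measurable M"
  shows "f -` test_box qs \<inter> space M \<in> sets M"
proof -
  have "f -` test_box qs \<inter> space M = {x \<in> space M. \<forall>j\<in>{..<length qs}. of_rat (qs ! j) < (LINT y|f x. test j y)}"
    using assms(1) by (auto simp: test_box_def)
  also have "\<dots> \<in> sets M" by measurable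
  finally show ?thesis .
qed

text \<open>An open set of the product topology is a union of rectangles of boxes, and there are
  only countably many such rectangles. Hence the Borel sets of the product topology are controlled
  by the test integrals of the two components.\<close>

lemma measurable_subtopology_weak_prod:
  assumes K: "K \<subseteq> prob_measures borel" and L: "L \<subseteq> prob_measures borel"
    and f: "\<And>x. x \<in> space M \<Longrightarrow> f x \<in> K" "\<And>i. (\<lambda>x. LINT y|f x. test i y) \<in> borel_measurable M"
    and g: "\<And>x. x \<in> space M \<Longrightarrow> g x \<in> L" "\<And>i. (\<lambda>x. LINT y|g x. test i y) \<in> borel_measurable M"
  shows "(\<lambda>x. (f x, g x)) \<in> M \<rightarrow>\<^sub>M borel_of (prod_topology (subtopology weak_topology K) (subtopology weak_topology L))"
proof (rule measurable_borel_ofI)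
  show "(\<lambda>x. (f x, g x)) \<in> space M \<rightarrow> topspace (prod_topology (subtopology weak_topology K) (subtopology weak_topology L))"
    using f(1) g(1) K L by auto
  fix W assume W: "openin (prod_topology (subtopology weak_topology K) (subtopology weak_topology L)) W"
  let ?b = "\<lambda>(qs, rs). (test_box qs \<inter> K) \<times> (test_box rs \<inter> L)"
  define I where "I = {p. ?b p \<subseteq> W}"
  have "W = (\<Union>p\<in>I. ?b p)"
  proof
    show "W \<subseteq> (\<Union>p\<in>I. ?b p)"
    proof
      fix w assume w: "w \<in> W"
      obtain P Q where PQ: "w = (P, Q)" by (cases w)
      obtain U V where UV: "openin (subtopology weak_topology K) U" "openin (subtopology weak_topology L) V"
        "P \<in> U" "Q \<in> V" "U \<times> V \<subseteq> W"
        using iffD1[OF openin_prod_topology_alt W, rule_format, OF w[unfolded PQ]] by metis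
      obtain U' where U': "openin weak_topology U'" "U = U' \<inter> K"
        using UV(1) unfolding openin_subtopology by metis
      obtain V' where V': "openin weak_topology V'" "V = V' \<inter> L"
        using UV(2) unfolding openin_subtopology by metis
      have PU: "P \<in> U'" "P \<in> K" and QV: "Q \<in> V'" "Q \<in> L" using UV U' V' by simp_all
      obtain qs where qs: "P \<in> test_box qs" "test_box qs \<subseteq> U'" using weak_open_box[OF U'(1) PU(1)] by metis
      obtain rs where rs: "Q \<in> test_box rs" "test_box rs \<subseteq> V'" using weak_open_box[OF V'(1) QV(1)] by metis
      have "?b (qs, rs) \<subseteq> U \<times> V" using qs(2) rs(2) U'(2) V'(2) by blast
      then have "(qs, rs) \<in> I" using UV(5) unfolding I_def by blast
      moreover have "w \<in> ?b (qs, rs)" using qs rs PU QV by (simp add: PQ)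
      ultimately show "w \<in> (\<Union>p\<in>I. ?b p)" by blast
    qed
  qed (auto simp: I_def)
  then have "(\<lambda>x. (f x, g x)) -` W \<inter> space M = (\<Union>p\<in>I. (f -` test_box (fst p) \<inter> space M) \<inter> (g -` test_box (snd p) \<inter> space M))"
    using f(1) g(1) by (auto simp: case_prod_beta')
  also have "\<dots> \<in> sets M"
  proof (rule sets.countable_UN'', simp, rule sets.Int)
    show "f -` test_box (fst p) \<inter> space M \<in> sets M" for p
      using f(1) K by (blast intro: vimage_box_sets f(2))
    show "g -` test_box (snd p) \<inter> space M \<in> sets M" for p
      using g(1) L by (blast intro: vimage_box_sets g(2))
  qed
  finally show "(\<lambda>x. (f x, g x)) -` W \<inter> space M \<in> sets M" .
qed

text \<open>The first projection of the diagonal map into the product.\<close>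

lemma measurable_subtopology_weak:
  assumes K: "K \<subseteq> prob_measures borel"
    and f: "\<And>x. x \<in> space M \<Longrightarrow> f x \<in> K" "\<And>i. (\<lambda>x. LINT y|f x. test i y) \<in> borel_measurable M"
  shows "f \<in> M \<rightarrow>\<^sub>M borel_of (subtopology weak_topology K)"
proof -
  have "(\<lambda>x. (f x, f x)) \<in> M \<rightarrow>\<^sub>M borel_of (prod_topology (subtopology weak_topology K) (subtopology weak_topology K))"
    by (rule measurable_subtopology_weak_prod[OF K K f f])
  moreover have "fst \<in> borel_of (prod_topology (subtopology weak_topology K) (subtopology weak_topology K)) \<rightarrow>\<^sub>M borel_of (subtopology weak_topology K)"
    by (rule continuous_map_measurable) (rule continuous_map_fst)
  ultimately have "(\<lambda>x. fst (f x, f x)) \<in> M \<rightarrow>\<^sub>M borel_of (subtopology weak_topology K)"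
    by (rule measurable_compose)
  then show ?thesis by simp
qed

text \<open>The mass of an open set is lower semicontinuous in the measure, and open sets are an
  intersection-stable generator. Through this map a measure on measures becomes a mixture that
  \<open>bind\<close> can form.\<close>

lemma measurable_weak_prob_algebra:
  fixes K :: "'a::{metric_space,second_countable_topology} measure set"
  assumes K: "K \<subseteq> prob_measures borel"
  shows "(\<lambda>P. P) \<in> borel_of (subtopology weak_topology K) \<rightarrow>\<^sub>M prob_algebra borel"
proof (rule measurable_prob_algebra_generated[where G="{U. open U}" and \<Omega>=UNIV])
  show "sets borel = sigma_sets UNIV {U::'a set. open U}" by (simp add: borel_def)
  show "Int_stable {U::'a set. open U}" by (auto simp: Int_stable_def)
next
  fix P assume "P \<in> space (borel_of (subtopology weak_topology K))"
  then show "prob_space P" "sets P = sets borel" by (auto simp: prob_measures_def)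
next
  fix U :: "'a set" assume "U \<in> {U. open U}"
  then have "openin (subtopology weak_topology K) ({P \<in> prob_measures borel. t < emeasure P U} \<inter> K)" for t
    using openin_weak_emeasure[of U t] by (auto simp: openin_subtopology)
  then have "{P \<in> prob_measures borel. t < emeasure P U} \<inter> K \<in> sets (borel_of (subtopology weak_topology K))" for t
    by (rule openin_sets_borel_of)
  moreover have "{P \<in> prob_measures borel. t < emeasure P U} \<inter> K = {P \<in> space (borel_of (subtopology weak_topology K)). t < emeasure P U}" for t
    by auto
  ultimately show "(\<lambda>P. emeasure P U) \<in> borel_measurable (borel_of (subtopology weak_topology K))"
    by (intro borel_measurableI_greater) simp
qed auto

subsection \<open>Prokhorov's theorem\<close>

text \<open>Compactness of the cube of all functions from sets to \<open>[0, 1]\<close>, by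
  Tychonoff's theorem. The cluster point is approached for finitely many sets at a time, arbitrarily
  late in the sequence; its countable additivity is not claimed.\<close>

lemma setwise_cluster_point:
  fixes P :: "nat \<Rightarrow> 'a measure"
  assumes P: "\<And>n. prob_space (P n)"
  obtains l :: "'a set \<Rightarrow> real" where
    "\<And>F e N. finite F \<Longrightarrow> 0 < e \<Longrightarrow> \<exists>n\<ge>N. \<forall>A\<in>F. \<bar>measure (P n) A - l A\<bar> < e"
proof -
  define S :: "('a set \<Rightarrow> real) set" where "S = PiE UNIV (\<lambda>_. {0..1})"
  have "compactin (product_topology (\<lambda>_. euclidean) UNIV) S"
    unfolding S_def compactin_PiE by simp
  then have "compact S" by (simp add: euclidean_product_topology)
  define G where "G = filtermap (\<lambda>n A. measure (P n) A) sequentially"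
  have "measure (P n) \<in> S" for n
    using prob_space.prob_le_1[OF P] by (auto simp: S_def)
  then have "eventually (\<lambda>x. x \<in> S) G" by (simp add: G_def eventually_filtermap)
  moreover have "G \<noteq> bot" by (simp add: G_def filtermap_bot_iff)
  ultimately obtain l where l: "inf (nhds l) G \<noteq> bot"
    using \<open>compact S\<close> unfolding compact_filter by blast
  show thesis
  proof (rule that[of l])
    fix F :: "'a set set" and e :: real and N assume F: "finite F" and e: "0 < e"
    show "\<exists>n\<ge>N. \<forall>A\<in>F. \<bar>measure (P n) A - l A\<bar> < e"
    proof (rule ccontr)
      assume neg: "\<not> ?thesis"
      have "open (\<Inter>A\<in>F. {f. \<bar>f A - l A\<bar> < e})"
        using F by (intro open_INT ballI open_Collect_less continuous_intros) auto
      then have "eventually (\<lambda>f. f \<in> (\<Inter>A\<in>F. {f. \<bar>f A - l A\<bar> < e})) (nhds l)"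
        using e by (intro eventually_nhds_in_open) auto
      moreover have "eventually (\<lambda>f. f \<notin> (\<Inter>A\<in>F. {f. \<bar>f A - l A\<bar> < e})) G"
        unfolding G_def eventually_filtermap
        by (rule eventually_sequentiallyI[of N]) (use neg in auto)
      ultimately have "eventually (\<lambda>f. False) (inf (nhds l) G)"
        unfolding eventually_inf by blast
      with l show False by (simp add: trivial_limit_def)
    qed
  qed
qed

text \<open>The cluster point \<open>l\<close> is finitely additive on Borel sets. On the algebra of
  its continuity sets, tightness makes it continuous at the empty set, and Caratheodory's theorem
  yields the measure \<open>Q\<close>. This algebra contains enough balls to generate the Borel
  sets. The subsequence is then chosen so as to follow \<open>l\<close> on a countable family of
  open sets. The condition \<open>k \<le> r k\<close> expresses that the chosen indices tend to
  infinity.\<close>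

lemma prokhorov:
  fixes P :: "nat \<Rightarrow> 'a::{metric_space,second_countable_topology} measure"
  assumes P: "\<And>n. P n \<in> prob_measures borel"
    and tight: "\<And>e. 0 < e \<Longrightarrow> \<exists>K. compact K \<and> (\<forall>\<^sub>F n in sequentially. 1 - e \<le> measure (P n) K)"
  obtains r :: "nat \<Rightarrow> nat" and Q where "\<And>k. k \<le> r k" "Q \<in> prob_measures borel" "wconv (\<lambda>k. P (r k)) Q"
proof -
  have ps: "prob_space (P n)" and ss: "sets (P n) = sets borel" and sp: "space (P n) = UNIV" for n
    using prob_measuresD[OF P[of n]] by auto
  obtain l :: "'a set \<Rightarrow> real" where l:
    "\<And>F e N. finite F \<Longrightarrow> 0 < e \<Longrightarrow> \<exists>n\<ge>N. \<forall>A\<in>F. \<bar>measure (P n) A - l A\<bar> < e"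
    using setwise_cluster_point[of P, OF ps] by blast
  \<comment> \<open>A single \<open>n\<close> approximates all three values of \<open>l\<close>, so
    additivity of \<open>P n\<close> carries over up to \<open>e\<close>.\<close>
  have l_add: "l (A \<union> B) = l A + l B"
    if "A \<in> sets borel" "B \<in> sets borel" "A \<inter> B = {}" for A B
  proof -
    have "\<bar>l (A \<union> B) - (l A + l B)\<bar> \<le> e" if "0 < e" for e
    proof -
      obtain n where n: "\<forall>C\<in>{A, B, A \<union> B}. \<bar>measure (P n) C - l C\<bar> < e / 3"
        using l[of "{A, B, A \<union> B}" "e / 3" 0] \<open>0 < e\<close> by auto
      interpret prob_space "P n" by (rule ps)
      have "measure (P n) (A \<union> B) = measure (P n) A + measure (P n) B"
        using \<open>A \<in> _\<close> \<open>B \<in> _\<close> \<open>A \<inter> B = {}\<close> by (intro finite_measure_Union) (auto simp: ss)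
      then show ?thesis using n by (auto simp: abs_if split: if_splits)
    qed
    then have "\<bar>l (A \<union> B) - (l A + l B)\<bar> \<le> 0" by (rule field_le_epsilon[of _ 0, simplified])
    then show ?thesis by simp
  qed
  have l_nonneg: "0 \<le> l A" for A
  proof (rule field_le_epsilon)
    fix e :: real assume "0 < e"
    then obtain n where n: "\<bar>measure (P n) A - l A\<bar> < e" using l[of "{A}" e 0] by auto
    then show "0 \<le> l A + e" using measure_nonneg[of "P n" A] by linarith
  qed
  have l_UNIV: "l UNIV = 1"
  proof -
    have "\<bar>l UNIV - 1\<bar> \<le> e" if "0 < e" for e
    proof -
      obtain n where n: "\<bar>measure (P n) UNIV - l UNIV\<bar> < e" using l[of "{UNIV}" e 0] \<open>0 < e\<close> by auto
      moreover have "measure (P n) UNIV = 1" using prob_space.prob_space[OF ps[of n]] sp[of n] by simp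
      ultimately show ?thesis by simp
    qed
    then have "\<bar>l UNIV - 1\<bar> \<le> 0" by (rule field_le_epsilon[of _ 0, simplified])
    then show ?thesis by simp
  qed
  have l_ge: "c \<le> l A" if ev: "\<forall>\<^sub>F n in sequentially. c \<le> measure (P n) A" for c A
  proof (rule field_le_epsilon)
    fix e :: real assume "0 < e"
    obtain N where "\<And>n. n \<ge> N \<Longrightarrow> c \<le> measure (P n) A"
      using ev by (auto simp: eventually_sequentially)
    moreover obtain n where "n \<ge> N" "\<bar>measure (P n) A - l A\<bar> < e"
      using l[of "{A}" e N] \<open>0 < e\<close> by auto
    ultimately show "c \<le> l A + e" by fastforce
  qed
  have l_empty: "l {} = 0" using l_add[of "{}" "{}"] by simp
  have l_mono: "l A \<le> l B" if "A \<subseteq> B" "A \<in> sets borel" "B \<in> sets borel" for A B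
    using l_add[of A "B - A"] l_nonneg[of "B - A"] that by (simp add: Un_absorb1)
  have l_diff: "l (B - A) = l B - l A" if "A \<subseteq> B" "A \<in> sets borel" "B \<in> sets borel" for A B
    using l_add[of A "B - A"] that by (simp add: Un_absorb1)
  have l_subadd: "l (A \<union> B) \<le> l A + l B" if "A \<in> sets borel" "B \<in> sets borel" for A B
    using l_add[of A "B - A"] l_mono[of "B - A" B] that by simp
  have l_sum: "l (\<Union>i\<in>I. A i) \<le> (\<Sum>i\<in>I. l (A i))" if "finite I" "\<And>i. i \<in> I \<Longrightarrow> A i \<in> sets borel" for I :: "nat set" and A
    using that
  proof (induction I rule: finite_induct)
    case (insert i I)
    have "l (A i \<union> (\<Union>i\<in>I. A i)) \<le> l (A i) + l (\<Union>i\<in>I. A i)"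
      using insert by (intro l_subadd sets.finite_UN) auto
    then show ?case using insert by fastforce
  qed (simp add: l_empty)
  \<comment> \<open>the continuity sets of \<open>l\<close>, on which tightness makes \<open>l\<close> continuous at the empty set\<close>
  define AA where "AA = {A \<in> sets borel. \<forall>e>0. \<exists>C V. closed C \<and> open V \<and> C \<subseteq> A \<and> A \<subseteq> V \<and> l (V - C) < e}"
  have AA_borel: "A \<in> sets borel" if "A \<in> AA" for A using that by (simp add: AA_def)
  have AA_E: "\<exists>C V. closed C \<and> open V \<and> C \<subseteq> A \<and> A \<subseteq> V \<and> l (V - C) < e" if "A \<in> AA" "0 < e" for A e
    using that by (simp add: AA_def)
  interpret AA: algebra UNIV AA
    unfolding algebra_iff_Un
  proof (intro conjI ballI)
    show "{} \<in> AA" by (auto simp: AA_def l_empty intro!: exI[of _ "{}"])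
    fix A assume A: "A \<in> AA"
    show "UNIV - A \<in> AA"
      unfolding AA_def
    proof (intro CollectI conjI allI impI)
      show "UNIV - A \<in> sets borel" using AA_borel[OF A] by (intro sets.Diff) auto
      fix e :: real assume "0 < e"
      then obtain C V where "closed C" "open V" "C \<subseteq> A" "A \<subseteq> V" "l (V - C) < e" using AA_E[OF A, of e] by metis
      moreover have "- C - (- V) = V - C" by auto
      ultimately show "\<exists>C V. closed C \<and> open V \<and> C \<subseteq> UNIV - A \<and> UNIV - A \<subseteq> V \<and> l (V - C) < e"
        by (intro exI[of _ "- V"] exI[of _ "- C"]) (auto simp: closed_def)
    qed
    fix B assume B: "B \<in> AA"
    show "A \<union> B \<in> AA"
      unfolding AA_def
    proof (intro CollectI conjI allI impI)
      show "A \<union> B \<in> sets borel" using AA_borel A B by auto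
      fix e :: real assume "0 < e"
      then obtain C V where CV: "closed C" "open V" "C \<subseteq> A" "A \<subseteq> V" "l (V - C) < e / 2"
        using AA_E[OF A, of "e / 2"] by (metis half_gt_zero)
      obtain D W where DW: "closed D" "open W" "D \<subseteq> B" "B \<subseteq> W" "l (W - D) < e / 2"
        using AA_E[OF B, of "e / 2"] \<open>0 < e\<close> by (metis half_gt_zero)
      have "l ((V \<union> W) - (C \<union> D)) \<le> l ((V - C) \<union> (W - D))"
        using CV DW by (intro l_mono sets.Diff sets.Un) auto
      also have "\<dots> \<le> l (V - C) + l (W - D)" using CV DW by (intro l_subadd) auto
      also have "\<dots> < e" using CV DW by linarith
      finally show "\<exists>C V. closed C \<and> open V \<and> C \<subseteq> A \<union> B \<and> A \<union> B \<subseteq> V \<and> l (V - C) < e"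
        using CV DW by (intro exI[of _ "C \<union> D"] exI[of _ "V \<union> W"]) auto
    qed
  qed auto
  \<comment> \<open>Suppose that all masses stay at least \<open>e\<close>. Closed subsets
    \<open>C i\<close> of \<open>A i\<close> losing less than \<open>e / 4 * (1 / 2) ^ i\<close> and
    a compact \<open>K\<close> missing mass at most \<open>e / 4\<close> lose at most
    \<open>3 * e / 4\<close> altogether, so all finite intersections inside \<open>K\<close> are
    nonempty. By compactness the \<open>C i\<close>, and with them the \<open>A i\<close>, have a
    common point.\<close>
  have cont: "(\<lambda>i. ennreal (l (A i))) \<longlonglongrightarrow> 0" if A: "range A \<subseteq> AA" "decseq A" "(\<Inter>i. A i) = {}" for A
  proof -
    have Ab: "A i \<in> sets borel" for i using A(1) AA_borel by blast
    have small: "\<exists>i. l (A i) < e" if e: "0 < e" for e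
    proof (rule ccontr)
      assume "\<not> ?thesis"
      then have big: "e \<le> l (A i)" for i by (simp add: not_less)
      have "\<forall>i. \<exists>C. closed C \<and> C \<subseteq> A i \<and> l (A i - C) < e / 4 * (1 / 2) ^ i"
      proof
        fix i
        have "0 < e / 4 * (1 / 2) ^ i" using e by simp
        then obtain C V where CV: "closed C" "open V" "C \<subseteq> A i" "A i \<subseteq> V" "l (V - C) < e / 4 * (1 / 2) ^ i"
          using AA_E[of "A i" "e / 4 * (1 / 2) ^ i"] A(1) by (metis rangeI subsetD)
        have "l (A i - C) \<le> l (V - C)" using CV Ab[of i] by (intro l_mono) auto
        then show "\<exists>C. closed C \<and> C \<subseteq> A i \<and> l (A i - C) < e / 4 * (1 / 2) ^ i"
          using CV by (intro exI[of _ C]) auto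
      qed
      then obtain C where C: "\<And>i. closed (C i)" "\<And>i. C i \<subseteq> A i" "\<And>i. l (A i - C i) < e / 4 * (1 / 2) ^ i"
        by metis
      have "0 < e / 4" using e by simp
      from tight[OF this] obtain K where K: "compact K" "1 - e / 4 \<le> l K" using l_ge by blast
      have Kb: "K \<in> sets borel" using K by (simp add: compact_imp_closed)
      define D where "D i = K \<inter> (\<Inter>j\<in>{..i}. C j)" for i
      have Dne: "D i \<noteq> {}" for i
      proof
        assume "D i = {}"
        have "A i \<subseteq> (D i \<union> (UNIV - K)) \<union> (\<Union>j\<in>{..i}. A j - C j)"
          using A(2) by (auto simp: D_def decseq_def)
        then have "l (A i) \<le> l ((D i \<union> (UNIV - K)) \<union> (\<Union>j\<in>{..i}. A j - C j))"
          using Ab Kb C(1) \<open>D i = {}\<close> by (intro l_mono sets.Un sets.finite_UN sets.Diff) auto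
        also have "\<dots> \<le> l (UNIV - K) + l (\<Union>j\<in>{..i}. A j - C j)"
          using Ab Kb C(1) \<open>D i = {}\<close> by (simp, intro l_subadd sets.finite_UN sets.Diff) auto
        also have "l (\<Union>j\<in>{..i}. A j - C j) \<le> (\<Sum>j\<in>{..i}. l (A j - C j))"
          using Ab C(1) by (intro l_sum sets.Diff) auto
        also have "\<dots> \<le> (\<Sum>j\<in>{..i}. e / 4 * (1 / 2) ^ j)"
          using C(3) by (intro sum_mono less_imp_le)
        also have "\<dots> \<le> e / 2"
        proof -
          have "(\<Sum>j\<in>{..i}. (1 / 2 :: real) ^ j) = 2 - (1 / 2) ^ i"
            by (induction i) auto
          then have "(\<Sum>j\<in>{..i}. (1 / 2 :: real) ^ j) \<le> 2" by simp
          from mult_left_mono[OF this, of "e / 4"] e show ?thesis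
            by (simp add: sum_distrib_left)
        qed
        also have "l (UNIV - K) = 1 - l K" using Kb l_diff[of K UNIV] by (simp add: l_UNIV)
        finally show False using big[of i] K(2) e by simp
      qed
      have "K \<inter> (\<Inter>i\<in>UNIV. C i) \<noteq> {}"
      proof (rule compact_imp_fip_image[OF K(1)])
        fix I' :: "nat set" assume "finite I'"
        then have "D (Max (insert 0 I')) \<subseteq> K \<inter> (\<Inter>i\<in>I'. C i)" by (auto simp: D_def)
        then show "K \<inter> (\<Inter>i\<in>I'. C i) \<noteq> {}" using Dne by blast
      qed (use C(1) in simp)
      moreover have "(\<Inter>i. C i) \<subseteq> (\<Inter>i. A i)" using C(2) by (intro INT_greatest) (meson INT_E UNIV_I subsetD subsetI order_trans INF_lower)
      ultimately show False unfolding A(3) by simp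
    qed
    have "(\<lambda>i. l (A i)) \<longlonglongrightarrow> 0"
    proof (rule LIMSEQ_I)
      fix e :: real assume "0 < e"
      then obtain i where i: "l (A i) < e" using small by blast
      have "l (A n) < e" if "i \<le> n" for n
        using l_mono[of "A n" "A i"] Ab A(2) that i by (force simp: decseq_def)
      then show "\<exists>no. \<forall>n\<ge>no. norm (l (A n) - 0) < e" using l_nonneg by auto
    qed
    then show ?thesis using tendsto_ennrealI[of "\<lambda>i. l (A i)" 0] by simp
  qed
  have "\<exists>\<mu> :: 'a set \<Rightarrow> ennreal. (\<forall>s\<in>AA. \<mu> s = ennreal (l s)) \<and> measure_space UNIV (sigma_sets UNIV AA) \<mu>"
  proof (rule AA.caratheodory_empty_continuous)
    show "positive AA (\<lambda>s. ennreal (l s))" by (simp add: positive_def l_empty)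
    show "additive AA (\<lambda>s. ennreal (l s))"
      by (auto simp: additive_def l_add AA_borel l_nonneg ennreal_plus[symmetric] simp del: ennreal_plus)
  qed (use cont in auto)
  then obtain \<mu> :: "'a set \<Rightarrow> ennreal" where \<mu>: "\<And>s. s \<in> AA \<Longrightarrow> \<mu> s = ennreal (l s)"
    and ms: "measure_space UNIV (sigma_sets UNIV AA) \<mu>" by blast
  \<comment> \<open>The mass of a ball is monotone in the radius, hence continuous at all but
    countably many radii. At such a radius, a slightly smaller closed ball and a slightly larger
    open ball show that the ball is a continuity set.\<close>
  have small_balls: "\<exists>r. 0 < r \<and> r < e \<and> ball x r \<in> AA" if e: "0 < e" for x e
  proof -
    define g where "g r = l (ball x r)" for r
    have "mono g" unfolding g_def by (intro monoI l_mono) auto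
    then have "countable {r. \<not> isCont g r}" by (rule mono_ctble_discont)
    moreover have "uncountable {0<..<e}" using e by (simp add: uncountable_open_interval)
    ultimately have "\<not> {0<..<e} \<subseteq> {r. \<not> isCont g r}" using countable_subset by blast
    then obtain r where r: "0 < r" "r < e" "isCont g r" by auto
    have "ball x r \<in> AA"
      unfolding AA_def
    proof (intro CollectI conjI allI impI)
      fix d :: real assume "0 < d"
      then obtain s where s: "s > 0" "\<And>y. dist y r < s \<Longrightarrow> dist (g y) (g r) < d / 2"
        using r(3) half_gt_zero unfolding continuous_at_eps_delta by metis
      define t where "t = s / 2"
      have t: "\<bar>g (r + t) - g r\<bar> < d / 2" "\<bar>g (r - t) - g r\<bar> < d / 2" "0 < t"
        using s(2)[of "r + t"] s(2)[of "r - t"] s(1) by (auto simp: t_def dist_real_def)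
      have sub: "ball x (r - t) \<subseteq> ball x (r + t)" using t by (intro subset_ball) simp
      have "l (ball x (r + t) - cball x (r - t)) \<le> l (ball x (r + t) - ball x (r - t))"
        by (intro l_mono) auto
      also have "\<dots> = g (r + t) - g (r - t)" unfolding g_def using sub by (intro l_diff) auto
      also have "\<dots> < d" using t by linarith
      finally show "\<exists>C V. closed C \<and> open V \<and> C \<subseteq> ball x r \<and> ball x r \<subseteq> V \<and> l (V - C) < d"
        using t(3) by (intro exI[of _ "cball x (r - t)"] exI[of _ "ball x (r + t)"]) auto
    qed simp
    with r show ?thesis by blast
  qed
  have cover: "\<exists>F. F \<subseteq> AA \<and> countable F \<and> \<Union>F = U" if U: "open U" for U
  proof -
    define F where "F = {B \<in> AA. open B \<and> B \<subseteq> U}"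
    obtain F' where F': "F' \<subseteq> F" "countable F'" "\<Union>F' = \<Union>F"
      using Lindelof[of F] by (auto simp: F_def)
    have "U \<subseteq> \<Union>F"
    proof
      fix x assume "x \<in> U"
      then obtain e where e: "0 < e" "ball x e \<subseteq> U" using U openE by blast
      obtain r where r: "0 < r" "r < e" "ball x r \<in> AA" using small_balls[OF e(1)] by blast
      have "ball x r \<subseteq> ball x e" using r by (intro subset_ball) simp
      then have "ball x r \<in> F" using r e by (auto simp: F_def)
      moreover have "x \<in> ball x r" using r by simp
      ultimately show "x \<in> \<Union>F" by blast
    qed
    moreover have "\<Union>F \<subseteq> U" by (auto simp: F_def)
    ultimately show ?thesis using F' by (intro exI[of _ F']) (auto simp: F_def)
  qed
  have sigma: "sigma_sets UNIV AA = sets borel"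
  proof
    show "sigma_sets UNIV AA \<subseteq> sets borel"
      using sets.sigma_sets_subset[of AA borel] AA_borel by auto
    have "U \<in> sigma_sets UNIV AA" if "open U" for U
    proof -
      obtain F where "F \<subseteq> AA" "countable F" "\<Union>F = U" using cover[OF \<open>open U\<close>] by blast
      then show ?thesis using sigma_sets_UNION[of F UNIV AA] by auto
    qed
    then have "sigma_sets UNIV {U. open U} \<subseteq> sigma_sets UNIV AA"
      by (intro sigma_sets_mono) auto
    then show "sets borel \<subseteq> sigma_sets UNIV AA" by (simp add: borel_def)
  qed
  define Q where "Q = measure_of UNIV AA \<mu>"
  have setsQ: "sets Q = sets borel" by (simp add: Q_def sigma[symmetric])
  have spaceQ: "space Q = UNIV" by (simp add: Q_def space_measure_of_conv)
  have Q_AA: "emeasure Q A = ennreal (l A)" if "A \<in> AA" for A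
  proof -
    have "emeasure Q A = \<mu> A"
      unfolding Q_def
    proof (rule emeasure_measure_of)
      show "AA \<subseteq> Pow UNIV" by simp
      show "A \<in> sets (measure_of UNIV AA \<mu>)" using that by simp
      show "positive (sets (measure_of UNIV AA \<mu>)) \<mu>" "countably_additive (sets (measure_of UNIV AA \<mu>)) \<mu>"
        using ms by (simp_all add: measure_space_def)
    qed simp
    then show ?thesis using \<mu>[OF that] by simp
  qed
  have QP: "Q \<in> prob_measures borel"
    unfolding prob_measures_def
  proof (intro CollectI conjI setsQ prob_spaceI)
    show "emeasure Q (space Q) = 1" using Q_AA[OF AA.top] by (simp add: spaceQ l_UNIV)
  qed
  \<comment> \<open>\<open>Q\<close> is continuous along the increasing union of continuity sets
    that fills \<open>U\<close>, whereas \<open>l\<close> is merely monotone. So only an inequality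
    results, in the direction that weak convergence requires.\<close>
  have Q_le: "emeasure Q U \<le> ennreal (l U)" if U: "open U" for U
  proof -
    obtain F where F: "F \<subseteq> AA" "countable F" "\<Union>F = U" using cover[OF U] by blast
    show ?thesis
    proof (cases "F = {}")
      case True
      then show ?thesis using F by auto
    next
      case False
      define B where "B n = (\<Union>i\<in>{..n::nat}. from_nat_into F i)" for n
      have fF: "from_nat_into F i \<in> F" for i using False by (rule from_nat_into)
      have BA: "B n \<in> AA" for n unfolding B_def using fF F(1) by (intro AA.finite_UN) auto
      have BU: "(\<Union>n. B n) = U"
      proof -
        have "(\<Union>n. B n) = \<Union>(range (from_nat_into F))" by (auto simp: B_def)
        then show ?thesis using F False by (simp add: range_from_nat_into)
      qed
      have "incseq B" by (auto simp: B_def incseq_def intro: order_trans)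
      then have "emeasure Q U = (SUP n. emeasure Q (B n))"
        using SUP_emeasure_incseq[of B Q] AA_borel[OF BA] BU by (simp add: setsQ image_subset_iff)
      also have "\<dots> \<le> ennreal (l U)"
        using BA AA_borel BU U by (intro SUP_least) (auto simp: Q_AA intro!: ennreal_leI l_mono)
      finally show ?thesis .
    qed
  qed
  obtain \<B> :: "'a set set" where \<B>: "countable \<B>" "topological_basis \<B>"
    using ex_countable_basis by blast
  \<comment> \<open>Finite unions of basis sets are countably many, and every open set is an
    increasing union of them. Stage \<open>k\<close> of the subsequence approximates
    \<open>l\<close> on the first \<open>k + 1\<close> of them, which yields convergence on each
    one.\<close>
  define \<W> where "\<W> = (\<lambda>s. \<Union>(set s)) ` lists \<B>"
  have "countable \<W>" "\<W> \<noteq> {}" using \<B>(1) by (auto simp: \<W>_def)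
  define w where "w = from_nat_into \<W>"
  have rw: "range w = \<W>" using \<open>countable \<W>\<close> \<open>\<W> \<noteq> {}\<close> by (simp add: w_def)
  have w_open: "open (w j)" for j
  proof -
    have "w j \<in> \<W>" using rw by blast
    then show ?thesis using topological_basis_open[OF \<B>(2)]
      by (auto simp: \<W>_def intro!: open_Union)
  qed
  have "\<forall>k. \<exists>n\<ge>k. \<forall>A\<in>w ` {..k}. \<bar>measure (P n) A - l A\<bar> < 1 / Suc k"
    by (intro allI l) auto
  then obtain r where r: "\<And>k. k \<le> r k" "\<And>k j. j \<le> k \<Longrightarrow> \<bar>measure (P (r k)) (w j) - l (w j)\<bar> < 1 / Suc k"
    by (metis atMost_iff imageI)
  have w_lim: "emeasure Q (w j) \<le> liminf (\<lambda>k. emeasure (P (r k)) (w j))" for j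
  proof -
    have "(\<lambda>k. measure (P (r k)) (w j) - l (w j)) \<longlonglongrightarrow> 0"
    proof (rule Lim_null_comparison)
      show "\<forall>\<^sub>F k in sequentially. norm (measure (P (r k)) (w j) - l (w j)) \<le> 1 / Suc k"
        using eventually_ge_at_top[of j] by eventually_elim (use r(2) in \<open>force intro: less_imp_le\<close>)
      show "(\<lambda>k. 1 / real (Suc k)) \<longlonglongrightarrow> 0" using LIMSEQ_inverse_real_of_nat by (simp add: inverse_eq_divide)
    qed
    then have "(\<lambda>k. measure (P (r k)) (w j)) \<longlonglongrightarrow> l (w j)" by (simp add: LIM_zero_iff)
    then have "(\<lambda>k. ennreal (measure (P (r k)) (w j))) \<longlonglongrightarrow> ennreal (l (w j))" by (rule tendsto_ennrealI)
    then have "liminf (\<lambda>k. ennreal (measure (P (r k)) (w j))) = ennreal (l (w j))"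
      by (intro lim_imp_Liminf) auto
    moreover have "emeasure (P n) A = ennreal (measure (P n) A)" for n A
      by (rule finite_measure.emeasure_eq_measure) (rule prob_space.finite_measure[OF ps])
    ultimately show ?thesis using Q_le[OF w_open[of j]] by simp
  qed
  have "wconv (\<lambda>k. P (r k)) Q"
    unfolding wconv_def
  proof (intro allI impI)
    fix U :: "'a set" assume U: "open U"
    define F where "F = {B \<in> \<B>. B \<subseteq> U}"
    have FU: "\<Union>F = U"
    proof
      show "U \<subseteq> \<Union>F"
      proof
        fix x assume "x \<in> U"
        then obtain B where "B \<in> \<B>" "x \<in> B" "B \<subseteq> U" using topological_basisE[OF \<B>(2) U] by metis
        then show "x \<in> \<Union>F" by (auto simp: F_def)
      qed
    qed (auto simp: F_def)
    have "countable F" using \<B>(1) by (auto simp: F_def intro: countable_subset)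
    show "emeasure Q U \<le> liminf (\<lambda>k. emeasure (P (r k)) U)"
    proof (cases "F = {}")
      case True
      then show ?thesis using FU by auto
    next
      case False
      define B where "B n = \<Union>(set (map (from_nat_into F) [0..<n]))" for n
      have fF: "from_nat_into F i \<in> F" for i using False by (rule from_nat_into)
      have "B n \<in> \<W>" for n
        unfolding B_def \<W>_def by (rule imageI) (use fF in \<open>auto simp: F_def\<close>)
      then have Bw: "\<exists>j. B n = w j" for n using rw by (metis imageE)
      have BU: "(\<Union>n. B n) = U"
      proof -
        have "(\<Union>n. B n) = \<Union>(range (from_nat_into F))" by (force simp: B_def)
        then show ?thesis using FU False \<open>countable F\<close> by (simp add: range_from_nat_into)
      qed
      have Bs: "B n \<in> sets borel" for n using Bw w_open by (metis borel_open)
      have "incseq B" by (force simp: B_def incseq_def)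
      then have "emeasure Q U = (SUP n. emeasure Q (B n))"
        using SUP_emeasure_incseq[of B Q] Bs BU by (simp add: setsQ image_subset_iff)
      also have "\<dots> \<le> liminf (\<lambda>k. emeasure (P (r k)) U)"
      proof (rule SUP_least)
        fix n
        obtain j where j: "B n = w j" using Bw by blast
        have "emeasure Q (B n) \<le> liminf (\<lambda>k. emeasure (P (r k)) (w j))" unfolding j by (rule w_lim)
        also have "\<dots> \<le> liminf (\<lambda>k. emeasure (P (r k)) U)"
          using j BU U by (intro Liminf_mono always_eventually allI emeasure_mono) (auto simp: ss)
        finally show "emeasure Q (B n) \<le> liminf (\<lambda>k. emeasure (P (r k)) U)" .
      qed
      finally show ?thesis .
    qed
  qed
  with r(1) QP show thesis by (rule that)
qed

text \<open>By separability, finitely many balls of radius \<open>1 / Suc k\<close> carry most of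
  the mass of the limit, hence of all but finitely many \<open>P n\<close>; adding more balls takes
  care of the rest. Intersecting over \<open>k\<close> gives a totally bounded closed set, which is
  compact by completeness. A constant sequence gives the tightness of a single measure.\<close>

lemma wconv_tight:
  fixes P :: "nat \<Rightarrow> 'a::polish_space measure"
  assumes P: "\<And>n. P n \<in> prob_measures borel" and Q: "Q \<in> prob_measures borel"
    and w: "wconv P Q" and e: "0 < e"
  obtains K where "compact K" "\<And>n. 1 - e \<le> measure (P n) K"
proof -
  obtain D :: "'a set" where D: "countable D" "\<And>X. open X \<Longrightarrow> X \<noteq> {} \<Longrightarrow> \<exists>d\<in>D. d \<in> X"
    using countable_dense_setE by blast
  have "D \<noteq> {}" using D(2)[of UNIV] by auto
  define d where "d = from_nat_into D"
  have rd: "range d = D" using \<open>D \<noteq> {}\<close> D(1) by (simp add: d_def)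
  define V where "V m k = (\<Union>i\<in>{..m}. ball (d i) (1 / Suc k))" for m k :: nat
  have Vo: "open (V m k)" for m k by (auto simp: V_def)
  have V_mono: "V m k \<subseteq> V m' k" if "m \<le> m'" for m m' k
    unfolding V_def using that by (intro UN_mono) auto
  have V_UN: "(\<Union>m. V m k) = UNIV" for k
  proof -
    have "x \<in> (\<Union>m. V m k)" for x
    proof -
      have "ball x (1 / Suc k) \<noteq> {}" by simp
      then obtain i where "d i \<in> ball x (1 / Suc k)" using D(2)[OF open_ball] rd by (metis imageE)
      then have "x \<in> V i k" by (auto simp: V_def dist_commute)
      then show ?thesis by blast
    qed
    then show ?thesis by blast
  qed
  have single: "\<exists>m0. \<forall>m\<ge>m0. 1 - \<delta> < measure R (V m k)" if R: "R \<in> prob_measures borel" and "0 < \<delta>" for R \<delta> k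
  proof -
    interpret prob_space R using prob_measuresD[OF R] by simp
    have "incseq (\<lambda>m. V m k)" using V_mono by (auto simp: incseq_def)
    then have "(\<lambda>m. measure R (V m k)) \<longlonglongrightarrow> measure R (\<Union>m. V m k)"
      using Vo prob_measuresD[OF R] by (intro finite_Lim_measure_incseq) auto
    moreover have "measure R (\<Union>m. V m k) = 1" unfolding V_UN using prob_space prob_measuresD[OF R] by simp
    ultimately have "(\<lambda>m. measure R (V m k)) \<longlonglongrightarrow> 1" by simp
    from order_tendstoD(1)[OF this, of "1 - \<delta>"] \<open>0 < \<delta>\<close> show ?thesis
      by (simp add: eventually_sequentially)
  qed
  have uniform: "\<exists>m. \<forall>n. 1 - \<delta> \<le> measure (P n) (V m k)" if \<delta>: "0 < \<delta>" for \<delta> k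
  proof -
    obtain m0 where m0: "1 - \<delta> < measure Q (V m0 k)" using single[OF Q \<delta>] by blast
    have em: "emeasure R A = ennreal (measure R A)" if "R \<in> prob_measures borel" for R :: "'a measure" and A
      by (rule finite_measure.emeasure_eq_measure)
        (rule prob_space.finite_measure[OF prob_measuresD(1)[OF that]])
    have "\<forall>\<^sub>F n in sequentially. 1 - \<delta> \<le> measure (P n) (V m0 k)"
    proof (cases "1 - \<delta> < 0")
      case True
      then show ?thesis by (intro always_eventually allI order_trans[OF _ measure_nonneg]) simp
    next
      case False
      then have "ennreal (1 - \<delta>) < emeasure Q (V m0 k)"
        using m0 by (simp add: em[OF Q] ennreal_less_iff)
      moreover have "emeasure Q (V m0 k) \<le> liminf (\<lambda>n. emeasure (P n) (V m0 k))"
        using w Vo by (simp add: wconv_def)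
      ultimately have "\<forall>\<^sub>F n in sequentially. ennreal (1 - \<delta>) < emeasure (P n) (V m0 k)"
        unfolding le_Liminf_iff by blast
      then show ?thesis
        by eventually_elim (use False in \<open>simp add: em[OF P] ennreal_less_iff\<close>)
    qed
    then obtain N where N: "\<And>n. n \<ge> N \<Longrightarrow> 1 - \<delta> \<le> measure (P n) (V m0 k)"
      by (auto simp: eventually_sequentially)
    have "\<forall>n. \<exists>m. \<forall>m'\<ge>m. 1 - \<delta> < measure (P n) (V m' k)" using single[OF P \<delta>] by blast
    then obtain f where f: "\<And>n m'. f n \<le> m' \<Longrightarrow> 1 - \<delta> < measure (P n) (V m' k)" by metis
    define m where "m = Max (insert m0 (f ` {..<N}))"
    have m: "m0 \<le> m" "\<And>n. n < N \<Longrightarrow> f n \<le> m" by (auto simp: m_def)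
    have "1 - \<delta> \<le> measure (P n) (V m k)" for n
    proof (cases "n < N")
      case True
      then show ?thesis using f[OF m(2)] by (simp add: less_imp_le)
    next
      case False
      interpret prob_space "P n" using prob_measuresD[OF P] by simp
      have "measure (P n) (V m0 k) \<le> measure (P n) (V m k)"
        using Vo prob_measuresD[OF P] by (intro finite_measure_mono V_mono m(1)) auto
      then show ?thesis using N[of n] False by simp
    qed
    then show ?thesis by blast
  qed
  have "\<forall>k. \<exists>m. \<forall>n. 1 - e * (1 / 2) ^ Suc k \<le> measure (P n) (V m k)"
    using e by (intro allI uniform) simp
  then obtain m where m: "\<And>k n. 1 - e * (1 / 2) ^ Suc k \<le> measure (P n) (V (m k) k)" by metis
  \<comment> \<open>Closed balls make \<open>K\<close> closed; the masses missed at stage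
    \<open>k\<close> are at most \<open>e * (1 / 2) ^ Suc k\<close> and add up to
    \<open>e\<close>.\<close>
  define K where "K = (\<Inter>k. \<Union>i\<in>{..m k}. cball (d i) (1 / Suc k))"
  have clK: "closed K" unfolding K_def by (intro closed_INT ballI closed_UN) auto
  have "compact K"
    unfolding compact_eq_totally_bounded
  proof (intro conjI allI impI iffD2[OF complete_eq_closed])
    show "closed K" by (rule clK)
    fix \<epsilon> :: real assume "0 < \<epsilon>"
    then obtain k where k: "1 / Suc k < \<epsilon>" using nat_approx_posE by blast
    have "K \<subseteq> (\<Union>x\<in>d ` {..m k}. ball x \<epsilon>)"
    proof
      fix x assume "x \<in> K"
      then obtain i where "i \<le> m k" "x \<in> cball (d i) (1 / Suc k)" by (auto simp: K_def)
      then show "x \<in> (\<Union>x\<in>d ` {..m k}. ball x \<epsilon>)" using k by force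
    qed
    then show "\<exists>k. finite k \<and> K \<subseteq> (\<Union>x\<in>k. ball x \<epsilon>)" by (intro exI[of _ "d ` {..m k}"]) simp
  qed
  moreover have "1 - e \<le> measure (P n) K" for n
  proof -
    interpret prob_space "P n" using prob_measuresD[OF P] by simp
    have ss: "sets (P n) = sets borel" "space (P n) = UNIV" using prob_measuresD[OF P] by auto
    have le: "measure (P n) (UNIV - V (m k) k) \<le> e * (1 / 2) ^ Suc k" for k
      using m[of k n] prob_compl[of "V (m k) k"] Vo by (simp add: ss)
    have sums: "(\<lambda>k. e * (1 / 2) ^ Suc k) sums e"
      using sums_mult[OF power_half_series, of e] by simp
    have summ: "summable (\<lambda>k. measure (P n) (UNIV - V (m k) k))"
      by (rule summable_comparison_test[OF _ sums_summable[OF sums]]) (use le in auto)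
    have "V (m k) k \<subseteq> (\<Union>i\<in>{..m k}. cball (d i) (1 / Suc k))" for k
      unfolding V_def by (intro UN_mono) auto
    then have "UNIV - K \<subseteq> (\<Union>k. UNIV - V (m k) k)" by (force simp: K_def)
    then have "measure (P n) (UNIV - K) \<le> measure (P n) (\<Union>k. UNIV - V (m k) k)"
      using Vo by (intro finite_measure_mono) (auto simp: ss)
    also have "\<dots> \<le> (\<Sum>k. measure (P n) (UNIV - V (m k) k))"
      using Vo by (intro finite_measure_subadditive_countably summ) (auto simp: ss)
    also have "\<dots> \<le> (\<Sum>k. e * (1 / 2) ^ Suc k)"
      by (intro suminf_le le summ sums_summable[OF sums])
    also have "\<dots> = e" using sums by (rule sums_unique[symmetric])
    finally show ?thesis using prob_compl[of K] clK by (simp add: ss)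
  qed
  ultimately show thesis by (rule that)
qed

subsection \<open>The mean ergodic theorem along a subsequence\<close>

definition avg :: "('a \<Rightarrow> 'a) \<Rightarrow> nat \<Rightarrow> ('a \<Rightarrow> real) \<Rightarrow> 'a \<Rightarrow> real" where
  "avg T n f x = (\<Sum>k<n. f ((T ^^ k) x)) / real n"

text \<open>The averages asymptotically minimize the \<open>L\<^sup>2\<close> norm over the convex hull of the orbit, so by the
  parallelogram identity they form a Cauchy sequence.\<close>

inductive_set orbit_hull :: "('a \<Rightarrow> 'a) \<Rightarrow> ('a \<Rightarrow> real) \<Rightarrow> ('a \<Rightarrow> real) set"
  for T :: "'a \<Rightarrow> 'a" and f :: "'a \<Rightarrow> real" where
  base: "f \<in> orbit_hull T f"
| shift: "g \<in> orbit_hull T f \<Longrightarrow> (\<lambda>x. g (T x)) \<in> orbit_hull T f"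
| convex: "g \<in> orbit_hull T f \<Longrightarrow> h \<in> orbit_hull T f \<Longrightarrow> 0 \<le> u \<Longrightarrow> u \<le> 1 \<Longrightarrow>
    (\<lambda>x. u * g x + (1 - u) * h x) \<in> orbit_hull T f"

lemma measurable_funpow: "T \<in> M \<rightarrow>\<^sub>M M \<Longrightarrow> (T ^^ k) \<in> M \<rightarrow>\<^sub>M M"
  by (induction k) (auto intro: measurable_comp)

lemma measurable_avg [measurable]:
  assumes "T \<in> M \<rightarrow>\<^sub>M M" "f \<in> borel_measurable M"
  shows "avg T n f \<in> borel_measurable M"
proof -
  have [measurable]: "(\<lambda>x. f ((T ^^ k) x)) \<in> borel_measurable M" for k
    using measurable_compose[OF measurable_funpow assms(2)] assms(1) by blast
  show ?thesis unfolding avg_def[abs_def] by measurable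
qed

lemma abs_convex_le:
  fixes u a b B :: real
  assumes "0 \<le> u" "u \<le> 1" "\<bar>a\<bar> \<le> B" "\<bar>b\<bar> \<le> B"
  shows "\<bar>u * a + (1 - u) * b\<bar> \<le> B"
proof -
  have "\<bar>u * a + (1 - u) * b\<bar> \<le> \<bar>u * a\<bar> + \<bar>(1 - u) * b\<bar>" by (rule abs_triangle_ineq)
  also have "\<dots> = u * \<bar>a\<bar> + (1 - u) * \<bar>b\<bar>" using assms by (simp add: abs_mult)
  also have "\<dots> \<le> u * B + (1 - u) * B" using assms by (intro add_mono mult_left_mono) auto
  finally show ?thesis by (simp add: algebra_simps)
qed

lemma avg_bounded:
  assumes "\<And>x. \<bar>f x\<bar> \<le> B"
  shows "\<bar>avg T n f x\<bar> \<le> B"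
proof (cases "n = 0")
  case True
  then show ?thesis using assms[of x] by (simp add: avg_def)
next
  case False
  have "\<bar>\<Sum>k<n. f ((T ^^ k) x)\<bar> \<le> (\<Sum>k<n. B)" by (rule order_trans[OF sum_abs sum_mono]) (rule assms)
  with False show ?thesis by (simp add: avg_def field_simps)
qed

lemma avg_shift:
  assumes "\<And>x. \<bar>g x\<bar> \<le> B"
  shows "\<bar>avg T n (\<lambda>x. g (T x)) x - avg T n g x\<bar> \<le> 2 * B / n"
proof -
  have "(\<Sum>k<n. g ((T ^^ Suc k) x)) - (\<Sum>k<n. g ((T ^^ k) x)) = g ((T ^^ n) x) - g ((T ^^ 0) x)"
    using sum_lessThan_telescope[of "\<lambda>k. g ((T ^^ k) x)" n] by (simp only: sum_subtractf)
  then have "avg T n (\<lambda>x. g (T x)) x - avg T n g x = (g ((T ^^ n) x) - g x) / n"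
    by (simp add: avg_def diff_divide_distrib[symmetric])
  moreover have "\<bar>g ((T ^^ n) x) - g x\<bar> \<le> 2 * B" using assms[of "(T ^^ n) x"] assms[of x] by linarith
  ultimately show ?thesis by (simp add: divide_right_mono)
qed

lemma avg_shift_tendsto:
  assumes B: "\<And>x. \<bar>g x\<bar> \<le> B" and n: "\<And>k::nat. k < n k"
  shows "(\<lambda>k. avg T (n k) (\<lambda>x. g (T x)) x - avg T (n k) g x) \<longlonglongrightarrow> 0"
proof (rule Lim_null_comparison)
  have B0: "0 \<le> B" using B[of x] by linarith
  show "\<forall>\<^sub>F k in sequentially. norm (avg T (n k) (\<lambda>x. g (T x)) x - avg T (n k) g x) \<le> 2 * B * (1 / real (Suc k))"
  proof (intro always_eventually allI)
    fix k
    have "2 * B / n k \<le> 2 * B / real (Suc k)"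
      using n[of k] B0 by (intro divide_left_mono) auto
    then show "norm (avg T (n k) (\<lambda>x. g (T x)) x - avg T (n k) g x) \<le> 2 * B * (1 / real (Suc k))"
      using avg_shift[of g B T "n k" x, OF B] by simp
  qed
  show "(\<lambda>k. 2 * B * (1 / real (Suc k))) \<longlonglongrightarrow> 0"
    using tendsto_mult_left[OF LIMSEQ_inverse_real_of_nat, of "2 * B"] by (simp add: inverse_eq_divide)
qed

lemma avg_lin: "avg T n (\<lambda>x. u * g x + v * h x) x = u * avg T n g x + v * avg T n h x"
  by (simp add: avg_def sum.distrib sum_distrib_left[symmetric] add_divide_distrib)

lemma orbit_hull_bounded:
  assumes "\<And>x. \<bar>f x\<bar> \<le> B"
  shows "g \<in> orbit_hull T f \<Longrightarrow> \<bar>g x\<bar> \<le> B"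
  by (induction arbitrary: x rule: orbit_hull.induct) (auto intro: assms abs_convex_le)

lemma orbit_hull_measurable:
  assumes [measurable]: "T \<in> M \<rightarrow>\<^sub>M M" "f \<in> borel_measurable M"
  shows "g \<in> orbit_hull T f \<Longrightarrow> g \<in> borel_measurable M"
proof (induction rule: orbit_hull.induct)
  case (convex g h u)
  note [measurable] = convex.IH
  show ?case by measurable
qed (auto intro: measurable_compose[OF assms(1)] assms(2))

text \<open>A shift changes an average over \<open>n\<close> terms by at most a constant over
  \<open>n\<close>, by telescoping, and convex combinations preserve such a bound. So the whole hull
  has the same asymptotic averages as \<open>f\<close>, uniformly in the point.\<close>

lemma orbit_hull_avg:
  assumes B: "\<And>x. \<bar>f x\<bar> \<le> B"
  shows "g \<in> orbit_hull T f \<Longrightarrow> \<exists>C\<ge>0. \<forall>n x. \<bar>avg T n g x - avg T n f x\<bar> \<le> C / real n"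
proof (induction rule: orbit_hull.induct)
  case base
  show ?case by (intro exI[of _ 0]) simp
next
  case (shift g)
  then obtain C where C: "C \<ge> 0" "\<And>n x. \<bar>avg T n g x - avg T n f x\<bar> \<le> C / real n" by blast
  have "0 \<le> B" using B[of undefined] by linarith
  have "\<bar>avg T n (\<lambda>x. g (T x)) x - avg T n f x\<bar> \<le> (2 * B + C) / real n" for n x
    using avg_shift[of g B T n x, OF orbit_hull_bounded[OF B shift.hyps]] C(2)[of n x]
    by (simp add: add_divide_distrib)
  then show ?case using \<open>0 \<le> B\<close> C(1) by (intro exI[of _ "2 * B + C"]) auto
next
  case (convex g h u)
  then obtain C D where C: "C \<ge> 0" "\<And>n x. \<bar>avg T n g x - avg T n f x\<bar> \<le> C / real n"
    and D: "D \<ge> 0" "\<And>n x. \<bar>avg T n h x - avg T n f x\<bar> \<le> D / real n" by blast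
  have "\<bar>avg T n (\<lambda>x. u * g x + (1 - u) * h x) x - avg T n f x\<bar> \<le> max C D / real n" for n x
  proof -
    have "\<bar>avg T n g x - avg T n f x\<bar> \<le> max C D / real n"
      by (rule order_trans[OF C(2) divide_right_mono]) auto
    moreover have "\<bar>avg T n h x - avg T n f x\<bar> \<le> max C D / real n"
      by (rule order_trans[OF D(2) divide_right_mono]) auto
    ultimately have "\<bar>u * (avg T n g x - avg T n f x) + (1 - u) * (avg T n h x - avg T n f x)\<bar> \<le> max C D / real n"
      by (rule abs_convex_le[OF convex.hyps(3,4)])
    then show ?thesis unfolding avg_lin by (simp add: algebra_simps)
  qed
  then show ?case using C(1) by (intro exI[of _ "max C D"]) auto
qed

text \<open>Splitting off the first term exhibits the average over \<open>n + 2\<close> terms as a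
  convex combination of \<open>f\<close> and a shifted shorter average. The index is
  \<open>Suc n\<close> because the empty average is the zero function.\<close>

lemma avg_in_orbit_hull: "avg T (Suc n) f \<in> orbit_hull T f"
proof (induction n)
  case 0
  have "avg T (Suc 0) f = f" by (auto simp: avg_def)
  then show ?case by (simp add: orbit_hull.base)
next
  case (Suc n)
  define u where "u = 1 / real (Suc (Suc n))"
  have u: "0 \<le> u" "u \<le> 1" "1 - u = real (Suc n) / real (Suc (Suc n))" by (auto simp: u_def field_simps)
  have "avg T (Suc (Suc n)) f x = u * f x + (1 - u) * avg T (Suc n) f (T x)" for x
  proof -
    have "(\<Sum>k<Suc (Suc n). f ((T ^^ k) x)) = f x + (\<Sum>k<Suc n. f ((T ^^ k) (T x)))"
      by (subst sum.lessThan_Suc_shift) (simp add: funpow_swap1)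
    then show ?thesis
      unfolding u(3) unfolding avg_def u_def by (simp add: add_divide_distrib del: sum.lessThan_Suc of_nat_Suc)
  qed
  then have "avg T (Suc (Suc n)) f = (\<lambda>x. u * f x + (1 - u) * avg T (Suc n) f (T x))" by blast
  then show ?case
    using orbit_hull.convex[OF orbit_hull.base orbit_hull.shift[OF Suc.IH] u(1,2)] by simp
qed

section \<open>Mean square and almost everywhere convergence of the averages\<close>

lemma distr_funpow:
  assumes T: "T \<in> M \<rightarrow>\<^sub>M M" and inv: "distr M M T = M"
  shows "distr M M (T ^^ k) = M"
proof (induction k)
  case 0
  show ?case using distr_id[of M] by (simp add: id_def)
next
  case (Suc k)
  have "distr M M (T \<circ> (T ^^ k)) = distr (distr M M (T ^^ k)) M T"
    by (rule distr_distr[symmetric, OF T measurable_funpow[OF T]])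
  then show ?case using Suc inv by (simp only: funpow.simps(2))
qed

context prob_space
begin

lemma integrable_bounded_fun:
  fixes f :: "'a \<Rightarrow> real"
  assumes "f \<in> borel_measurable M" "\<And>x. \<bar>f x\<bar> \<le> B"
  shows "integrable M f"
  by (rule integrable_const_bound[of f B]) (use assms in \<open>auto intro!: AE_I2\<close>)

lemma integral_avg:
  assumes T: "T \<in> M \<rightarrow>\<^sub>M M" and inv: "distr M M T = M"
    and f: "f \<in> borel_measurable M" "\<And>x. \<bar>f x\<bar> \<le> B" and n: "0 < n"
  shows "(LINT x|M. avg T n f x) = (LINT x|M. f x)"
proof -
  have 1: "(LINT x|M. f ((T ^^ k) x)) = (LINT x|M. f x)" for k
  proof -
    have "(LINT x|distr M M (T ^^ k). f x) = (LINT x|M. f ((T ^^ k) x))"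
      by (rule integral_distr[OF measurable_funpow[OF T] f(1)])
    then show ?thesis by (simp add: distr_funpow[OF T inv])
  qed
  have 2: "integrable M (\<lambda>x. f ((T ^^ k) x))" for k
    by (rule integrable_bounded_fun[of _ B])
      (use measurable_compose[OF measurable_funpow[OF T] f(1)] f(2) in auto)
  show ?thesis using n by (simp add: avg_def 1 2)
qed

text \<open>The averages are asymptotically minimal for this reason: for a nearly minimal
  \<open>h\<close> in the hull, averaging does not increase the norm, by Cauchy-Schwarz and
  invariance, and the averages of \<open>f\<close> and of \<open>h\<close> differ by at most a
  constant over \<open>n\<close>.\<close>

lemma avg_Cauchy:
  assumes T: "T \<in> M \<rightarrow>\<^sub>M M" and inv: "distr M M T = M"
    and f: "f \<in> borel_measurable M" and B: "\<And>x. \<bar>f x\<bar> \<le> B" and e: "0 < e"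
  shows "\<exists>N. \<forall>n\<ge>N. \<forall>m\<ge>N. (LINT x|M. (avg T n f x - avg T m f x)\<^sup>2) \<le> e"
proof -
  have B0: "0 \<le> B" using B[of undefined] by linarith
  have om: "g \<in> borel_measurable M" if "g \<in> orbit_hull T f" for g
    by (rule orbit_hull_measurable[OF T f that])
  have ob: "\<bar>g x\<bar> \<le> B" if "g \<in> orbit_hull T f" for g x
    by (rule orbit_hull_bounded[OF B that])
  have sq_le: "y\<^sup>2 \<le> B\<^sup>2" if "\<bar>y\<bar> \<le> B" for y
    using that by (metis abs_ge_zero power2_abs power_mono)
  have oi: "integrable M (\<lambda>x. (g x)\<^sup>2)" if "g \<in> orbit_hull T f" for g
    by (rule integrable_bounded_fun[of _ "B\<^sup>2"]) (use om[OF that] sq_le ob[OF that] in auto)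
  define c where "c = (INF g\<in>orbit_hull T f. LINT x|M. (g x)\<^sup>2)"
  have bdd: "bdd_below ((\<lambda>g. LINT x|M. (g x)\<^sup>2) ` orbit_hull T f)"
    by (rule bdd_belowI[of _ 0]) auto
  have c_le: "c \<le> (LINT x|M. (g x)\<^sup>2)" if "g \<in> orbit_hull T f" for g
    unfolding c_def by (rule cINF_lower[OF bdd that])
  have "(INF g\<in>orbit_hull T f. LINT x|M. (g x)\<^sup>2) < c + e / 8" using e by (simp add: c_def)
  then obtain h where h: "h \<in> orbit_hull T f" "(LINT x|M. (h x)\<^sup>2) < c + e / 8"
    using cINF_less_iff[OF _ bdd, of "c + e / 8"] orbit_hull.base by auto
  obtain C where C: "C \<ge> 0" "\<And>n x. \<bar>avg T n h x - avg T n f x\<bar> \<le> C / real n"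
    using orbit_hull_avg[OF B h(1)] by blast
  \<comment> \<open>Writing the average of \<open>f\<close> as that of \<open>h\<close> plus an
    error of at most \<open>C / n\<close>, squaring adds at most
    \<open>2 * B * C / n + (C / n)\<^sup>2\<close>, which is at most \<open>K / n\<close>.\<close>
  define K where "K = 2 * B * C + C\<^sup>2"
  have K0: "0 \<le> K" using B0 C by (simp add: K_def)
  have upper: "(LINT x|M. (avg T (Suc n) f x)\<^sup>2) \<le> c + e / 8 + K / Suc n" for n
  proof -
    let ?n = "Suc n"
    have pt: "(avg T ?n f x)\<^sup>2 \<le> avg T ?n (\<lambda>x. (h x)\<^sup>2) x + K / ?n" for x
    proof -
      define a where "a = avg T ?n h x"
      define d where "d = avg T ?n f x - a"
      have a: "\<bar>a\<bar> \<le> B" unfolding a_def by (rule avg_bounded[OF ob[OF h(1)]])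
      have d: "\<bar>d\<bar> \<le> C / ?n" using C(2)[of ?n x] by (simp add: d_def a_def abs_minus_commute)
      have "\<bar>a * d\<bar> \<le> B * (C / ?n)" unfolding abs_mult using a d B0 by (intro mult_mono) auto
      then have 1: "2 * (a * d) \<le> 2 * B * C / ?n" by (simp add: abs_le_iff)
      have "d\<^sup>2 \<le> (C / ?n)\<^sup>2" using d by (metis abs_ge_zero power2_abs power_mono)
      also have "\<dots> \<le> C\<^sup>2 / ?n"
      proof -
        have "C\<^sup>2 / (real ?n)\<^sup>2 \<le> C\<^sup>2 / real ?n"
          by (rule divide_left_mono) (auto simp: power2_eq_square)
        then show ?thesis by (simp add: power_divide)
      qed
      finally have 2: "d\<^sup>2 \<le> C\<^sup>2 / ?n" .
      have "(avg T ?n f x)\<^sup>2 = a\<^sup>2 + 2 * (a * d) + d\<^sup>2"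
        unfolding d_def by (simp add: power2_eq_square algebra_simps)
      also have "\<dots> \<le> a\<^sup>2 + 2 * B * C / ?n + C\<^sup>2 / ?n" using 1 2 by linarith
      also have "\<dots> = a\<^sup>2 + K / ?n" by (simp add: K_def add_divide_distrib)
      also have "a\<^sup>2 \<le> avg T ?n (\<lambda>x. (h x)\<^sup>2) x"
      proof -
        have "(\<Sum>k<?n. h ((T ^^ k) x))\<^sup>2 \<le> real ?n * (\<Sum>k<?n. (h ((T ^^ k) x))\<^sup>2)"
          using sum_squared_le_sum_of_squares[of "\<lambda>k. h ((T ^^ k) x)" "{..<?n}"] by (simp add: mult.commute)
        then have "(\<Sum>k<?n. h ((T ^^ k) x))\<^sup>2 / (real ?n)\<^sup>2 \<le> real ?n * (\<Sum>k<?n. (h ((T ^^ k) x))\<^sup>2) / (real ?n)\<^sup>2"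
          by (rule divide_right_mono) simp
        then show ?thesis unfolding a_def avg_def power_divide
          by (simp add: power2_eq_square[of "real ?n"] del: of_nat_Suc sum.lessThan_Suc)
      qed
      finally show ?thesis by simp
    qed
    have h2: "(\<lambda>x. (h x)\<^sup>2) \<in> borel_measurable M" "\<And>x. \<bar>(h x)\<^sup>2\<bar> \<le> B\<^sup>2"
      using om[OF h(1)] sq_le ob[OF h(1)] by auto
    have i2: "integrable M (avg T ?n (\<lambda>x. (h x)\<^sup>2))"
      by (rule integrable_bounded_fun[OF measurable_avg[OF T h2(1)] avg_bounded[OF h2(2)]])
    have "(LINT x|M. (avg T ?n f x)\<^sup>2) \<le> (LINT x|M. avg T ?n (\<lambda>x. (h x)\<^sup>2) x + K / ?n)"
      using i2 pt oi[OF avg_in_orbit_hull[of T n f]] by (intro integral_mono) auto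
    also have "\<dots> = (LINT x|M. avg T ?n (\<lambda>x. (h x)\<^sup>2) x) + K / ?n"
      using i2 by (simp add: prob_space del: of_nat_Suc)
    also have "(LINT x|M. avg T ?n (\<lambda>x. (h x)\<^sup>2) x) = (LINT x|M. (h x)\<^sup>2)"
      by (rule integral_avg[OF T inv h2]) simp
    finally show ?thesis using h(2) by linarith
  qed
  \<comment> \<open>One \<open>e / 8\<close> comes from the choice of \<open>h\<close>, the other
    from \<open>K / Suc n\<close>. Each squared norm is then at most \<open>c + e / 4\<close>, and
    the parallelogram identity adds four such excesses up to \<open>e\<close>.\<close>
  obtain N0 :: nat where N0: "K / (e / 8) < real N0" using reals_Archimedean2 by blast
  have upper2: "(LINT x|M. (avg T (Suc n) f x)\<^sup>2) \<le> c + e / 4" if "n \<ge> N0" for n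
  proof -
    have "K / Suc n \<le> e / 8"
    proof -
      have "K < real N0 * (e / 8)" using N0 e by (simp add: pos_divide_less_eq)
      also have "\<dots> \<le> real (Suc n) * (e / 8)" using that e by (intro mult_right_mono) auto
      finally show ?thesis by (simp add: pos_divide_le_eq mult.commute)
    qed
    then show ?thesis using upper[of n] by linarith
  qed
  have "(LINT x|M. (avg T (Suc n) f x - avg T (Suc m) f x)\<^sup>2) \<le> e" if nm: "n \<ge> N0" "m \<ge> N0" for n m
  proof -
    let ?u = "avg T (Suc n) f" and ?v = "avg T (Suc m) f"
    \<comment> \<open>The midpoint, with coefficients in the form of the hull's convexity rule.
      Since it lies in the hull, its squared norm is at least \<open>c\<close>.\<close>
    define w where "w x = (1/2) * ?u x + (1 - 1/2) * ?v x" for x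
    have w: "w \<in> orbit_hull T f"
      unfolding w_def by (rule orbit_hull.convex[OF avg_in_orbit_hull avg_in_orbit_hull]) auto
    have "(LINT x|M. (?u x - ?v x)\<^sup>2) = (LINT x|M. 2 * (?u x)\<^sup>2 + 2 * (?v x)\<^sup>2 - 4 * (w x)\<^sup>2)"
      by (intro Bochner_Integration.integral_cong) (auto simp: w_def power2_eq_square algebra_simps)
    also have "\<dots> = 2 * (LINT x|M. (?u x)\<^sup>2) + 2 * (LINT x|M. (?v x)\<^sup>2) - 4 * (LINT x|M. (w x)\<^sup>2)"
      using oi[OF avg_in_orbit_hull] oi[OF w] by simp
    also have "\<dots> \<le> 2 * (c + e / 4) + 2 * (c + e / 4) - 4 * c"
      by (intro diff_mono add_mono mult_left_mono upper2 nm c_le w) auto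
    finally show ?thesis by simp
  qed
  note bound = this
  show ?thesis
  proof (intro exI[of _ "Suc N0"] allI impI)
    fix n m assume nm: "Suc N0 \<le> n" "Suc N0 \<le> m"
    then show "(LINT x|M. (avg T n f x - avg T m f x)\<^sup>2) \<le> e"
      using bound[of "n - 1" "m - 1"] by simp
  qed
qed

text \<open>The square bounds make the increments summable in mean, so they are absolutely summable
  almost everywhere. The bounds hold only from index \<open>j\<close> on, whence the shift by
  \<open>j\<close> in the increments.\<close>

lemma AE_convergent_of_square_summable:
  fixes a :: "nat \<Rightarrow> 'a \<Rightarrow> real"
  assumes m [measurable]: "\<And>k. a k \<in> borel_measurable M" and B: "\<And>k x. \<bar>a k x\<bar> \<le> B"
    and le: "\<And>k. j \<le> k \<Longrightarrow> (LINT x|M. (a (Suc k) x - a k x)\<^sup>2) \<le> (1 / 4) ^ k"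
  shows "AE x in M. convergent (\<lambda>k. a k x)"
proof -
  define d where "d k x = a (Suc k + j) x - a (k + j) x" for k x
  have [measurable]: "d k \<in> borel_measurable M" for k unfolding d_def by measurable
  have B0: "0 \<le> B" using B[of 0 undefined] by linarith
  have dB: "\<bar>d k x\<bar> \<le> 2 * B" for k x
    using B[of "Suc k + j" x] B[of "k + j" x] by (simp add: d_def)
  have di: "integrable M (\<lambda>x. \<bar>d k x\<bar>)" for k
    by (rule integrable_bounded_fun[of _ "2 * B"]) (use dB in auto)
  have d2: "integrable M (\<lambda>x. (d k x)\<^sup>2)" for k
  proof (rule integrable_bounded_fun[of _ "(2 * B)\<^sup>2"])
    show "\<bar>(d k x)\<^sup>2\<bar> \<le> (2 * B)\<^sup>2" for x
      using power_mono[OF dB[of k x], of 2] by simp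
  qed simp
  have L1: "(LINT x|M. \<bar>d k x\<bar>) \<le> (1 / 2) ^ k" for k
  proof -
    \<comment> \<open>The square root of the bound on the mean square: with this \<open>s\<close>
      both terms of the inequality between arithmetic and geometric mean contribute
      \<open>s / 2\<close>.\<close>
    define s where "s = (1 / 2 :: real) ^ (k + j)"
    have s0: "0 < s" "(1 / 4 :: real) ^ (k + j) = s * s"
      by (auto simp: s_def power_mult_distrib[symmetric])
    have "\<bar>d k x\<bar> \<le> (s + (d k x)\<^sup>2 / s) / 2" for x
    proof -
      have "0 \<le> (\<bar>d k x\<bar> - s)\<^sup>2" by simp
      then have "2 * \<bar>d k x\<bar> * s \<le> s * s + (d k x)\<^sup>2"
        by (simp add: power2_eq_square algebra_simps)
      then show ?thesis using s0(1) by (simp add: field_simps)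
    qed
    then have "(LINT x|M. \<bar>d k x\<bar>) \<le> (LINT x|M. (s + (d k x)\<^sup>2 / s) / 2)"
      using di d2 by (intro integral_mono) auto
    also have "\<dots> = (s + (LINT x|M. (d k x)\<^sup>2) / s) / 2"
      using d2 by (simp add: prob_space)
    also have "\<dots> \<le> (s + s * s / s) / 2"
    proof -
      have "(LINT x|M. (d k x)\<^sup>2) \<le> s * s"
        using le[of "k + j"] unfolding s0(2) d_def by simp
      then show ?thesis using s0 by (intro divide_right_mono add_left_mono) auto
    qed
    also have "\<dots> = s" using s0 by simp
    also have "\<dots> \<le> (1 / 2) ^ k" unfolding s_def by (rule power_decreasing) auto
    finally show ?thesis .
  qed
  have "(\<integral>\<^sup>+ x. (\<Sum>k. ennreal \<bar>d k x\<bar>) \<partial>M) = (\<Sum>k. \<integral>\<^sup>+ x. ennreal \<bar>d k x\<bar> \<partial>M)"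
    by (rule nn_integral_suminf) measurable
  also have "\<dots> = (\<Sum>k. ennreal (LINT x|M. \<bar>d k x\<bar>))"
    using di by (simp add: nn_integral_eq_integral)
  also have "\<dots> \<le> (\<Sum>k. ennreal ((1 / 2) ^ k))"
    using L1 by (intro suminf_le ennreal_leI) auto
  also have "\<dots> < \<infinity>"
    by (simp add: suminf_ennreal_eq[OF _ geometric_sums] less_top[symmetric])
  finally have fin: "(\<integral>\<^sup>+ x. (\<Sum>k. ennreal \<bar>d k x\<bar>) \<partial>M) \<noteq> \<infinity>" by simp
  have "AE x in M. (\<Sum>k. ennreal \<bar>d k x\<bar>) \<noteq> \<infinity>"
    by (rule nn_integral_PInf_AE[OF _ fin]) measurable
  then show ?thesis
  proof eventually_elim
    case (elim x)
    then have "summable (\<lambda>k. \<bar>d k x\<bar>)" by (intro summable_suminf_not_top) auto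
    then have "summable (\<lambda>k. d k x)" by (rule summable_rabs_cancel)
    then have "convergent (\<lambda>n. \<Sum>k<n. d k x)" by (simp add: summable_iff_convergent)
    moreover have "(\<Sum>k<n. d k x) = a (n + j) x - a j x" for n
      using sum_lessThan_telescope[of "\<lambda>k. a (k + j) x" n] by (simp add: d_def)
    ultimately have "convergent (\<lambda>n. a (n + j) x - a j x + a j x)"
      by (intro convergent_add convergent_const) simp
    then have "convergent (\<lambda>n. a (n + j) x)" by simp
    then show "convergent (\<lambda>k. a k x)" by (rule iffD1[OF convergent_ignore_initial_segment])
  qed
qed

text \<open>The indices outgrow the Cauchy thresholds of all functions diagonally, so that a single
  subsequence serves countably many functions, the \<open>j\<close>-th with increments controlled
  from step \<open>j\<close> on.\<close>

lemma mean_ergodic_subsequence: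
  fixes f :: "nat \<Rightarrow> 'a \<Rightarrow> real"
  assumes T: "T \<in> M \<rightarrow>\<^sub>M M" and inv: "distr M M T = M"
    and f: "\<And>j. f j \<in> borel_measurable M" and B: "\<And>j x. \<bar>f j x\<bar> \<le> B j"
  obtains n :: "nat \<Rightarrow> nat" where "\<And>k. k < n k"
    "\<And>j. AE x in M. convergent (\<lambda>k. avg T (n k) (f j) x)"
proof -
  have "\<exists>N. \<forall>n\<ge>N. \<forall>m\<ge>N. (LINT x|M. (avg T n (f j) x - avg T m (f j) x)\<^sup>2) \<le> (1 / 4) ^ k" for j k
    by (rule avg_Cauchy[OF T inv f B]) simp
  then obtain N where N: "\<And>j k n m. N j k \<le> n \<Longrightarrow> N j k \<le> m \<Longrightarrow>
      (LINT x|M. (avg T n (f j) x - avg T m (f j) x)\<^sup>2) \<le> (1 / 4) ^ k" by metis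
  \<comment> \<open>The sum dominates each \<open>N j i\<close> with
    \<open>j \<le> i \<le> k\<close>, also at all later indices; \<open>Suc k\<close> ensures
    \<open>k < n k\<close>.\<close>
  define n where "n k = Suc k + (\<Sum>i\<le>k. \<Sum>j\<le>i. N j i)" for k
  have nN: "N j k \<le> n l" if "j \<le> k" "k \<le> l" for j k l
  proof -
    have "N j k \<le> (\<Sum>j\<le>k. N j k)" using that by (intro member_le_sum) auto
    also have "\<dots> \<le> (\<Sum>i\<le>l. \<Sum>j\<le>i. N j i)"
      using that member_le_sum[of k "{..l}" "\<lambda>i. \<Sum>j\<le>i. N j i"] by auto
    finally show ?thesis by (simp add: n_def)
  qed
  show thesis
  proof (rule that[of n])
    show "k < n k" for k by (simp add: n_def)
    show "AE x in M. convergent (\<lambda>k. avg T (n k) (f j) x)" for j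
    proof (rule AE_convergent_of_square_summable)
      show "avg T (n k) (f j) \<in> borel_measurable M" for k by (rule measurable_avg[OF T f])
      show "\<bar>avg T (n k) (f j) x\<bar> \<le> B j" for k x by (rule avg_bounded[OF B])
      show "(LINT x|M. (avg T (n (Suc k)) (f j) x - avg T (n k) (f j) x)\<^sup>2) \<le> (1 / 4) ^ k" if "j \<le> k" for k
        using that by (intro N nN) auto
    qed
  qed
qed

end

subsection \<open>Invariant measures\<close>

lemma action_comp: "continuous_int_action a \<Longrightarrow> a m (a n x) = a (m + n) x"
  by (simp add: continuous_int_action_def)

lemma action_zero: "continuous_int_action a \<Longrightarrow> a 0 = id"
  by (simp add: continuous_int_action_def)

lemma action_continuous: "continuous_int_action a \<Longrightarrow> continuous_on UNIV (a n)"
  by (simp add: continuous_int_action_def)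

lemma action_measurable: "continuous_int_action a \<Longrightarrow> a n \<in> borel \<rightarrow>\<^sub>M borel"
  by (rule borel_measurable_continuous_onI[OF action_continuous])

lemma action_measurable':
  "continuous_int_action a \<Longrightarrow> P \<in> prob_measures borel \<Longrightarrow> a n \<in> P \<rightarrow>\<^sub>M P"
  using action_measurable[of a n] measurable_cong_sets[OF prob_measuresD(2) prob_measuresD(2), of P borel P borel]
  by simp

lemma action_int: "continuous_int_action a \<Longrightarrow> a (int k) = (a 1 ^^ k)"
proof (induction k)
  case (Suc k)
  then have "a (int (Suc k)) = a 1 \<circ> a (int k)"
    unfolding continuous_int_action_def by (metis of_nat_Suc add.commute)
  with Suc show ?case by simp
qed (simp add: action_zero id_def)

lemma distr_action: "P \<in> prob_measures borel \<Longrightarrow> distr P P f = distr P borel f"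
  by (rule distr_cong) (simp_all add: prob_measuresD)

lemma invariant_probsD:
  assumes "P \<in> invariant_probs a"
  shows "P \<in> prob_measures borel" "prob_space P" "sets P = sets borel" "space P = UNIV"
    "distr P borel (a n) = P"
  using assms prob_measuresD[of P borel] by (auto simp: invariant_probs_def)

text \<open>Iterating the generator gives the nonnegative times. For negative \<open>n\<close>, the
  measure is first written as its own image under \<open>a (- n)\<close>, which \<open>a n\<close>
  undoes.\<close>

lemma invariant_probsI:
  assumes act: "continuous_int_action a" and P: "P \<in> prob_measures borel" and inv: "distr P borel (a 1) = P"
  shows "P \<in> invariant_probs a"
proof -
  note m = action_measurable'[OF act P]
  have m': "a n \<in> P \<rightarrow>\<^sub>M borel" for n
    using action_measurable[OF act] measurable_cong_sets prob_measuresD(2)[OF P] by blast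
  have nat: "distr P borel (a (int k)) = P" for k
    using distr_funpow[OF m, of 1 k] inv by (simp add: action_int[OF act] distr_action[OF P])
  have "distr P borel (a n) = P" for n
  proof (cases "0 \<le> n")
    case True
    then show ?thesis using nat[of "nat n"] by simp
  next
    case False
    have "distr P borel (a n) = distr (distr P borel (a (- n))) borel (a n)"
      using nat[of "nat (- n)"] False by simp
    also have "\<dots> = distr P borel (a n \<circ> a (- n))"
      by (rule distr_distr[OF action_measurable[OF act] m'])
    also have "a n \<circ> a (- n) = id"
      by (auto simp: action_comp[OF act] action_zero[OF act])
    also have "distr P borel id = P"
      using distr_id[of P] distr_action[OF P, of id] by (simp add: id_def)
    finally show ?thesis .
  qed
  then show ?thesis using P by (simp add: invariant_probs_def)
qed

lemma emeasure_invariant: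
  assumes act: "continuous_int_action a" and P: "P \<in> invariant_probs a" and A: "A \<in> sets borel"
  shows "emeasure P (a n -` A) = emeasure P A"
proof -
  have "a n \<in> P \<rightarrow>\<^sub>M borel"
    using action_measurable[OF act] measurable_cong_sets invariant_probsD(3)[OF P] by blast
  then have "emeasure (distr P borel (a n)) A = emeasure P (a n -` A)"
    using A by (simp add: emeasure_distr invariant_probsD(4)[OF P])
  then show ?thesis by (simp add: invariant_probsD(5)[OF P])
qed

lemma prob_measures_eqI:
  assumes P: "P \<in> prob_measures borel" and Q: "Q \<in> prob_measures borel"
    and eq: "\<And>A. A \<in> sets borel \<Longrightarrow> measure P A = measure Q A"
  shows "P = Q"
proof (rule measure_eqI)
  show "sets P = sets Q" using prob_measuresD[OF P] prob_measuresD[OF Q] by simp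
  fix A assume "A \<in> sets P"
  then show "emeasure P A = emeasure Q A"
    using eq[of A] prob_measuresD[OF P] prob_measuresD[OF Q]
    by (simp add: finite_measure.emeasure_eq_measure prob_space.finite_measure)
qed

lemma measurable_prob_cong:
  "P \<in> prob_measures borel \<Longrightarrow> f \<in> borel \<rightarrow>\<^sub>M N \<Longrightarrow> f \<in> P \<rightarrow>\<^sub>M N"
  using measurable_cong_sets[OF prob_measuresD(2) refl, of P borel] by blast

lemma integral_avg_invariant:
  assumes act: "continuous_int_action a" and P: "P \<in> invariant_probs a"
    and f: "f \<in> borel_measurable borel" and B: "\<And>x. \<bar>f x\<bar> \<le> B" and n: "0 < n"
  shows "(LINT x|P. avg (a 1) n f x) = (LINT x|P. f x)"
proof -
  note P' = invariant_probsD(1)[OF P]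
  interpret prob_space P by (rule invariant_probsD(2)[OF P])
  show ?thesis
    by (rule integral_avg[OF action_measurable'[OF act P'] _ measurable_prob_cong[OF P' f] B n])
      (simp add: distr_action[OF P'] invariant_probsD(5)[OF P])
qed

text \<open>Averages over at least one term have the same integral as \<open>f\<close>, and
  dominated convergence passes this to the limit.\<close>

lemma integral_limit_avg:
  assumes act: "continuous_int_action a" and P: "P \<in> invariant_probs a"
    and f: "f \<in> borel_measurable borel" and B: "\<And>x. \<bar>f x\<bar> \<le> B" and n: "\<And>k::nat. k < n k"
    and L: "L \<in> borel_measurable borel"
    and lim: "AE x in P. (\<lambda>k. avg (a 1) (n k) f x) \<longlonglongrightarrow> L x"
  shows "(LINT x|P. L x) = (LINT x|P. f x)"
proof (rule LIMSEQ_unique)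
  note P' = invariant_probsD(1)[OF P]
  interpret prob_space P by (rule invariant_probsD(2)[OF P])
  show "(\<lambda>k. LINT x|P. avg (a 1) (n k) f x) \<longlonglongrightarrow> (LINT x|P. L x)"
  proof (rule integral_dominated_convergence[where w="\<lambda>_. B"])
    show "L \<in> borel_measurable P" using measurable_prob_cong[OF P' L] .
    show "avg (a 1) (n k) f \<in> borel_measurable P" for k
      by (rule measurable_avg[OF action_measurable'[OF act P'] measurable_prob_cong[OF P' f]])
    show "AE x in P. norm (avg (a 1) (n k) f x) \<le> B" for k
      using avg_bounded[of f B, OF B] by (intro AE_I2) simp
  qed (use lim in auto)
  have "0 < n k" for k using n[of k] by linarith
  then show "(\<lambda>k. LINT x|P. avg (a 1) (n k) f x) \<longlonglongrightarrow> (LINT x|P. f x)"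
    by (simp add: integral_avg_invariant[OF act P f B])
qed

subsection \<open>Limits of empirical measures\<close>

text \<open>The uniform distribution on the orbit segment. As the image of a \<open>pmf\<close> it
  is a probability measure even for \<open>n = 0\<close>, where the distribution is
  unspecified.\<close>

definition empirical :: "('a \<Rightarrow> 'a) \<Rightarrow> nat \<Rightarrow> 'a::topological_space \<Rightarrow> 'a measure" where
  "empirical T n x = distr (measure_pmf (pmf_of_set {..<n})) borel (\<lambda>k. (T ^^ k) x)"

lemma empirical_prob: "empirical T n x \<in> prob_measures borel"
  by (auto simp: empirical_def prob_measures_def intro!: prob_space.prob_space_distr prob_space_measure_pmf)

lemma integral_empirical:
  assumes "0 < n" "f \<in> borel_measurable borel"
  shows "(LINT y|empirical T n x. f y) = avg T n f x"
proof -
  have "(LINT y|empirical T n x. f y) = (LINT k|measure_pmf (pmf_of_set {..<n}). f ((T ^^ k) x))"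
    unfolding empirical_def by (rule integral_distr[OF _ assms(2)]) simp
  also have "\<dots> = avg T n f x"
    using assms(1) by (subst integral_pmf_of_set) (auto simp: avg_def)
  finally show ?thesis .
qed

lemma measure_empirical:
  assumes "0 < n" "K \<in> sets borel"
  shows "measure (empirical T n x) K = avg T n (indicator K) x"
proof -
  have "(LINT y|empirical T n x. indicator K y) = measure (empirical T n x) K"
    using assms prob_measuresD[OF empirical_prob[of T n x]] by simp
  then show ?thesis using integral_empirical[OF assms(1), of "indicator K"] assms(2) by simp
qed

text \<open>The Krylov-Bogolyubov argument: shifting an orbit segment by one step changes its
  averages by a term of order \<open>1 / n k\<close>.\<close>

lemma empirical_limit_invariant:
  fixes a :: "int \<Rightarrow> 'a::{metric_space,second_countable_topology} \<Rightarrow> 'a"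
  assumes act: "continuous_int_action a" and n: "\<And>k::nat. k < n k"
    and Q: "Q \<in> prob_measures borel" and w: "wconv (\<lambda>k. empirical (a 1) (n k) x) Q"
  shows "Q \<in> invariant_probs a"
proof (rule invariant_probsI[OF act Q])
  have n0: "0 < n k" for k using n[of k] by linarith
  have m: "a 1 \<in> Q \<rightarrow>\<^sub>M borel" by (rule measurable_prob_cong[OF Q action_measurable[OF act]])
  show "distr Q borel (a 1) = Q"
  proof (rule prob_eq_if_test_eq[OF distr_prob_measures[OF Q action_measurable[OF act]] Q])
    fix i
    have c: "continuous_on UNIV (\<lambda>y. test i (a 1 y))"
      using continuous_on_compose2[OF continuous_test action_continuous[OF act]] by simp
    have "(\<lambda>k. LINT y|empirical (a 1) (n k) x. test i (a 1 y)) \<longlonglongrightarrow> (LINT y|Q. test i (a 1 y))"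
      by (rule wconv_integral[OF empirical_prob Q w c abs_test_le_bound])
    then have 1: "(\<lambda>k. avg (a 1) (n k) (\<lambda>y. test i (a 1 y)) x) \<longlonglongrightarrow> (LINT y|Q. test i (a 1 y))"
      by (simp add: integral_empirical n0 borel_measurable_continuous_onI[OF c])
    have "(\<lambda>k. LINT y|empirical (a 1) (n k) x. test i y) \<longlonglongrightarrow> (LINT y|Q. test i y)"
      by (rule wconv_test[OF empirical_prob Q w])
    then have 2: "(\<lambda>k. avg (a 1) (n k) (test i) x) \<longlonglongrightarrow> (LINT y|Q. test i y)"
      by (simp add: integral_empirical n0)
    have "(\<lambda>k. avg (a 1) (n k) (\<lambda>y. test i (a 1 y)) x - avg (a 1) (n k) (test i) x) \<longlonglongrightarrow> 0"
      by (rule avg_shift_tendsto[OF abs_test_le_bound n])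
    with 1 2 have "(LINT y|Q. test i (a 1 y)) = (LINT y|Q. test i y)"
      using LIMSEQ_unique[OF tendsto_diff[OF 1 2]] by fastforce
    moreover have "(LINT y|distr Q borel (a 1). test i y) = (LINT y|Q. test i (a 1 y))"
      by (rule integral_distr[OF m]) simp
    ultimately show "(LINT y|distr Q borel (a 1). test i y) = (LINT y|Q. test i y)" by simp
  qed
qed

lemma wconv_const: "wconv (\<lambda>_. P) P"
  by (simp add: wconv_def Liminf_const)

text \<open>The limiting frequency \<open>L i\<close> of visits to \<open>K i\<close> has integral
  \<open>measure P (K i)\<close>, so \<open>1 - L i\<close> has mean at most
  \<open>(1 / 2) ^ i\<close>. The infimum over \<open>i\<close> then has mean 0 and vanishes almost
  everywhere: some \<open>K i\<close> is visited with frequency close to 1.\<close>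

lemma AE_tight_averages:
  fixes a :: "int \<Rightarrow> 'a::polish_space \<Rightarrow> 'a"
  assumes act: "continuous_int_action a" and P: "P \<in> invariant_probs a" and n: "\<And>k::nat. k < n k"
    and K: "\<And>i. K i \<in> sets borel" "\<And>i. 1 - (1 / 2) ^ i \<le> measure P (K i)"
    and conv: "\<And>i. AE x in P. convergent (\<lambda>k. avg (a 1) (n k) (indicator (K i)) x)"
  shows "AE x in P. \<forall>e>0. \<exists>i. \<forall>\<^sub>F k in sequentially. 1 - e \<le> avg (a 1) (n k) (indicator (K i)) x"
proof -
  note P' = invariant_probsD(1)[OF P]
  interpret prob_space P by (rule invariant_probsD(2)[OF P])
  have [measurable]: "avg (a 1) (n k) (indicator (K i)) \<in> borel_measurable borel" for i k
    using K(1) by (intro measurable_avg[OF action_measurable[OF act]]) auto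
  define L where "L i x = lim (\<lambda>k. avg (a 1) (n k) (indicator (K i)) x)" for i x
  have Lm: "L i \<in> borel_measurable borel" for i unfolding L_def[abs_def] by measurable
  note [measurable] = measurable_prob_cong[OF P' Lm]
  have Llim: "AE x in P. (\<lambda>k. avg (a 1) (n k) (indicator (K i)) x) \<longlonglongrightarrow> L i x" for i
    using conv[of i] by eventually_elim (simp add: L_def convergent_LIMSEQ_iff)
  have Lint: "(LINT x|P. L i x) = measure P (K i)" for i
  proof -
    have "(LINT x|P. L i x) = (LINT x|P. indicator (K i) x)"
      by (rule integral_limit_avg[OF act P _ _ n Lm Llim, where B=1]) (use K(1) in \<open>auto simp: indicator_def\<close>)
    then show ?thesis using K(1) by (simp add: invariant_probsD[OF P])
  qed
  have Lb: "AE x in P. 0 \<le> L i x \<and> L i x \<le> 1" for i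
    using Llim[of i]
  proof eventually_elim
    case (elim x)
    have "\<bar>avg (a 1) (n k) (indicator (K i)) x\<bar> \<le> 1" for k
      by (rule avg_bounded) (auto simp: indicator_def)
    moreover have "0 \<le> avg (a 1) (n k) (indicator (K i)) x" for k
      by (auto simp: avg_def intro!: divide_nonneg_nonneg sum_nonneg)
    ultimately show ?case
      using LIMSEQ_le_const[OF elim] LIMSEQ_le_const2[OF elim] by (auto simp: abs_le_iff)
  qed
  have "(\<integral>\<^sup>+ x. (INF i. ennreal (1 - L i x)) \<partial>P) \<le> ennreal ((1 / 2) ^ i)" for i
  proof -
    have int: "integrable P (L i)"
      by (rule integrable_const_bound[where B=1]) (use Lb[of i] in auto)
    have "(\<integral>\<^sup>+ x. (INF i. ennreal (1 - L i x)) \<partial>P) \<le> (\<integral>\<^sup>+ x. ennreal (1 - L i x) \<partial>P)"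
      by (intro nn_integral_mono INF_lower) simp
    also have "\<dots> = ennreal (LINT x|P. 1 - L i x)"
      using int Lb[of i] by (intro nn_integral_eq_integral) auto
    also have "(LINT x|P. 1 - L i x) = 1 - measure P (K i)"
      using int by (simp add: Lint prob_space)
    also have "ennreal \<dots> \<le> ennreal ((1 / 2) ^ i)" using K(2)[of i] by (intro ennreal_leI) simp
    finally show ?thesis .
  qed
  moreover have "(\<lambda>i. ennreal ((1 / 2) ^ i)) \<longlonglongrightarrow> ennreal 0"
    by (intro tendsto_ennrealI LIMSEQ_realpow_zero) auto
  ultimately have "(\<integral>\<^sup>+ x. (INF i. ennreal (1 - L i x)) \<partial>P) \<le> ennreal 0"
    by (intro LIMSEQ_le_const) auto
  then have "AE x in P. (INF i. ennreal (1 - L i x)) = 0"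
    by (subst nn_integral_0_iff_AE[symmetric]) auto
  moreover have "AE x in P. \<forall>i. (\<lambda>k. avg (a 1) (n k) (indicator (K i)) x) \<longlonglongrightarrow> L i x"
    using Llim by (simp add: AE_all_countable)
  ultimately show ?thesis
  proof eventually_elim
    case (elim x)
    show ?case
    proof (intro allI impI)
      fix e :: real assume "0 < e"
      then have "(INF i. ennreal (1 - L i x)) < ennreal e" using elim(1) by simp
      then obtain i where "ennreal (1 - L i x) < ennreal e" by (auto simp: INF_less_iff)
      then have "1 - e < L i x" using \<open>0 < e\<close> by (cases "0 \<le> 1 - L i x") (auto simp: ennreal_less_iff)
      from order_tendstoD(1)[OF spec[OF elim(2)] this]
      show "\<exists>i. \<forall>\<^sub>F k in sequentially. 1 - e \<le> avg (a 1) (n k) (indicator (K i)) x"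
        by (intro exI[of _ i]) (auto elim: eventually_mono)
    qed
  qed
qed

text \<open>For almost every \<open>x\<close> the empirical measures are tight, which yields a limit
  measure along a further subsequence depending on \<open>x\<close>. As the test averages converge
  along all of \<open>n\<close>, the limits found there are the limits along
  \<open>n\<close>.\<close>

lemma ergodic_limits:
  fixes a :: "int \<Rightarrow> 'a::polish_space \<Rightarrow> 'a"
  assumes act: "continuous_int_action a" and P: "P \<in> invariant_probs a"
  obtains n :: "nat \<Rightarrow> nat" where "\<And>k. k < n k"
    "AE x in P. \<exists>Q\<in>invariant_probs a. \<forall>j. (\<lambda>k. avg (a 1) (n k) (test j) x) \<longlonglongrightarrow> (LINT y|Q. test j y)"
proof -
  note P' = invariant_probsD(1)[OF P]
  interpret prob_space P by (rule invariant_probsD(2)[OF P])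
  have "\<exists>K. compact K \<and> 1 - (1 / 2) ^ i \<le> measure P K" for i :: nat
    using wconv_tight[OF P' P' wconv_const, of "(1 / 2) ^ i"] by force
  then obtain K where K: "\<And>i::nat. compact (K i)" "\<And>i. 1 - (1 / 2) ^ i \<le> measure P (K i)" by metis
  have Kb: "K i \<in> sets borel" for i using K(1) by (simp add: compact_imp_closed)
  \<comment> \<open>Test functions at even and indicators of compact sets at odd positions, so that
    one subsequence gives convergence of both.\<close>
  define f where "f j = (if even j then test (j div 2) else indicator (K (j div 2)))" for j :: nat
  have fe: "f (2 * j) = test j" "f (2 * j + 1) = indicator (K j)" for j by (auto simp: f_def)
  have fm: "f j \<in> borel_measurable P" for j
    using Kb by (auto simp: f_def intro!: measurable_prob_cong[OF P'])
  define B where "B j = max 1 (test_bound TYPE('a) (j div 2))" for j :: nat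
  have fB: "\<bar>f j x\<bar> \<le> B j" for j x
    using abs_test_le_bound[of "j div 2" x] by (auto simp: f_def B_def indicator_def)
  have inv: "distr P P (a 1) = P" by (simp add: distr_action[OF P'] invariant_probsD(5)[OF P])
  have "\<exists>n. (\<forall>k. k < n k) \<and> (\<forall>j. AE x in P. convergent (\<lambda>k. avg (a 1) (n k) (f j) x))"
    by (rule mean_ergodic_subsequence[where f=f and B=B, OF action_measurable'[OF act P'] inv fm fB]) blast
  then obtain n where n: "\<And>k. k < n k" and conv: "\<And>j. AE x in P. convergent (\<lambda>k. avg (a 1) (n k) (f j) x)"
    by blast
  have n0: "0 < n k" for k using n[of k] by linarith
  have "AE x in P. \<forall>j. convergent (\<lambda>k. avg (a 1) (n k) (test j) x)"
    unfolding AE_all_countable using conv[of "2 * _"] by (simp add: fe)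
  moreover have "AE x in P. \<forall>e>0. \<exists>i. \<forall>\<^sub>F k in sequentially. 1 - e \<le> avg (a 1) (n k) (indicator (K i)) x"
    using conv[of "2 * _ + 1"] by (intro AE_tight_averages[OF act P n Kb K(2)]) (simp add: fe[simplified])
  ultimately have "AE x in P. \<exists>Q\<in>invariant_probs a. \<forall>j. (\<lambda>k. avg (a 1) (n k) (test j) x) \<longlonglongrightarrow> (LINT y|Q. test j y)"
  proof eventually_elim
    case (elim x)
    have tight: "\<exists>K. compact K \<and> (\<forall>\<^sub>F k in sequentially. 1 - e \<le> measure (empirical (a 1) (n k) x) K)" if "0 < e" for e
    proof -
      obtain i where "\<forall>\<^sub>F k in sequentially. 1 - e \<le> avg (a 1) (n k) (indicator (K i)) x"
        using elim(2) \<open>0 < e\<close> by blast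
      then show ?thesis using K(1)[of i] by (intro exI[of _ "K i"]) (simp add: measure_empirical[OF n0 Kb])
    qed
    obtain r Q where r: "\<And>k. k \<le> r k" and Q: "Q \<in> prob_measures borel"
      and w: "wconv (\<lambda>k. empirical (a 1) (n (r k)) x) Q"
      using prokhorov[OF empirical_prob tight] by metis
    have n': "k < n (r k)" for k using r[of k] n[of "r k"] by linarith
    have n0': "0 < n (r k)" for k using n0 .
    have "Q \<in> invariant_probs a" by (rule empirical_limit_invariant[OF act n' Q w])
    moreover have "(\<lambda>k. avg (a 1) (n k) (test j) x) \<longlonglongrightarrow> (LINT y|Q. test j y)" for j
    proof -
      have "(\<lambda>k. LINT y|empirical (a 1) (n (r k)) x. test j y) \<longlonglongrightarrow> (LINT y|Q. test j y)"
        by (rule wconv_test[OF empirical_prob Q w])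
      then have 1: "(\<lambda>k. avg (a 1) (n (r k)) (test j) x) \<longlonglongrightarrow> (LINT y|Q. test j y)"
        by (simp add: integral_empirical n0')
      obtain l where l: "(\<lambda>k. avg (a 1) (n k) (test j) x) \<longlonglongrightarrow> l"
        using elim(1) by (auto simp: convergent_def)
      have "filterlim r at_top sequentially"
        by (rule filterlim_at_top_mono[OF filterlim_ident]) (use r in auto)
      from filterlim_compose[OF l this] 1 have "l = (LINT y|Q. test j y)" by (rule LIMSEQ_unique)
      with l show ?thesis by simp
    qed
    ultimately show ?case by blast
  qed
  with n show thesis by (rule that)
qed

subsection \<open>Ergodicity and extreme points\<close>

abbreviation ergodics :: "(int \<Rightarrow> 'a::topological_space \<Rightarrow> 'a) \<Rightarrow> 'a measure set" where
  "ergodics a \<equiv> extreme_measures (invariant_probs a)"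

lemma ergodics_invariant: "P \<in> ergodics a \<Longrightarrow> P \<in> invariant_probs a"
  by (simp add: extreme_measures_def)

lemma ergodics_prob: "P \<in> ergodics a \<Longrightarrow> P \<in> prob_measures borel"
  by (rule invariant_probsD(1)[OF ergodics_invariant])

text \<open>Ergodicity in its usual form. For invariant measures it is equivalent to extremality, by
  \<open>ergodics_zero_one\<close> and \<open>zero_one_ergodic\<close>, and unlike extremality it
  passes easily to images.\<close>

definition zero_one_law :: "(int \<Rightarrow> 'a::topological_space \<Rightarrow> 'a) \<Rightarrow> 'a measure \<Rightarrow> bool" where
  "zero_one_law a P \<longleftrightarrow> (\<forall>A\<in>sets borel. a 1 -` A = A \<longrightarrow> measure P A = 0 \<or> measure P A = 1)"

lemma uniform_measure_invariant:
  assumes act: "continuous_int_action a" and P: "P \<in> invariant_probs a"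
    and A: "A \<in> sets borel" "a 1 -` A = A" "emeasure P A \<noteq> 0"
  shows "uniform_measure P A \<in> invariant_probs a"
proof -
  interpret prob_space P by (rule invariant_probsD(2)[OF P])
  have sP: "sets P = sets borel" "space P = UNIV" using invariant_probsD[OF P] by auto
  have U: "uniform_measure P A \<in> prob_measures borel"
    using A(3) sP by (auto simp: prob_measures_def intro!: prob_space_uniform_measure emeasure_finite)
  have m: "a 1 \<in> uniform_measure P A \<rightarrow>\<^sub>M borel"
    by (rule measurable_prob_cong[OF U action_measurable[OF act]])
  show ?thesis
  proof (rule invariant_probsI[OF act U], rule measure_eqI)
    fix B assume "B \<in> sets (distr (uniform_measure P A) borel (a 1))"
    then have B: "B \<in> sets borel" by simp
    have aB: "a 1 -` B \<in> sets borel" using measurable_sets[OF action_measurable[OF act] B] by simp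
    have "emeasure (distr (uniform_measure P A) borel (a 1)) B = emeasure (uniform_measure P A) (a 1 -` B)"
      using emeasure_distr[OF m B] sP by simp
    also have "\<dots> = emeasure P (A \<inter> a 1 -` B) / emeasure P A"
      using A(1) aB by (simp add: sP)
    also have "A \<inter> a 1 -` B = a 1 -` (A \<inter> B)" using A(2) by blast
    also have "emeasure P (a 1 -` (A \<inter> B)) = emeasure P (A \<inter> B)"
      using A(1) B by (intro emeasure_invariant[OF act P]) auto
    also have "emeasure P (A \<inter> B) / emeasure P A = emeasure (uniform_measure P A) B"
      using A(1) B by (simp add: sP)
    finally show "emeasure (distr (uniform_measure P A) borel (a 1)) B = emeasure (uniform_measure P A) B" .
  qed (simp add: sP)
qed

text \<open>An invariant set of intermediate mass splits \<open>P\<close> into its conditionings on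
  the set and on the complement. Both are invariant, and they differ.\<close>

lemma ergodics_zero_one:
  assumes act: "continuous_int_action a" and P: "P \<in> ergodics a"
  shows "zero_one_law a P"
  unfolding zero_one_law_def
proof (intro ballI impI)
  fix A assume A: "A \<in> sets borel" "a 1 -` A = A"
  note PI = ergodics_invariant[OF P]
  interpret prob_space P by (rule invariant_probsD(2)[OF PI])
  have sP: "sets P = sets borel" "space P = UNIV" using invariant_probsD[OF PI] by auto
  show "measure P A = 0 \<or> measure P A = 1"
  proof (rule ccontr)
    assume "\<not> ?thesis"
    then have p: "0 < measure P A" "measure P A < 1"
      using prob_le_1[of A] measure_nonneg[of P A] by (auto simp: order_less_le)
    have c: "measure P (UNIV - A) = 1 - measure P A" using prob_compl[of A] A(1) by (simp add: sP)
    define Q R where "Q = uniform_measure P A" and "R = uniform_measure P (UNIV - A)"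
    have Q: "Q \<in> invariant_probs a"
      unfolding Q_def using p by (intro uniform_measure_invariant[OF act PI] A) (auto simp: emeasure_eq_measure)
    have R: "R \<in> invariant_probs a"
      unfolding R_def using p c A by (intro uniform_measure_invariant[OF act PI]) (auto simp: emeasure_eq_measure)
    have Qm: "measure Q B = measure P (A \<inter> B) / measure P A" if "B \<in> sets borel" for B
      using A(1) that p unfolding Q_def measure_def
      by (simp add: sP emeasure_eq_measure divide_ennreal)
    have Rm: "measure R B = measure P ((UNIV - A) \<inter> B) / measure P (UNIV - A)" if "B \<in> sets borel" for B
      using A(1) that p c unfolding R_def measure_def
      by (simp add: sP emeasure_eq_measure divide_ennreal)
    have "Q = R"
    proof -
      \<comment> \<open>The weight \<open>t\<close> of \<open>extreme_measures\<close> belongs to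
        the second measure, hence it is \<open>1 - measure P A\<close> here.\<close>
      have "measure P B = (1 - (1 - measure P A)) * measure Q B + (1 - measure P A) * measure R B" if "B \<in> sets P" for B
      proof -
        have "measure P B = measure P (A \<inter> B) + measure P ((UNIV - A) \<inter> B)"
        proof -
          have "A \<inter> B \<union> (UNIV - A) \<inter> B = B" "A \<inter> B \<inter> ((UNIV - A) \<inter> B) = {}" by blast+
          then show ?thesis
            using A(1) that finite_measure_Union[of "A \<inter> B" "(UNIV - A) \<inter> B"] by (simp add: sP)
        qed
        then show ?thesis using that p c by (simp add: Qm Rm sP)
      qed
      moreover have "0 < 1 - measure P A" "1 - measure P A < 1" using p by auto
      ultimately show ?thesis using P Q R unfolding extreme_measures_def by blast
    qed
    moreover have "measure Q A = 1" "measure R A = 0" using A p by (simp_all add: Qm Rm Diff_Int_distrib2)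
    ultimately show False by simp
  qed
qed

text \<open>The set where the limit exceeds its mean \<open>c\<close> has mass 0 or 1, so
  \<open>L - c\<close> has almost everywhere one sign; having integral 0, it vanishes.\<close>

lemma limit_constant_if_zero_one:
  assumes act: "continuous_int_action a" and P: "P \<in> invariant_probs a" and zo: "zero_one_law a P"
    and f: "f \<in> borel_measurable borel" and B: "\<And>x. \<bar>f x\<bar> \<le> B" and n: "\<And>k::nat. k < n k"
    and L: "L \<in> borel_measurable borel" and LB: "\<And>x. \<bar>L x\<bar> \<le> B"
    and lim: "AE x in P. (\<lambda>k. avg (a 1) (n k) f x) \<longlonglongrightarrow> L x"
  shows "AE x in P. L x = (LINT y|P. f y)"
proof -
  note P' = invariant_probsD(1)[OF P]
  interpret prob_space P by (rule invariant_probsD(2)[OF P])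
  define c where "c = (LINT y|P. f y)"
  \<comment> \<open>\<open>L\<close> is determined only almost everywhere. Phrasing the condition
    through the averages, with a rational margin above \<open>c\<close>, gives a set that is
    invariant exactly and agrees with \<open>{x. c < L x}\<close> up to a null set.\<close>
  define A where "A = {y. \<exists>q::rat. c < of_rat q \<and> (\<forall>\<^sub>F k in sequentially. of_rat q < avg (a 1) (n k) f y)}"
  have [measurable]: "avg (a 1) (n k) f \<in> borel_measurable borel" for k
    using f by (intro measurable_avg[OF action_measurable[OF act]])
  have "Measurable.pred borel (\<lambda>y. \<exists>q::rat. c < of_rat q \<and> (\<forall>\<^sub>F k in sequentially. of_rat q < avg (a 1) (n k) f y))"
    unfolding eventually_sequentially by measurable
  then have Ab: "A \<in> sets borel" by (simp add: A_def pred_def)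
  have diff: "(\<lambda>k. avg (a 1) (n k) f (a 1 y) - avg (a 1) (n k) f y) \<longlonglongrightarrow> 0" for y
  proof -
    have "avg (a 1) (n k) f (a 1 y) = avg (a 1) (n k) (\<lambda>x. f (a 1 x)) y" for k
      by (simp add: avg_def funpow_swap1)
    then show ?thesis using avg_shift_tendsto[where T="a 1" and x=y, OF B n] by simp
  qed
  \<comment> \<open>The margin survives a vanishing perturbation after \<open>q\<close> is lowered
    to a rational strictly between \<open>c\<close> and \<open>q\<close>.\<close>
  have transfer: "\<exists>q::rat. c < of_rat q \<and> (\<forall>\<^sub>F k in sequentially. of_rat q < v k)"
    if q: "c < of_rat q" "\<forall>\<^sub>F k in sequentially. of_rat q < u k" and uv: "(\<lambda>k. u k - v k) \<longlonglongrightarrow> 0"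
    for u v :: "nat \<Rightarrow> real" and q :: rat
  proof -
    obtain q' where q': "c < of_rat q'" "of_rat q' < (of_rat q :: real)" using of_rat_dense[OF q(1)] by blast
    have "\<forall>\<^sub>F k in sequentially. u k - v k < of_rat q - of_rat q'"
      using order_tendstoD(2)[OF uv, of "of_rat q - of_rat q'"] q' by simp
    with q(2) have "\<forall>\<^sub>F k in sequentially. of_rat q' < v k" by eventually_elim linarith
    with q' show ?thesis by blast
  qed
  have "a 1 -` A = A"
  proof (rule set_eqI)
    fix y
    have d2: "(\<lambda>k. avg (a 1) (n k) f y - avg (a 1) (n k) f (a 1 y)) \<longlonglongrightarrow> 0"
      using tendsto_minus[OF diff[of y]] by simp
    show "y \<in> a 1 -` A \<longleftrightarrow> y \<in> A"
      unfolding A_def vimage_def mem_Collect_eq using transfer[OF _ _ diff] transfer[OF _ _ d2] by metis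
  qed
  with zo Ab have A01: "measure P A = 0 \<or> measure P A = 1" by (simp add: zero_one_law_def)
  have AL: "AE x in P. x \<in> A \<longleftrightarrow> c < L x"
    using lim
  proof eventually_elim
    case (elim x)
    show ?case
    proof
      assume "x \<in> A"
      then obtain q :: rat where q: "c < of_rat q" "\<forall>\<^sub>F k in sequentially. of_rat q < avg (a 1) (n k) f x"
        by (auto simp: A_def)
      have "of_rat q \<le> L x"
        by (rule tendsto_lowerbound[OF elim]) (use q(2) in \<open>auto elim: eventually_mono\<close>)
      with q show "c < L x" by linarith
    next
      assume "c < L x"
      then obtain q where "c < of_rat q" "of_rat q < L x" using of_rat_dense by blast
      then show "x \<in> A" using order_tendstoD(1)[OF elim] by (auto simp: A_def)
    qed
  qed
  have Lint: "(LINT x|P. L x) = c"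
    unfolding c_def by (rule integral_limit_avg[OF act P f B n L lim])
  have Li: "integrable P L" by (rule integrable_bounded_borel[OF P' L LB])
  have ae: "AE x in P. L x = c" if s: "AE x in P. 0 \<le> s * (L x - c)" "s \<noteq> 0" for s :: real
  proof -
    have "integrable P (\<lambda>x. s * (L x - c))" using Li by simp
    moreover have "(LINT x|P. s * (L x - c)) = 0" using Li by (simp add: Lint prob_space)
    ultimately have "AE x in P. s * (L x - c) = 0"
      using integral_nonneg_eq_0_iff_AE[of P "\<lambda>x. s * (L x - c)"] s(1) by blast
    then show ?thesis by eventually_elim (use s(2) in simp)
  qed
  have sP: "sets P = sets borel" "space P = UNIV" using invariant_probsD[OF P] by auto
  show ?thesis
    using A01
  proof
    assume "measure P A = 0"
    then have "AE x in P. x \<notin> A"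
      using Ab by (intro AE_not_in) (auto simp: null_sets_def sP emeasure_eq_measure)
    with AL have "AE x in P. 0 \<le> (-1) * (L x - c)" by eventually_elim simp
    then have "AE x in P. L x = c" by (rule ae) simp
    then show ?thesis by (simp add: c_def)
  next
    assume "measure P A = 1"
    then have "AE x in P. x \<in> A" using Ab by (intro AE_prob_1) simp
    with AL have "AE x in P. 0 \<le> 1 * (L x - c)" by eventually_elim simp
    then have "AE x in P. L x = c" by (rule ae) simp
    then show ?thesis by (simp add: c_def)
  qed
qed

text \<open>The two parts of a convex combination are absolutely continuous with respect to
  \<open>P\<close>, so the averages have the limits \<open>c j\<close> under them as well. By
  invariance their test integrals are \<open>c j\<close>, and the parts coincide.\<close>

lemma ergodic_if_constant_limits:
  fixes a :: "int \<Rightarrow> 'a::{metric_space,second_countable_topology} \<Rightarrow> 'a"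
  assumes act: "continuous_int_action a" and P: "P \<in> invariant_probs a" and n: "\<And>k::nat. k < n k"
    and lim: "AE x in P. \<forall>j. (\<lambda>k. avg (a 1) (n k) (test j) x) \<longlonglongrightarrow> c j"
  shows "P \<in> ergodics a"
  unfolding extreme_measures_def
proof (intro CollectI conjI P ballI allI impI)
  have sP: "sets P = sets borel" "space P = UNIV" using invariant_probsD[OF P] by auto
  have key: "(LINT y|S. test j y) = c j" if S: "S \<in> invariant_probs a"
    and ac: "\<And>A. A \<in> sets borel \<Longrightarrow> measure P A = 0 \<Longrightarrow> measure S A = 0" for S j
  proof -
    interpret S: prob_space S by (rule invariant_probsD(2)[OF S])
    interpret P: prob_space P by (rule invariant_probsD(2)[OF P])
    have sS: "sets S = sets borel" "space S = UNIV" using invariant_probsD[OF S] by auto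
    obtain N where N: "\<And>x. x \<in> space P - N \<Longrightarrow> \<forall>j. (\<lambda>k. avg (a 1) (n k) (test j) x) \<longlonglongrightarrow> c j" "N \<in> null_sets P"
      using AE_E3[OF lim] by blast
    have "N \<in> null_sets S"
      using N(2) ac[of N] by (auto simp: null_sets_def sP sS S.emeasure_eq_measure P.emeasure_eq_measure)
    then have limS: "AE x in S. (\<lambda>k. avg (a 1) (n k) (test j) x) \<longlonglongrightarrow> c j"
      by (rule AE_I') (use N(1) sP in auto)
    have "(LINT x|S. c j) = (LINT x|S. test j x)"
      by (rule integral_limit_avg[OF act S _ abs_test_le_bound n _ limS]) auto
    then show ?thesis by (simp add: S.prob_space)
  qed
  fix Q R and t :: real
  assume QR: "Q \<in> invariant_probs a" "R \<in> invariant_probs a" and t: "0 < t" "t < 1"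
    and eq: "\<forall>A\<in>sets P. measure P A = (1 - t) * measure Q A + t * measure R A"
  have "measure Q A = 0" "measure R A = 0" if "A \<in> sets borel" "measure P A = 0" for A
  proof -
    have "(1 - t) * measure Q A + t * measure R A = 0" using eq that sP by auto
    moreover have "0 \<le> (1 - t) * measure Q A" "0 \<le> t * measure R A" using t by auto
    ultimately have "(1 - t) * measure Q A = 0" "t * measure R A = 0" by linarith+
    then show "measure Q A = 0" "measure R A = 0" using t by auto
  qed
  then show "Q = R"
    using key[OF QR(1)] key[OF QR(2)]
    by (intro prob_eq_if_test_eq[OF invariant_probsD(1)[OF QR(1)] invariant_probsD(1)[OF QR(2)]]) simp
qed

subsection \<open>The ergodic decomposition\<close>

lemma measurable_testsI:
  fixes K :: "'b \<Rightarrow> 'a::{metric_space,second_countable_topology} measure"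
  assumes "\<And>x. x \<in> space M \<Longrightarrow> K x \<in> prob_measures borel"
    and "\<And>j. (\<lambda>x. LINT y|K x. test j y) \<in> borel_measurable M"
  shows "K \<in> M \<rightarrow>\<^sub>M prob_algebra borel"
proof -
  have "K \<in> M \<rightarrow>\<^sub>M borel_of (subtopology weak_topology (prob_measures borel))"
    by (rule measurable_subtopology_weak) (use assms in auto)
  from measurable_compose[OF this measurable_weak_prob_algebra[OF order_refl]] show ?thesis .
qed

lemma integral_kernel_measurable:
  fixes f :: "'a::topological_space \<Rightarrow> real"
  assumes "K \<in> M \<rightarrow>\<^sub>M prob_algebra borel" "f \<in> borel_measurable borel"
  shows "(\<lambda>x. LINT y|K x. f y) \<in> borel_measurable M"
  using measurable_compose[OF measurable_prob_algebraD[OF assms(1)] integral_measurable_subprob_algebra[OF assms(2)]] .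

lemma bind_kernel:
  fixes K :: "'b \<Rightarrow> 'a::topological_space measure" and f :: "'a \<Rightarrow> real"
  assumes P: "prob_space P" and K: "K \<in> P \<rightarrow>\<^sub>M prob_algebra borel"
  shows "P \<bind> K \<in> prob_measures borel"
    "A \<in> sets borel \<Longrightarrow> emeasure (P \<bind> K) A = (\<integral>\<^sup>+ x. emeasure (K x) A \<partial>P)"
    "g \<in> borel_measurable borel \<Longrightarrow> (\<integral>\<^sup>+ y. g y \<partial>(P \<bind> K)) = (\<integral>\<^sup>+ x. \<integral>\<^sup>+ y. g y \<partial>K x \<partial>P)"
    "f \<in> borel_measurable borel \<Longrightarrow> (\<And>y. \<bar>f y\<bar> \<le> B) \<Longrightarrow> (LINT y|(P \<bind> K). f y) = (LINT x|P. LINT y|K x. f y)"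
proof -
  interpret prob_space P by (rule P)
  note K' = measurable_prob_algebraD[OF K]
  have P': "P \<in> space (prob_algebra P)" using P by (simp add: space_prob_algebra)
  show "P \<bind> K \<in> prob_measures borel"
    unfolding prob_measures_def using prob_space_bind'[OF P' K] sets_bind'[OF P' K] by simp
  show "A \<in> sets borel \<Longrightarrow> emeasure (P \<bind> K) A = (\<integral>\<^sup>+ x. emeasure (K x) A \<partial>P)"
    by (rule emeasure_bind[OF not_empty K'])
  show "g \<in> borel_measurable borel \<Longrightarrow> (\<integral>\<^sup>+ y. g y \<partial>(P \<bind> K)) = (\<integral>\<^sup>+ x. \<integral>\<^sup>+ y. g y \<partial>K x \<partial>P)"
    by (rule nn_integral_bind[OF _ K'])
  show "(LINT y|(P \<bind> K). f y) = (LINT x|P. LINT y|K x. f y)" if "f \<in> borel_measurable borel" "\<And>y. \<bar>f y\<bar> \<le> B"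
  proof (rule integral_bind[where K=borel and B'=1 and B=B])
    show "K \<in> P \<rightarrow>\<^sub>M subprob_algebra borel" by (rule K')
    show "AE x in P. emeasure (K x) (space (K x)) \<le> ennreal 1"
    proof (rule AE_I2)
      fix x assume "x \<in> space P"
      then have "prob_space (K x)" using measurable_space[OF K] by (simp add: space_prob_algebra)
      then show "emeasure (K x) (space (K x)) \<le> ennreal 1" by (simp add: prob_space.emeasure_space_1)
    qed
  qed (use that in \<open>auto intro: finite_measure_axioms\<close>)
qed

text \<open>By this, properties that hold almost everywhere for a barycenter pass to its
  components.\<close>

lemma AE_kernel_null:
  assumes P: "prob_space P" and K: "K \<in> P \<rightarrow>\<^sub>M prob_algebra borel"
    and bary: "\<And>A. A \<in> sets borel \<Longrightarrow> emeasure R A = (\<integral>\<^sup>+ x. emeasure (K x) A \<partial>P)"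
    and N: "N \<in> sets borel" "emeasure R N = 0"
  shows "AE x in P. N \<in> null_sets (K x)"
proof -
  have "(\<lambda>x. emeasure (K x) N) \<in> borel_measurable P"
    by (rule measurable_emeasure_kernel[OF measurable_prob_algebraD[OF K] N(1)])
  then have "AE x in P. emeasure (K x) N = 0"
    using bary[OF N(1)] N(2) by (subst nn_integral_0_iff_AE[symmetric]) auto
  moreover have "AE x in P. sets (K x) = sets borel"
    using measurable_space[OF K] by (intro AE_I2) (simp add: space_prob_algebra)
  ultimately show ?thesis by eventually_elim (use N(1) in \<open>simp add: null_sets_def\<close>)
qed

text \<open>\<open>K x\<close> is the limit of the empirical measures of \<open>x\<close>, with
  \<open>P\<close> itself as the value on the exceptional null set, which keeps all values invariant
  and the kernel measurable. Mixing gives back \<open>P\<close> because limits of averages have the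
  integrals of the test functions.\<close>

lemma invariant_kernel:
  fixes a :: "int \<Rightarrow> 'a::polish_space \<Rightarrow> 'a"
  assumes act: "continuous_int_action a" and P: "P \<in> invariant_probs a"
  obtains n :: "nat \<Rightarrow> nat" and K where "\<And>k. k < n k" "\<And>x. K x \<in> invariant_probs a"
    "K \<in> borel \<rightarrow>\<^sub>M prob_algebra borel" "P \<bind> K = P"
    "AE x in P. \<forall>j. (\<lambda>k. avg (a 1) (n k) (test j) x) \<longlonglongrightarrow> (LINT y|K x. test j y)"
proof -
  note P' = invariant_probsD(1)[OF P]
  interpret prob_space P by (rule invariant_probsD(2)[OF P])
  have sP: "sets P = sets borel" "space P = UNIV" using invariant_probsD[OF P] by auto
  obtain n :: "nat \<Rightarrow> nat" where n: "\<And>k. k < n k" and ae: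
    "AE x in P. \<exists>Q\<in>invariant_probs a. \<forall>j. (\<lambda>k. avg (a 1) (n k) (test j) x) \<longlonglongrightarrow> (LINT y|Q. test j y)"
    by (rule ergodic_limits[OF act P]) blast
  obtain N where N: "\<And>x. x \<in> space P - N \<Longrightarrow> \<exists>Q\<in>invariant_probs a. \<forall>j. (\<lambda>k. avg (a 1) (n k) (test j) x) \<longlonglongrightarrow> (LINT y|Q. test j y)"
    "N \<in> null_sets P" using AE_E3[OF ae] by blast
  have Nb [measurable]: "N \<in> sets borel" using N(2) by (auto simp: null_sets_def sP)
  have "\<exists>Q. Q \<in> invariant_probs a \<and> (x \<notin> N \<longrightarrow> (\<forall>j. (\<lambda>k. avg (a 1) (n k) (test j) x) \<longlonglongrightarrow> (LINT y|Q. test j y)))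
      \<and> (x \<in> N \<longrightarrow> Q = P)" for x
  proof (cases "x \<in> N")
    case True
    then show ?thesis using P by auto
  next
    case False
    then show ?thesis using N(1)[of x] by (auto simp: sP)
  qed
  then obtain K where K: "\<And>x. K x \<in> invariant_probs a"
    "\<And>x j. x \<notin> N \<Longrightarrow> (\<lambda>k. avg (a 1) (n k) (test j) x) \<longlonglongrightarrow> (LINT y|K x. test j y)" "\<And>x. x \<in> N \<Longrightarrow> K x = P"
    by metis
  have [measurable]: "avg (a 1) (n k) (test j) \<in> borel_measurable borel" for k j
    by (intro measurable_avg[OF action_measurable[OF act]]) simp
  have Km: "K \<in> borel \<rightarrow>\<^sub>M prob_algebra borel"
  proof (rule measurable_testsI)
    show "K x \<in> prob_measures borel" for x using invariant_probsD(1)[OF K(1)] .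
    fix j
    show "(\<lambda>x. LINT y|K x. test j y) \<in> borel_measurable borel"
    proof (rule borel_measurable_LIMSEQ_real)
      show "(\<lambda>k. if x \<in> N then (LINT y|P. test j y) else avg (a 1) (n k) (test j) x) \<longlonglongrightarrow> (LINT y|K x. test j y)" for x
        using K(2)[of x j] K(3)[of x] by (cases "x \<in> N") auto
      show "(\<lambda>x. if x \<in> N then (LINT y|P. test j y) else avg (a 1) (n k) (test j) x) \<in> borel_measurable borel" for k
        by measurable
    qed
  qed
  have lim: "AE x in P. \<forall>j. (\<lambda>k. avg (a 1) (n k) (test j) x) \<longlonglongrightarrow> (LINT y|K x. test j y)"
    using AE_not_in[OF N(2)] by eventually_elim (use K(2) in blast)
  have KP: "K \<in> P \<rightarrow>\<^sub>M prob_algebra borel" by (rule measurable_prob_cong[OF P' Km])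
  note b = bind_kernel[OF prob_space_axioms KP]
  have "P \<bind> K = P"
  proof (rule prob_eq_if_test_eq[OF b(1) P'])
    fix j
    have limj: "AE x in P. (\<lambda>k. avg (a 1) (n k) (test j) x) \<longlonglongrightarrow> (LINT y|K x. test j y)"
      using lim by eventually_elim blast
    have "(LINT y|(P \<bind> K). test j y) = (LINT x|P. LINT y|K x. test j y)"
      by (rule b(4)[OF _ abs_test_le_bound]) simp
    also have "\<dots> = (LINT y|P. test j y)"
      by (rule integral_limit_avg[OF act P _ abs_test_le_bound n integral_kernel_measurable[OF Km] limj]) auto
    finally show "(LINT y|(P \<bind> K). test j y) = (LINT y|P. test j y)" .
  qed
  with n K(1) Km show thesis using lim by (rule that)
qed

lemma abs_integral_le:
  assumes P: "P \<in> prob_measures borel" and f: "f \<in> borel_measurable borel" and B: "\<And>x. \<bar>f x\<bar> \<le> (B::real)"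
  shows "\<bar>LINT x|P. f x\<bar> \<le> B"
proof -
  interpret prob_space P using prob_measuresD[OF P] by simp
  have i: "integrable P f" by (rule integrable_bounded_borel[OF P f B])
  have "\<bar>LINT x|P. f x\<bar> \<le> (LINT x|P. \<bar>f x\<bar>)" by (rule integral_abs_bound)
  also have "\<dots> \<le> (LINT x|P. B)" using i B by (intro integral_mono) auto
  finally show ?thesis by (simp add: prob_space)
qed

text \<open>Conditioning twice on the invariant sets changes nothing, so the conditional variances of the
  limits of the averages integrate to zero.\<close>

lemma kernel_ergodic:
  fixes a :: "int \<Rightarrow> 'a::polish_space \<Rightarrow> 'a"
  assumes act: "continuous_int_action a" and P: "P \<in> invariant_probs a"
    and n: "\<And>k::nat. k < n k" and KI: "\<And>x. K x \<in> invariant_probs a"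
    and Km: "K \<in> borel \<rightarrow>\<^sub>M prob_algebra borel" and PK: "P \<bind> K = P"
    and lim: "AE x in P. \<forall>j. (\<lambda>k. avg (a 1) (n k) (test j) x) \<longlonglongrightarrow> (LINT y|K x. test j y)"
  shows "AE x in P. K x \<in> ergodics a"
proof -
  note P' = invariant_probsD(1)[OF P]
  interpret prob_space P by (rule invariant_probsD(2)[OF P])
  have sP: "sets P = sets borel" "space P = UNIV" using invariant_probsD[OF P] by auto
  have KP: "K \<in> P \<rightarrow>\<^sub>M prob_algebra borel" by (rule measurable_prob_cong[OF P' Km])
  note b = bind_kernel[OF prob_space_axioms KP, unfolded PK]
  define L where "L j x = (LINT y|K x. test j y)" for j x
  define C where "C j = test_bound TYPE('a) j" for j
  have Lm [measurable]: "L j \<in> borel_measurable borel" for j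
    unfolding L_def by (rule integral_kernel_measurable[OF Km]) simp
  have LB: "\<bar>L j x\<bar> \<le> C j" for j x
    unfolding L_def C_def by (rule abs_integral_le[OF invariant_probsD(1)[OF KI] _ abs_test_le_bound]) simp
  have L2B: "\<bar>(L j x)\<^sup>2\<bar> \<le> (C j)\<^sup>2" for j x
    using power_mono[OF LB[of j x], of 2] by simp
  have C0: "0 \<le> C j" for j using LB[of j undefined] by linarith
  obtain N where N: "\<And>x. x \<in> space P - N \<Longrightarrow> \<forall>j. (\<lambda>k. avg (a 1) (n k) (test j) x) \<longlonglongrightarrow> L j x" "N \<in> null_sets P"
    using AE_E3[OF lim] unfolding L_def by blast
  have "AE x in P. N \<in> null_sets (K x)"
    by (rule AE_kernel_null[OF prob_space_axioms KP b(2)]) (use N(2) sP in \<open>auto simp: null_sets_def\<close>)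
  then have good: "AE x in P. AE y in K x. \<forall>j. (\<lambda>k. avg (a 1) (n k) (test j) y) \<longlonglongrightarrow> L j y"
  proof eventually_elim
    case (elim x)
    from AE_not_in[OF this] show ?case
      by eventually_elim (use N(1) sP in auto)
  qed
  \<comment> \<open>Under the invariant measure \<open>K x\<close> the averages of
    \<open>test j\<close> still converge to \<open>L j\<close>, so the mean of \<open>L j\<close> is
    that of \<open>test j\<close>, which is \<open>L j x\<close> by definition.\<close>
  have LL: "AE x in P. \<forall>j. (LINT y|K x. L j y) = L j x"
    using good
  proof eventually_elim
    case (elim x)
    show ?case
    proof
      fix j
      have "AE y in K x. (\<lambda>k. avg (a 1) (n k) (test j) y) \<longlonglongrightarrow> L j y"
        using elim by eventually_elim blast
      from integral_limit_avg[OF act KI _ abs_test_le_bound n Lm this]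
      show "(LINT y|K x. L j y) = L j x" by (simp add: L_def)
    qed
  qed
  have const: "AE x in P. AE y in K x. L j y = L j x" for j
  proof -
    \<comment> \<open>The second moment minus the squared mean of \<open>L j\<close> under
      \<open>K x\<close>, by \<open>LL\<close>. Since mixing the \<open>K x\<close> gives
      \<open>P\<close>, the two terms have equal integrals.\<close>
    define V where "V x = (LINT y|K x. (L j y)\<^sup>2) - (L j x)\<^sup>2" for x
    have m2: "(\<lambda>x. LINT y|K x. (L j y)\<^sup>2) \<in> borel_measurable borel"
      by (rule integral_kernel_measurable[OF Km]) simp
    have i1: "integrable P (\<lambda>x. LINT y|K x. (L j y)\<^sup>2)"
    proof (rule integrable_bounded_borel[OF P' m2])
      show "\<bar>LINT y|K x. (L j y)\<^sup>2\<bar> \<le> (C j)\<^sup>2" for x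
        by (rule abs_integral_le[OF invariant_probsD(1)[OF KI] _ L2B]) simp
    qed
    have i2: "integrable P (\<lambda>x. (L j x)\<^sup>2)"
      by (rule integrable_bounded_borel[OF P' _ L2B]) simp
    have var: "AE x in P. V x = (LINT y|K x. (L j y - L j x)\<^sup>2)"
      using LL
    proof eventually_elim
      case (elim x)
      interpret K: prob_space "K x" by (rule invariant_probsD(2)[OF KI])
      have j1: "integrable (K x) (L j)" by (rule integrable_bounded_borel[OF invariant_probsD(1)[OF KI] Lm LB])
      have j2: "integrable (K x) (\<lambda>y. (L j y)\<^sup>2)"
        by (rule integrable_bounded_borel[OF invariant_probsD(1)[OF KI] _ L2B]) simp
      have "(LINT y|K x. (L j y - L j x)\<^sup>2) = (LINT y|K x. (L j y)\<^sup>2 - 2 * L j x * L j y + (L j x)\<^sup>2)"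
        by (intro Bochner_Integration.integral_cong) (auto simp: power2_eq_square algebra_simps)
      also have "\<dots> = (LINT y|K x. (L j y)\<^sup>2) - 2 * L j x * (LINT y|K x. L j y) + (L j x)\<^sup>2"
        using j1 j2 by (simp add: K.prob_space)
      also have "\<dots> = V x" using elim by (simp add: V_def power2_eq_square)
      finally show ?case by simp
    qed
    have "integrable P V" unfolding V_def using i1 i2 by simp
    moreover have "(LINT x|P. V x) = 0"
    proof -
      have "(LINT y|P. (L j y)\<^sup>2) = (LINT x|P. LINT y|K x. (L j y)\<^sup>2)"
        by (rule b(4)[OF _ L2B]) simp
      then show ?thesis unfolding V_def using i1 i2 by simp
    qed
    moreover have "AE x in P. 0 \<le> V x"
      using var by eventually_elim simp
    ultimately have "AE x in P. V x = 0"
      using integral_nonneg_eq_0_iff_AE[of P V] by blast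
    with var show ?thesis
    proof eventually_elim
      case (elim x)
      interpret K: prob_space "K x" by (rule invariant_probsD(2)[OF KI])
      have "integrable (K x) (\<lambda>y. (L j y - L j x)\<^sup>2)"
      proof (rule integrable_bounded_borel[OF invariant_probsD(1)[OF KI]])
        show "\<bar>(L j y - L j x)\<^sup>2\<bar> \<le> (2 * C j)\<^sup>2" for y
        proof -
          have "\<bar>L j y - L j x\<bar> \<le> 2 * C j" using LB[of j y] LB[of j x] by linarith
          from power_mono[OF this, of 2] show ?thesis by simp
        qed
      qed simp
      then have "AE y in K x. (L j y - L j x)\<^sup>2 = 0"
        using integral_nonneg_eq_0_iff_AE[of "K x" "\<lambda>y. (L j y - L j x)\<^sup>2"] elim by auto
      then show ?case by eventually_elim simp
    qed
  qed
  have "AE x in P. \<forall>j. AE y in K x. L j y = L j x"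
    using const by (simp add: AE_all_countable)
  with good show ?thesis
  proof eventually_elim
    case (elim x)
    have "AE y in K x. \<forall>j. L j y = L j x" using elim(2) by (simp add: AE_all_countable)
    with elim(1) have "AE y in K x. \<forall>j. (\<lambda>k. avg (a 1) (n k) (test j) y) \<longlonglongrightarrow> L j x"
      by eventually_elim simp
    then show ?case by (rule ergodic_if_constant_limits[OF act KI n])
  qed
qed

text \<open>A map into the space of ergodic measures must be ergodic everywhere, so on the
  exceptional null set the kernel gets its value at some good point \<open>x0\<close>.\<close>

lemma ergodic_kernel:
  fixes a :: "int \<Rightarrow> 'a::polish_space \<Rightarrow> 'a"
  assumes act: "continuous_int_action a" and P: "P \<in> invariant_probs a"
  obtains n :: "nat \<Rightarrow> nat" and K where "\<And>k. k < n k" "\<And>x. K x \<in> ergodics a"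
    "K \<in> borel \<rightarrow>\<^sub>M prob_algebra borel" "P \<bind> K = P"
    "AE x in P. \<forall>j. (\<lambda>k. avg (a 1) (n k) (test j) x) \<longlonglongrightarrow> (LINT y|K x. test j y)"
proof -
  note P' = invariant_probsD(1)[OF P]
  interpret prob_space P by (rule invariant_probsD(2)[OF P])
  have sP: "sets P = sets borel" "space P = UNIV" using invariant_probsD[OF P] by auto
  obtain n :: "nat \<Rightarrow> nat" and K where n: "\<And>k. k < n k" and KI: "\<And>x. K x \<in> invariant_probs a"
    and Km: "K \<in> borel \<rightarrow>\<^sub>M prob_algebra borel" and PK: "P \<bind> K = P"
    and lim: "AE x in P. \<forall>j. (\<lambda>k. avg (a 1) (n k) (test j) x) \<longlonglongrightarrow> (LINT y|K x. test j y)"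
    by (rule invariant_kernel[OF act P]) blast
  obtain N where N: "\<And>x. x \<in> space P - N \<Longrightarrow> K x \<in> ergodics a" "N \<in> null_sets P"
    using AE_E3[OF kernel_ergodic[OF act P n KI Km PK lim]] by blast
  have Nb [measurable]: "N \<in> sets borel" using N(2) by (auto simp: null_sets_def sP)
  have "N \<noteq> UNIV" using N(2) emeasure_space_1 by (auto simp: null_sets_def sP)
  then obtain x0 where "x0 \<notin> N" by blast
  then have e0: "K x0 \<in> ergodics a" using N(1) by (simp add: sP)
  define K' where "K' x = (if x \<in> N then K x0 else K x)" for x
  have K'e: "K' x \<in> ergodics a" for x using N(1) e0 by (simp add: K'_def sP)
  have K'm: "K' \<in> borel \<rightarrow>\<^sub>M prob_algebra borel"
    unfolding K'_def
    by (rule measurable_If_set[OF measurable_const Km])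
      (use measurable_space[OF Km, of x0] in auto)
  have eq: "AE x in P. K' x = K x" using AE_not_in[OF N(2)] by eventually_elim (simp add: K'_def)
  have KP: "K \<in> P \<rightarrow>\<^sub>M prob_algebra borel" "K' \<in> P \<rightarrow>\<^sub>M prob_algebra borel"
    by (rule measurable_prob_cong[OF P'], rule Km K'm)+
  have "P \<bind> K' = P \<bind> K"
  proof (rule prob_measures_eqI[OF bind_kernel(1)[OF prob_space_axioms KP(2)] bind_kernel(1)[OF prob_space_axioms KP(1)]])
    fix A :: "'a set" assume A: "A \<in> sets borel"
    have "(\<integral>\<^sup>+ x. emeasure (K' x) A \<partial>P) = (\<integral>\<^sup>+ x. emeasure (K x) A \<partial>P)"
      by (rule nn_integral_cong_AE) (use eq in eventually_elim, simp)
    then show "measure (P \<bind> K') A = measure (P \<bind> K) A"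
      unfolding measure_def bind_kernel(2)[OF prob_space_axioms KP(2) A] bind_kernel(2)[OF prob_space_axioms KP(1) A]
      by simp
  qed
  with PK have "P \<bind> K' = P" by simp
  moreover have "AE x in P. \<forall>j. (\<lambda>k. avg (a 1) (n k) (test j) x) \<longlonglongrightarrow> (LINT y|K' x. test j y)"
    using lim eq by eventually_elim simp
  ultimately show thesis using n K'e K'm by (intro that) 
qed

text \<open>The zero-one law makes the limits of the test averages constant, and constant limits
  force extremality.\<close>

lemma zero_one_ergodic:
  fixes a :: "int \<Rightarrow> 'a::polish_space \<Rightarrow> 'a"
  assumes act: "continuous_int_action a" and P: "P \<in> invariant_probs a" and zo: "zero_one_law a P"
  shows "P \<in> ergodics a"
proof -
  obtain n :: "nat \<Rightarrow> nat" and K where n: "\<And>k. k < n k" and KI: "\<And>x. K x \<in> invariant_probs a"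
    and Km: "K \<in> borel \<rightarrow>\<^sub>M prob_algebra borel"
    and lim: "AE x in P. \<forall>j. (\<lambda>k. avg (a 1) (n k) (test j) x) \<longlonglongrightarrow> (LINT y|K x. test j y)"
    by (rule invariant_kernel[OF act P]) blast
  have "AE x in P. (LINT y|K x. test j y) = (LINT y|P. test j y)" for j
  proof (rule limit_constant_if_zero_one[OF act P zo _ abs_test_le_bound n])
    show "(\<lambda>x. LINT y|K x. test j y) \<in> borel_measurable borel"
      by (rule integral_kernel_measurable[OF Km]) simp
    show "\<bar>LINT y|K x. test j y\<bar> \<le> test_bound TYPE('a) j" for x
      by (rule abs_integral_le[OF invariant_probsD(1)[OF KI] _ abs_test_le_bound]) simp
    show "AE x in P. (\<lambda>k. avg (a 1) (n k) (test j) x) \<longlonglongrightarrow> (LINT y|K x. test j y)"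
      using lim by eventually_elim blast
  qed simp
  then have "AE x in P. \<forall>j. (LINT y|K x. test j y) = (LINT y|P. test j y)" by (simp add: AE_all_countable)
  with lim have "AE x in P. \<forall>j. (\<lambda>k. avg (a 1) (n k) (test j) x) \<longlonglongrightarrow> (LINT y|P. test j y)"
    by eventually_elim simp
  then show ?thesis by (rule ergodic_if_constant_limits[OF act P n])
qed

section \<open>Existence and uniqueness of the representing measure\<close>

lemma ergodics_subset: "ergodics a \<subseteq> prob_measures borel"
  using ergodics_prob by blast

lemma measurable_ergodic_topology:
  fixes a :: "int \<Rightarrow> 'a::{metric_space,second_countable_topology} \<Rightarrow> 'a"
  assumes "K \<in> M \<rightarrow>\<^sub>M prob_algebra borel" "\<And>x. x \<in> space M \<Longrightarrow> K x \<in> ergodics a"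
  shows "K \<in> M \<rightarrow>\<^sub>M borel_of (ergodic_topology a)"
  unfolding ergodic_topology_def
  by (rule measurable_subtopology_weak[OF ergodics_subset assms(2) integral_kernel_measurable[OF assms(1)]]) auto

lemma kernel_ergodic_topology:
  fixes a :: "int \<Rightarrow> 'a::{metric_space,second_countable_topology} \<Rightarrow> 'a"
  shows "(\<lambda>Q. Q) \<in> borel_of (ergodic_topology a) \<rightarrow>\<^sub>M prob_algebra borel"
  unfolding ergodic_topology_def by (rule measurable_weak_prob_algebra[OF ergodics_subset])

lemma topspace_ergodic [simp]: "topspace (ergodic_topology a) = ergodics a"
  unfolding ergodic_topology_def topspace_subtopology using ergodics_subset[of a] by auto

text \<open>For almost every \<open>Q\<close> under \<open>m\<close>, the limits found under
  \<open>P\<close> also hold \<open>Q\<close>-almost everywhere, where the zero-one law makes them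
  the test integrals of \<open>Q\<close>; thus \<open>K\<close> equals \<open>Q\<close> almost
  everywhere under \<open>Q\<close>. Hence \<open>Q\<close> gives the set where \<open>K\<close>
  lies in \<open>S\<close> mass 1 or 0 according to whether \<open>Q\<close> is in \<open>S\<close>,
  and integrating over \<open>m\<close> determines \<open>m\<close>.\<close>

lemma decomposition_unique:
  fixes a :: "int \<Rightarrow> 'a::polish_space \<Rightarrow> 'a"
  assumes act: "continuous_int_action a" and P: "P \<in> invariant_probs a" and n: "\<And>k::nat. k < n k"
    and Ke: "\<And>x. K x \<in> ergodics a" and Km: "K \<in> borel \<rightarrow>\<^sub>M prob_algebra borel"
    and lim: "AE x in P. \<forall>j. (\<lambda>k. avg (a 1) (n k) (test j) x) \<longlonglongrightarrow> (LINT y|K x. test j y)"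
    and m: "m \<in> prob_measures (borel_of (ergodic_topology a))" and bary: "is_barycenter m P"
  shows "m = distr P (borel_of (ergodic_topology a)) K"
proof (rule measure_eqI)
  note P' = invariant_probsD(1)[OF P]
  have sP: "sets P = sets borel" "space P = UNIV" using invariant_probsD[OF P] by auto
  have sm: "sets m = sets (borel_of (ergodic_topology a))" "space m = ergodics a"
    using prob_measuresD[OF m] by auto
  show "sets m = sets (distr P (borel_of (ergodic_topology a)) K)" by (simp add: sm)
  have idm: "(\<lambda>Q. Q) \<in> m \<rightarrow>\<^sub>M prob_algebra borel"
    using kernel_ergodic_topology measurable_cong_sets[OF sm(1) refl] by blast
  have KT: "K \<in> borel \<rightarrow>\<^sub>M borel_of (ergodic_topology a)"
    by (rule measurable_ergodic_topology[OF Km Ke])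
  obtain N where N: "\<And>x. x \<in> space P - N \<Longrightarrow> \<forall>j. (\<lambda>k. avg (a 1) (n k) (test j) x) \<longlonglongrightarrow> (LINT y|K x. test j y)" "N \<in> null_sets P"
    using AE_E3[OF lim] by blast
  have "AE Q in m. N \<in> null_sets Q"
  proof (rule AE_kernel_null[OF prob_measuresD(1)[OF m] idm])
    show "A \<in> sets borel \<Longrightarrow> emeasure P A = (\<integral>\<^sup>+ Q. emeasure Q A \<partial>m)" for A
      using bary by (simp add: is_barycenter_def)
  qed (use N(2) sP in \<open>auto simp: null_sets_def\<close>)
  moreover have "AE Q in m. Q \<in> ergodics a" using sm(2) by (intro AE_I2) simp
  ultimately have fix_ae: "AE Q in m. AE y in Q. K y = Q"
  proof eventually_elim
    case (elim Q)
    note QI = ergodics_invariant[OF elim(2)]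
    have limQ: "AE y in Q. \<forall>j. (\<lambda>k. avg (a 1) (n k) (test j) y) \<longlonglongrightarrow> (LINT z|K y. test j z)"
      using AE_not_in[OF elim(1)] by eventually_elim (use N(1) sP in auto)
    have "AE y in Q. (LINT z|K y. test j z) = (LINT z|Q. test j z)" for j
    proof (rule limit_constant_if_zero_one[OF act QI ergodics_zero_one[OF act elim(2)] _ abs_test_le_bound n])
      show "(\<lambda>x. LINT y|K x. test j y) \<in> borel_measurable borel"
        by (rule integral_kernel_measurable[OF Km]) simp
      show "\<bar>LINT y|K x. test j y\<bar> \<le> test_bound TYPE('a) j" for x
        by (rule abs_integral_le[OF ergodics_prob[OF Ke] _ abs_test_le_bound]) simp
      show "AE x in Q. (\<lambda>k. avg (a 1) (n k) (test j) x) \<longlonglongrightarrow> (LINT y|K x. test j y)"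
        using limQ by eventually_elim blast
    qed simp
    then have "AE y in Q. \<forall>j. (LINT z|K y. test j z) = (LINT z|Q. test j z)" by (simp add: AE_all_countable)
    then show ?case
      by eventually_elim (rule prob_eq_if_test_eq[OF ergodics_prob[OF Ke] ergodics_prob[OF elim(2)]], blast)
  qed
  fix S assume "S \<in> sets m"
  then have S: "S \<in> sets (borel_of (ergodic_topology a))" by (simp add: sm)
  have KS: "K -` S \<in> sets borel" using measurable_sets[OF KT S] by simp
  have "emeasure m S = (\<integral>\<^sup>+ Q. indicator S Q \<partial>m)" using S by (simp add: sm)
  also have "\<dots> = (\<integral>\<^sup>+ Q. emeasure Q (K -` S) \<partial>m)"
  proof (rule nn_integral_cong_AE)
    have "AE Q in m. Q \<in> ergodics a" using sm(2) by (intro AE_I2) simp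
    with fix_ae show "AE Q in m. indicator S Q = emeasure Q (K -` S)"
    proof eventually_elim
      case (elim Q)
      note Q' = ergodics_prob[OF elim(2)]
      interpret Q: prob_space Q using prob_measuresD[OF Q'] by simp
      have sQ: "sets Q = sets borel" "space Q = UNIV" using prob_measuresD[OF Q'] by auto
      have "emeasure Q (K -` S) = emeasure Q (if Q \<in> S then UNIV else {})"
        by (rule emeasure_eq_AE) (use elim(1) KS sQ in auto)
      also have "\<dots> = indicator S Q" using Q.emeasure_space_1 by (simp add: sQ indicator_def)
      finally show ?case by simp
    qed
  qed
  also have "\<dots> = emeasure P (K -` S)" using bary KS by (simp add: is_barycenter_def)
  also have "\<dots> = emeasure (distr P (borel_of (ergodic_topology a)) K) S"
    using emeasure_distr[OF measurable_prob_cong[OF P' KT] S] by (simp add: sP)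
  finally show "emeasure m S = emeasure (distr P (borel_of (ergodic_topology a)) K) S" .
qed

lemma is_barycenter_distr:
  fixes a :: "int \<Rightarrow> 'a::{metric_space,second_countable_topology} \<Rightarrow> 'a"
  assumes M: "prob_space M" and f: "f \<in> M \<rightarrow>\<^sub>M borel_of (ergodic_topology a)"
    and eq: "\<And>A. A \<in> sets borel \<Longrightarrow> emeasure P A = (\<integral>\<^sup>+ x. emeasure (f x) A \<partial>M)"
  shows "is_barycenter (distr M (borel_of (ergodic_topology a)) f) P"
  unfolding is_barycenter_def
proof
  fix A :: "'a set" assume A: "A \<in> sets borel"
  have "(\<lambda>Q. emeasure Q A) \<in> borel_measurable (borel_of (ergodic_topology a))"
    by (rule measurable_emeasure_kernel[OF measurable_prob_algebraD[OF kernel_ergodic_topology] A])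
  then show "emeasure P A = (\<integral>\<^sup>+ Q. emeasure Q A \<partial>distr M (borel_of (ergodic_topology a)) f)"
    using eq[OF A] by (simp add: nn_integral_distr[OF f])
qed

text \<open>The law of the ergodic kernel under \<open>P\<close> is the representing measure; with
  uniqueness this gives meaning to the description in \<open>ergodic_decomposition\<close>.\<close>

lemma ergodic_decomposition_unique:
  fixes a :: "int \<Rightarrow> 'a::polish_space \<Rightarrow> 'a"
  assumes act: "continuous_int_action a" and P: "P \<in> invariant_probs a"
  shows "\<exists>!m. m \<in> prob_measures (borel_of (ergodic_topology a)) \<and> is_barycenter m P"
proof -
  note P' = invariant_probsD(1)[OF P]
  interpret prob_space P by (rule invariant_probsD(2)[OF P])
  obtain n :: "nat \<Rightarrow> nat" and K where n: "\<And>k. k < n k" and Ke: "\<And>x. K x \<in> ergodics a"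
    and Km: "K \<in> borel \<rightarrow>\<^sub>M prob_algebra borel" and PK: "P \<bind> K = P"
    and lim: "AE x in P. \<forall>j. (\<lambda>k. avg (a 1) (n k) (test j) x) \<longlonglongrightarrow> (LINT y|K x. test j y)"
    by (rule ergodic_kernel[OF act P]) blast
  have KT: "K \<in> P \<rightarrow>\<^sub>M borel_of (ergodic_topology a)"
    by (rule measurable_prob_cong[OF P' measurable_ergodic_topology[OF Km Ke]])
  note b = bind_kernel[OF prob_space_axioms measurable_prob_cong[OF P' Km], unfolded PK]
  show ?thesis
  proof (rule ex1I)
    show "distr P (borel_of (ergodic_topology a)) K \<in> prob_measures (borel_of (ergodic_topology a)) \<and>
        is_barycenter (distr P (borel_of (ergodic_topology a)) K) P"
      using is_barycenter_distr[OF prob_space_axioms KT b(2)] prob_space_distr[OF KT]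
      by (simp add: prob_measures_def)
    fix m assume "m \<in> prob_measures (borel_of (ergodic_topology a)) \<and> is_barycenter m P"
    then show "m = distr P (borel_of (ergodic_topology a)) K"
      using decomposition_unique[OF act P n Ke Km lim] by blast
  qed
qed

lemma ergodic_decompositionD:
  fixes a :: "int \<Rightarrow> 'a::polish_space \<Rightarrow> 'a"
  assumes "continuous_int_action a" "P \<in> invariant_probs a"
  shows "ergodic_decomposition a P \<in> prob_measures (borel_of (ergodic_topology a))"
    "is_barycenter (ergodic_decomposition a P) P"
  using theI'[OF ergodic_decomposition_unique[OF assms]] unfolding ergodic_decomposition_def by auto

lemma ergodic_decomposition_eqI:
  fixes a :: "int \<Rightarrow> 'a::polish_space \<Rightarrow> 'a"
  assumes "continuous_int_action a" "P \<in> invariant_probs a"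
    and "m \<in> prob_measures (borel_of (ergodic_topology a))" "is_barycenter m P"
  shows "m = ergodic_decomposition a P"
  using ergodic_decomposition_unique[OF assms(1,2)] ergodic_decompositionD[OF assms(1,2)] assms(3,4) by blast

text \<open>Preimages of invariant sets under an equivariant map are invariant, so the zero-one law
  passes to the image. The maps of interest are the two projections.\<close>

lemma factor_ergodic:
  fixes a :: "int \<Rightarrow> 'a::polish_space \<Rightarrow> 'a" and d :: "int \<Rightarrow> 'c::topological_space \<Rightarrow> 'c"
  assumes act: "continuous_int_action a" and dact: "continuous_int_action d"
    and h: "continuous_on UNIV h" and eqv: "\<And>x. h (d 1 x) = a 1 (h x)" and P: "P \<in> ergodics d"
  shows "distr P borel h \<in> ergodics a"
proof (rule zero_one_ergodic[OF act])
  note PI = ergodics_invariant[OF P]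
  note P' = invariant_probsD(1)[OF PI]
  have hb: "h \<in> borel \<rightarrow>\<^sub>M borel" by (rule borel_measurable_continuous_onI[OF h])
  have hm: "h \<in> P \<rightarrow>\<^sub>M borel" by (rule measurable_prob_cong[OF P' hb])
  have dm: "d 1 \<in> P \<rightarrow>\<^sub>M borel" by (rule measurable_prob_cong[OF P' action_measurable[OF dact]])
  show inv: "distr P borel h \<in> invariant_probs a"
  proof (rule invariant_probsI[OF act distr_prob_measures[OF P' hb]])
    have "distr (distr P borel h) borel (a 1) = distr P borel (a 1 \<circ> h)"
      by (rule distr_distr[OF action_measurable[OF act] hm])
    also have "a 1 \<circ> h = h \<circ> d 1" by (auto simp: eqv)
    also have "distr P borel (h \<circ> d 1) = distr (distr P borel (d 1)) borel h"
      by (rule distr_distr[symmetric, OF hb dm])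
    finally show "distr (distr P borel h) borel (a 1) = distr P borel h"
      by (simp add: invariant_probsD(5)[OF PI])
  qed
  show "zero_one_law a (distr P borel h)"
    unfolding zero_one_law_def
  proof (intro ballI impI)
    fix A assume A: "A \<in> sets borel" "a 1 -` A = A"
    have hA: "h -` A \<in> sets borel" using measurable_sets[OF hb A(1)] by simp
    have "d 1 -` (h -` A) = h -` (a 1 -` A)" by (auto simp: eqv)
    then have "d 1 -` (h -` A) = h -` A" using A(2) by simp
    with ergodics_zero_one[OF dact P] hA have "measure P (h -` A) = 0 \<or> measure P (h -` A) = 1"
      by (simp add: zero_one_law_def)
    then show "measure (distr P borel h) A = 0 \<or> measure (distr P borel h) A = 1"
      using measure_distr[OF hm A(1)] by (simp add: prob_measuresD(3)[OF P'])
  qed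
qed

subsection \<open>Invariant couplings\<close>

text \<open>The counterpart of \<open>invariant_cost\<close> for nonnegative costs, with values in
  \<open>ennreal\<close>, where integrals and infima carry no side conditions.\<close>

definition pos_cost ::
    "(int \<Rightarrow> 'a::topological_space \<Rightarrow> 'a) \<Rightarrow> (int \<Rightarrow> 'b::topological_space \<Rightarrow> 'b) \<Rightarrow>
     ('a \<times> 'b \<Rightarrow> real) \<Rightarrow> 'a measure \<Rightarrow> 'b measure \<Rightarrow> ennreal" where
  "pos_cost a b g \<mu> \<nu> = (INF p \<in> invariant_couplings a b \<mu> \<nu>. \<integral>\<^sup>+ z. ennreal (g z) \<partial>p)"

lemma diag_continuous_action:
  assumes "continuous_int_action a" "continuous_int_action b"
  shows "continuous_int_action (diag_action a b)"
proof -
  have "continuous_on UNIV (diag_action a b n)" for n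
  proof -
    have "diag_action a b n = (\<lambda>z. (a n (fst z), b n (snd z)))"
      by (auto simp: diag_action_def)
    moreover have "continuous_on UNIV (\<lambda>z::'a \<times> 'b. a n (fst z))"
      by (rule continuous_on_compose2[OF action_continuous[OF assms(1)]]) (auto intro!: continuous_intros)
    moreover have "continuous_on UNIV (\<lambda>z::'a \<times> 'b. b n (snd z))"
      by (rule continuous_on_compose2[OF action_continuous[OF assms(2)]]) (auto intro!: continuous_intros)
    ultimately show ?thesis by (simp add: continuous_on_Pair)
  qed
  moreover have "diag_action a b 0 = id" "diag_action a b (m + n) = diag_action a b m \<circ> diag_action a b n" for m n
    using assms by (auto simp: diag_action_def continuous_int_action_def)
  ultimately show ?thesis by (simp add: continuous_int_action_def)
qed

lemma invariant_couplingsD: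
  assumes "p \<in> invariant_couplings a b \<mu> \<nu>"
  shows "p \<in> invariant_probs (diag_action a b)" "distr p borel fst = \<mu>" "distr p borel snd = \<nu>"
  using assms by (auto simp: invariant_couplings_def)

lemma continuous_fst_snd:
  "continuous_on UNIV (fst :: 'a::topological_space \<times> 'b::topological_space \<Rightarrow> 'a)"
  "continuous_on UNIV (snd :: 'a \<times> 'b \<Rightarrow> 'b)"
  by (auto intro!: continuous_intros)

lemma fst_snd_borel [measurable]:
  "(fst :: 'a::topological_space \<times> 'b::topological_space \<Rightarrow> 'a) \<in> borel \<rightarrow>\<^sub>M borel"
  "(snd :: 'a \<times> 'b \<Rightarrow> 'b) \<in> borel \<rightarrow>\<^sub>M borel"
  by (rule borel_measurable_continuous_onI, rule continuous_fst_snd)+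

text \<open>Supplies an invariant coupling for every pair of invariant measures, so that the
  recombination always has one to choose.\<close>

lemma product_coupling:
  fixes a :: "int \<Rightarrow> 'a::polish_space \<Rightarrow> 'a" and b :: "int \<Rightarrow> 'b::polish_space \<Rightarrow> 'b"
  assumes a: "continuous_int_action a" and b: "continuous_int_action b"
    and P: "P \<in> invariant_probs a" and Q: "Q \<in> invariant_probs b"
  shows "P \<Otimes>\<^sub>M Q \<in> invariant_couplings a b P Q"
proof -
  interpret P: prob_space P by (rule invariant_probsD(2)[OF P])
  interpret Q: prob_space Q by (rule invariant_probsD(2)[OF Q])
  have pair: "prob_space (P \<Otimes>\<^sub>M Q)"
    by (rule prob_space_pair[OF P.prob_space_axioms Q.prob_space_axioms])
  note P' = invariant_probsD(1)[OF P] and Q' = invariant_probsD(1)[OF Q]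
  have s: "sets (P \<Otimes>\<^sub>M Q) = sets borel"
    using sets_pair_measure_cong[OF invariant_probsD(3)[OF P] invariant_probsD(3)[OF Q]]
    by (simp only: borel_prod)
  have pr: "P \<Otimes>\<^sub>M Q \<in> prob_measures borel"
    using s pair by (simp add: prob_measures_def)
  have "distr (P \<Otimes>\<^sub>M Q) borel (diag_action a b 1) = P \<Otimes>\<^sub>M Q"
  proof -
    have "distr P borel (a 1) \<Otimes>\<^sub>M distr Q borel (b 1) =
        distr (P \<Otimes>\<^sub>M Q) (borel \<Otimes>\<^sub>M borel) (\<lambda>(x, y). (a 1 x, b 1 y))"
    proof (rule pair_measure_distr)
      show "a 1 \<in> P \<rightarrow>\<^sub>M borel" by (rule measurable_prob_cong[OF P' action_measurable[OF a]])
      show "b 1 \<in> Q \<rightarrow>\<^sub>M borel" by (rule measurable_prob_cong[OF Q' action_measurable[OF b]])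
      show "sigma_finite_measure (distr Q borel (b 1))"
        unfolding invariant_probsD(5)[OF Q] by (rule Q.sigma_finite_measure_axioms)
    qed
    then show ?thesis
      by (simp add: invariant_probsD(5)[OF P] invariant_probsD(5)[OF Q] borel_prod diag_action_def)
  qed
  then have "P \<Otimes>\<^sub>M Q \<in> invariant_probs (diag_action a b)"
    by (rule invariant_probsI[OF diag_continuous_action[OF a b] pr])
  moreover have "distr (P \<Otimes>\<^sub>M Q) borel fst = P"
  proof -
    have "distr (P \<Otimes>\<^sub>M Q) borel fst = distr (P \<Otimes>\<^sub>M Q) P fst"
      by (rule distr_cong) (simp_all add: invariant_probsD(3)[OF P])
    then show ?thesis using Q.distr_pair_fst by simp
  qed
  moreover have "distr (P \<Otimes>\<^sub>M Q) borel snd = Q"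
  proof (rule measure_eqI)
    fix A assume "A \<in> sets (distr (P \<Otimes>\<^sub>M Q) borel snd)"
    then have A: "A \<in> sets Q" by (simp add: invariant_probsD(3)[OF Q])
    have "emeasure (distr (P \<Otimes>\<^sub>M Q) borel snd) A = emeasure (P \<Otimes>\<^sub>M Q) (space P \<times> A)"
      using A by (subst emeasure_distr)
        (auto simp: invariant_probsD[OF Q] invariant_probsD[OF P] space_pair_measure measurable_prob_cong[OF pr]
          intro!: arg_cong[where f="emeasure _"])
    then show "emeasure (distr (P \<Otimes>\<^sub>M Q) borel snd) A = emeasure Q A"
      using A by (simp add: Q.emeasure_pair_measure_Times P.emeasure_space_1)
  qed (simp add: invariant_probsD(3)[OF Q])
  ultimately show ?thesis by (simp add: invariant_couplings_def)
qed

section \<open>Weak limits of invariant couplings\<close>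

lemma wconv_subsequence:
  assumes "wconv P Q" "\<And>k. k \<le> r k"
  shows "wconv (\<lambda>k. P (r k)) Q"
  unfolding wconv_def le_Liminf_iff
proof (intro allI impI)
  fix U y assume "open U" "y < emeasure Q U"
  then have "\<forall>\<^sub>F n in sequentially. y < emeasure (P n) U"
    using assms(1) unfolding wconv_def le_Liminf_iff by blast
  moreover have "filterlim r at_top sequentially"
    by (rule filterlim_at_top_mono[OF filterlim_ident]) (use assms(2) in auto)
  ultimately show "\<forall>\<^sub>F k in sequentially. y < emeasure (P (r k)) U"
    by (rule eventually_compose_filterlim)
qed

lemma invariant_wconv_limit:
  fixes a :: "int \<Rightarrow> 'a::{metric_space,second_countable_topology} \<Rightarrow> 'a"
  assumes act: "continuous_int_action a" and P: "\<And>n. P n \<in> invariant_probs a"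
    and Q: "Q \<in> prob_measures borel" and w: "wconv P Q"
  shows "Q \<in> invariant_probs a"
proof (rule invariant_probsI[OF act Q])
  note P' = invariant_probsD(1)[OF P]
  have "wconv (\<lambda>n. distr (P n) borel (a 1)) (distr Q borel (a 1))"
    by (rule wconv_distr[OF P' Q w action_continuous[OF act]])
  then have "wconv P (distr Q borel (a 1))" by (simp add: invariant_probsD(5)[OF P])
  from wconv_unique[OF P' distr_prob_measures[OF Q action_measurable[OF act]] this Q w]
  show "distr Q borel (a 1) = Q" .
qed

text \<open>Inclusion-exclusion for the two cylinders; tightness of the marginals thereby gives
  tightness of the couplings.\<close>

lemma measure_fst_snd:
  fixes p :: "('a::topological_space \<times> 'b::topological_space) measure"
  assumes p: "p \<in> prob_measures borel" and K: "K \<in> sets borel" and L: "L \<in> sets borel"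
  shows "measure (distr p borel fst) K + measure (distr p borel snd) L - 1 \<le> measure p (K \<times> L)"
proof -
  interpret prob_space p using prob_measuresD[OF p] by simp
  have s: "sets p = sets borel" "space p = UNIV" using prob_measuresD[OF p] by auto
  have K': "fst -` K \<in> sets (borel :: ('a \<times> 'b) measure)" using measurable_sets[OF fst_snd_borel(1) K] by simp
  have L': "snd -` L \<in> sets (borel :: ('a \<times> 'b) measure)" using measurable_sets[OF fst_snd_borel(2) L] by simp
  have 1: "measure (distr p borel fst) K = measure p (fst -` K)"
    using measure_distr[OF measurable_prob_cong[OF p fst_snd_borel(1)] K] by (simp add: s)
  have 2: "measure (distr p borel snd) L = measure p (snd -` L)"
    using measure_distr[OF measurable_prob_cong[OF p fst_snd_borel(2)] L] by (simp add: s)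
  have 3: "K \<times> L = fst -` K \<inter> snd -` L" by auto
  have "measure p (fst -` K \<union> snd -` L) = measure p (fst -` K) + measure p (snd -` L) - measure p (fst -` K \<inter> snd -` L)"
    using K' L' by (intro measure_Un3) (auto simp: fmeasurable_eq_sets s)
  moreover have "measure p (fst -` K \<union> snd -` L) \<le> 1" by (rule prob_le_1)
  ultimately show ?thesis unfolding 1 2 3 by linarith
qed

text \<open>Convergent marginals are tight, so the couplings are tight and have a limit along a
  subsequence. It is an invariant coupling of the limit marginals, and lower semicontinuity bounds
  its cost; the errors still vanish because \<open>k \<le> r k\<close>. The marginals may vary with
  \<open>n\<close>, which covers both approximate marginals and nearby pairs of measures.\<close>

lemma coupling_limit:
  fixes a :: "int \<Rightarrow> 'a::polish_space \<Rightarrow> 'a" and b :: "int \<Rightarrow> 'b::polish_space \<Rightarrow> 'b"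
  assumes a: "continuous_int_action a" and b: "continuous_int_action b"
    and g: "lower_semicontinuous g" "\<And>z. 0 \<le> g z"
    and M: "\<And>n. M n \<in> prob_measures borel" "\<mu> \<in> prob_measures borel" "wconv M \<mu>"
    and N: "\<And>n. N n \<in> prob_measures borel" "\<nu> \<in> prob_measures borel" "wconv N \<nu>"
    and p: "\<And>n. p n \<in> invariant_couplings a b (M n) (N n)"
    and le: "\<And>n. (\<integral>\<^sup>+ z. ennreal (g z) \<partial>p n) \<le> t + ennreal (1 / Suc n)"
  shows "pos_cost a b g \<mu> \<nu> \<le> t"
proof -
  note pI = invariant_couplingsD(1)[OF p]
  note p' = invariant_probsD(1)[OF pI]
  have tight: "\<exists>K. compact K \<and> (\<forall>\<^sub>F n in sequentially. 1 - e \<le> measure (p n) K)" if "0 < e" for e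
  proof -
    have e2: "0 < e / 2" using that by simp
    obtain K where K: "compact K" "\<And>n. 1 - e / 2 \<le> measure (M n) K" by (rule wconv_tight[OF M e2]) blast
    obtain L where L: "compact L" "\<And>n. 1 - e / 2 \<le> measure (N n) L" by (rule wconv_tight[OF N e2]) blast
    have "1 - e \<le> measure (p n) (K \<times> L)" for n
    proof -
      have "measure (M n) K + measure (N n) L - 1 \<le> measure (p n) (K \<times> L)"
        using measure_fst_snd[OF p', of K L n] K(1) L(1)
        by (simp add: invariant_couplingsD(2,3)[OF p] compact_imp_closed)
      then show ?thesis using K(2)[of n] L(2)[of n] by linarith
    qed
    then show ?thesis using compact_Times[OF K(1) L(1)] by (intro exI[of _ "K \<times> L"]) simp
  qed
  have "\<exists>r Q. (\<forall>k. k \<le> r k) \<and> Q \<in> prob_measures borel \<and> wconv (\<lambda>k. p (r k)) Q"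
    by (rule prokhorov[of p, OF p' tight]) blast+
  then obtain r Q where r: "\<And>k. k \<le> r k" and Q: "Q \<in> prob_measures borel" and w: "wconv (\<lambda>k. p (r k)) Q"
    by blast
  have QI: "Q \<in> invariant_probs (diag_action a b)"
    by (rule invariant_wconv_limit[OF diag_continuous_action[OF a b] pI Q w])
  have "distr Q borel fst = \<mu>"
  proof (rule wconv_unique[OF M(1) distr_prob_measures[OF Q fst_snd_borel(1)] _ M(2)])
    show "wconv (\<lambda>k. M (r k)) (distr Q borel fst)"
      using wconv_distr[OF p' Q w continuous_fst_snd(1)] by (simp add: invariant_couplingsD(2)[OF p])
    show "wconv (\<lambda>k. M (r k)) \<mu>" by (rule wconv_subsequence[OF M(3) r])
  qed
  moreover have "distr Q borel snd = \<nu>"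
  proof (rule wconv_unique[OF N(1) distr_prob_measures[OF Q fst_snd_borel(2)] _ N(2)])
    show "wconv (\<lambda>k. N (r k)) (distr Q borel snd)"
      using wconv_distr[OF p' Q w continuous_fst_snd(2)] by (simp add: invariant_couplingsD(3)[OF p])
    show "wconv (\<lambda>k. N (r k)) \<nu>" by (rule wconv_subsequence[OF N(3) r])
  qed
  ultimately have Qc: "Q \<in> invariant_couplings a b \<mu> \<nu>" using QI by (simp add: invariant_couplings_def)
  have "pos_cost a b g \<mu> \<nu> \<le> (\<integral>\<^sup>+ z. ennreal (g z) \<partial>Q)"
    unfolding pos_cost_def by (rule INF_lower[OF Qc])
  also have "\<dots> \<le> liminf (\<lambda>k. \<integral>\<^sup>+ z. ennreal (g z) \<partial>p (r k))"
    by (rule wconv_liminf_lsc[OF p' Q w g])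
  also have "\<dots> \<le> liminf (\<lambda>k. t + ennreal (1 / Suc k))"
  proof (intro Liminf_mono always_eventually allI)
    fix k
    have "1 / Suc (r k) \<le> 1 / Suc k" using r[of k] by (simp add: frac_le)
    then have "t + ennreal (1 / Suc (r k)) \<le> t + ennreal (1 / Suc k)"
      by (intro add_left_mono ennreal_leI)
    with le[of "r k"] show "(\<integral>\<^sup>+ z. ennreal (g z) \<partial>p (r k)) \<le> t + ennreal (1 / Suc k)" by (rule order_trans)
  qed
  also have "\<dots> = t"
  proof (rule lim_imp_Liminf)
    have "(\<lambda>k. ennreal (1 / Suc k)) \<longlonglongrightarrow> ennreal 0"
      using LIMSEQ_inverse_real_of_nat by (intro tendsto_ennrealI) (simp add: inverse_eq_divide)
    from tendsto_add[OF tendsto_const[of t] this] show "(\<lambda>k. t + ennreal (1 / Suc k)) \<longlonglongrightarrow> t" by simp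
  qed simp
  finally show ?thesis .
qed

subsection \<open>Lower semicontinuity of the ergodic cost\<close>

text \<open>One index governs both the number of tests and the precision, so that measures taken
  from the \<open>n\<close>-th neighbourhoods converge weakly to \<open>P\<close>.\<close>

definition test_nbhd ::
    "(int \<Rightarrow> 'a::{metric_space,second_countable_topology} \<Rightarrow> 'a) \<Rightarrow> nat \<Rightarrow> 'a measure \<Rightarrow> 'a measure set" where
  "test_nbhd a n P = {Q \<in> ergodics a. \<forall>j\<le>n. (LINT x|P. test j x) - 1 / Suc n < (LINT x|Q. test j x)}"

lemma openin_test_nbhd: "openin (ergodic_topology a) (test_nbhd a n P)"
proof -
  let ?W = "\<Inter>j\<in>{..n}. {Q \<in> prob_measures borel. (LINT x|P. test j x) - 1 / Suc n < (LINT x|Q. test j x)}"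
  have "openin weak_topology ?W" by (intro openin_INT2 openin_weak_test) auto
  moreover have "test_nbhd a n P = ?W \<inter> ergodics a"
    unfolding test_nbhd_def using ergodics_subset[of a] by auto
  ultimately show ?thesis unfolding ergodic_topology_def openin_subtopology by blast
qed

lemma wconv_test_nbhd:
  fixes P :: "'a::{metric_space,second_countable_topology} measure"
  assumes P: "P \<in> prob_measures borel" and Q: "\<And>n. Q n \<in> test_nbhd a n P"
  shows "wconv Q P"
proof (rule wconvI_test[OF _ P])
  show "Q n \<in> prob_measures borel" for n using Q[of n] ergodics_prob by (auto simp: test_nbhd_def)
  fix i and e :: real assume "0 < e"
  then obtain N where N: "1 / Suc N < e" using nat_approx_posE by blast
  show "\<forall>\<^sub>F n in sequentially. (LINT x|P. test i x) - e < (LINT x|Q n. test i x)"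
  proof (rule eventually_sequentiallyI)
    fix n assume n: "max N i \<le> n"
    have "1 / Suc n \<le> 1 / Suc N" using n by (simp add: frac_le)
    moreover have "(LINT x|P. test i x) - 1 / Suc n < (LINT x|Q n. test i x)"
      using Q[of n] n by (auto simp: test_nbhd_def)
    ultimately show "(LINT x|P. test i x) - e < (LINT x|Q n. test i x)" using N by linarith
  qed
qed

text \<open>The cost is lower semicontinuous: if pairs arbitrarily close to \<open>(P, Q)\<close>
  had cost at most \<open>t\<close>, their nearly optimal couplings would have a limit showing the
  same for \<open>(P, Q)\<close>.\<close>

lemma pos_cost_measurable:
  fixes a :: "int \<Rightarrow> 'a::polish_space \<Rightarrow> 'a" and b :: "int \<Rightarrow> 'b::polish_space \<Rightarrow> 'b"
  assumes a: "continuous_int_action a" and b: "continuous_int_action b"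
    and g: "lower_semicontinuous g" "\<And>z. 0 \<le> g z"
  shows "(\<lambda>e. pos_cost a b g (fst e) (snd e)) \<in>
    borel_measurable (borel_of (prod_topology (ergodic_topology a) (ergodic_topology b)))"
proof (rule borel_measurableI_greater)
  fix t :: ennreal
  let ?T = "prod_topology (ergodic_topology a) (ergodic_topology b)"
  let ?S = "{e \<in> ergodics a \<times> ergodics b. t < pos_cost a b g (fst e) (snd e)}"
  have "openin ?T ?S"
  proof (subst openin_subopen, intro ballI)
    fix e assume e: "e \<in> ?S"
    obtain P Q where PQ: "e = (P, Q)" by (cases e)
    have erg: "P \<in> ergodics a" "Q \<in> ergodics b" and t: "t < pos_cost a b g P Q" using e PQ by auto
    have "\<exists>n. test_nbhd a n P \<times> test_nbhd b n Q \<subseteq> ?S"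
    proof (rule ccontr)
      assume "\<not> ?thesis"
      then have "\<not> test_nbhd a n P \<times> test_nbhd b n Q \<subseteq> ?S" for n by (simp only: not_ex not_False_eq_True)
      then have "\<exists>e'. e' \<in> test_nbhd a n P \<times> test_nbhd b n Q \<and> e' \<notin> ?S" for n
        by (simp only: subset_eq Ball_def not_all not_imp)
      then have "\<forall>n. \<exists>e'. e' \<in> test_nbhd a n P \<times> test_nbhd b n Q \<and> e' \<notin> ?S" by (rule allI)
      from choice[OF this] obtain E where "\<forall>n. E n \<in> test_nbhd a n P \<times> test_nbhd b n Q \<and> E n \<notin> ?S" ..
      then have E': "E n \<in> test_nbhd a n P \<times> test_nbhd b n Q \<and> E n \<notin> ?S" for n by (rule spec)
      note E = conjunct1[OF E'] conjunct2[OF E']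
      define M N where "M n = fst (E n)" and "N n = snd (E n)" for n
      have MN: "M n \<in> test_nbhd a n P" "N n \<in> test_nbhd b n Q" "(M n, N n) \<notin> ?S" for n
        using E(1)[of n] E(2)[of n] by (simp_all add: M_def N_def mem_Times_iff)
      have M': "M n \<in> ergodics a" and N': "N n \<in> ergodics b" for n using MN(1,2) by (auto simp: test_nbhd_def)
      have le: "pos_cost a b g (M n) (N n) \<le> t" for n using MN(3)[of n] M' N' by (auto simp: not_less)
      have "pos_cost a b g (M n) (N n) < t + ennreal (1 / Suc n)" for n
      proof -
        have "t < t + ennreal (1 / Suc n)"
          using t by (cases t) (auto simp: ennreal_plus[symmetric] ennreal_less_iff top.not_eq_extremum simp del: ennreal_plus)
        with le[of n] show ?thesis by (rule le_less_trans)
      qed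
      then have "\<exists>p. p \<in> invariant_couplings a b (M n) (N n) \<and> (\<integral>\<^sup>+ z. ennreal (g z) \<partial>p) \<le> t + ennreal (1 / Suc n)" for n
        unfolding pos_cost_def INF_less_iff by (blast intro: less_imp_le)
      then obtain p where p: "\<And>n. p n \<in> invariant_couplings a b (M n) (N n)"
        "\<And>n. (\<integral>\<^sup>+ z. ennreal (g z) \<partial>p n) \<le> t + ennreal (1 / Suc n)" by metis
      have "pos_cost a b g P Q \<le> t"
        by (rule coupling_limit[OF a b g ergodics_prob[OF M'] ergodics_prob[OF erg(1)] _ ergodics_prob[OF N'] ergodics_prob[OF erg(2)] _ p])
          (rule wconv_test_nbhd[OF ergodics_prob[OF erg(1)] MN(1)], rule wconv_test_nbhd[OF ergodics_prob[OF erg(2)] MN(2)])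
      with t show False by simp
    qed
    then obtain n where n: "test_nbhd a n P \<times> test_nbhd b n Q \<subseteq> ?S" by blast
    moreover have "openin ?T (test_nbhd a n P \<times> test_nbhd b n Q)"
      by (simp add: openin_prod_Times_iff openin_test_nbhd)
    moreover have "e \<in> test_nbhd a n P \<times> test_nbhd b n Q"
      using erg by (simp add: PQ test_nbhd_def)
    ultimately show "\<exists>T. openin ?T T \<and> e \<in> T \<and> T \<subseteq> ?S" by blast
  qed
  then have "?S \<in> sets (borel_of ?T)" by (rule openin_sets_borel_of)
  then show "{e \<in> space (borel_of ?T). t < pos_cost a b g (fst e) (snd e)} \<in> sets (borel_of ?T)" by simp
qed

subsection \<open>Decomposing an invariant coupling\<close>

lemma couplings_fst_snd_measurable:
  "fst \<in> borel_of (prod_topology S T) \<rightarrow>\<^sub>M borel_of S" "snd \<in> borel_of (prod_topology S T) \<rightarrow>\<^sub>M borel_of T"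
  by (rule continuous_map_measurable, rule continuous_map_fst)
     (rule continuous_map_measurable, rule continuous_map_snd)

lemma emeasure_marginal:
  assumes "p \<in> prob_measures borel" "h \<in> borel \<rightarrow>\<^sub>M borel" "A \<in> sets borel"
  shows "emeasure (distr p borel h) A = emeasure p (h -` A)"
  using emeasure_distr[OF measurable_prob_cong[OF assms(1,2)] assms(3)] prob_measuresD[OF assms(1)] by simp

text \<open>\<open>F\<close> and \<open>G\<close> are the marginals of the ergodic component at
  \<open>z\<close>. Their joint law is \<open>p\<close>, and its marginals are recognized as the
  ergodic decompositions by their barycenters alone. Each component competes in the infimum defining
  the cost of its own marginals.\<close>

lemma decomposed_coupling:
  fixes a :: "int \<Rightarrow> 'a::polish_space \<Rightarrow> 'a" and b :: "int \<Rightarrow> 'b::polish_space \<Rightarrow> 'b"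
  assumes a: "continuous_int_action a" and b: "continuous_int_action b"
    and g: "lower_semicontinuous g" "\<And>z. 0 \<le> g z"
    and \<mu>: "\<mu> \<in> invariant_probs a" and \<nu>: "\<nu> \<in> invariant_probs b"
    and q: "q \<in> invariant_couplings a b \<mu> \<nu>"
  shows "\<exists>p \<in> couplings (ergodic_topology a) (ergodic_topology b) (ergodic_decomposition a \<mu>) (ergodic_decomposition b \<nu>).
     (\<integral>\<^sup>+ e. pos_cost a b g (fst e) (snd e) \<partial>p) \<le> (\<integral>\<^sup>+ z. ennreal (g z) \<partial>q)"
proof -
  let ?d = "diag_action a b"
  let ?T = "prod_topology (ergodic_topology a) (ergodic_topology b)"
  note d = diag_continuous_action[OF a b]
  note qI = invariant_couplingsD(1)[OF q]
  note q' = invariant_probsD(1)[OF qI]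
  interpret prob_space q by (rule invariant_probsD(2)[OF qI])
  have gm [measurable]: "g \<in> borel_measurable borel" by (rule measurable_lsc[OF g(1)])
  obtain n :: "nat \<Rightarrow> nat" and K where Ke: "\<And>z. K z \<in> ergodics ?d"
    and Km: "K \<in> borel \<rightarrow>\<^sub>M prob_algebra borel" and qK: "q \<bind> K = q"
    by (rule ergodic_kernel[OF d qI]) blast
  note K' = ergodics_prob[OF Ke]
  have Kq: "K \<in> q \<rightarrow>\<^sub>M prob_algebra borel" by (rule measurable_prob_cong[OF q' Km])
  note bk = bind_kernel[OF prob_space_axioms Kq, unfolded qK]
  define F where "F z = distr (K z) borel fst" for z
  define G where "G z = distr (K z) borel snd" for z
  have Fe: "F z \<in> ergodics a" for z
    unfolding F_def by (rule factor_ergodic[OF a d continuous_fst_snd(1) _ Ke]) (simp add: diag_action_def case_prod_beta)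
  have Ge: "G z \<in> ergodics b" for z
    unfolding G_def by (rule factor_ergodic[OF b d continuous_fst_snd(2) _ Ke]) (simp add: diag_action_def case_prod_beta)
  have Fm: "F \<in> q \<rightarrow>\<^sub>M prob_algebra borel"
    unfolding F_def by (rule measurable_compose[OF Kq measurable_distr_prob_space[OF fst_snd_borel(1)]])
  have Gm: "G \<in> q \<rightarrow>\<^sub>M prob_algebra borel"
    unfolding G_def by (rule measurable_compose[OF Kq measurable_distr_prob_space[OF fst_snd_borel(2)]])
  have FT: "F \<in> q \<rightarrow>\<^sub>M borel_of (ergodic_topology a)" by (rule measurable_ergodic_topology[OF Fm Fe])
  have GT: "G \<in> q \<rightarrow>\<^sub>M borel_of (ergodic_topology b)" by (rule measurable_ergodic_topology[OF Gm Ge])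
  have FG: "(\<lambda>z. (F z, G z)) \<in> q \<rightarrow>\<^sub>M borel_of ?T"
    unfolding ergodic_topology_def
    by (rule measurable_subtopology_weak_prod[OF ergodics_subset ergodics_subset Fe integral_kernel_measurable[OF Fm] Ge integral_kernel_measurable[OF Gm]])
      auto
  define p where "p = distr q (borel_of ?T) (\<lambda>z. (F z, G z))"
  have "distr p (borel_of (ergodic_topology a)) fst = ergodic_decomposition a \<mu>"
  proof (rule ergodic_decomposition_eqI[OF a \<mu>])
    have eq: "distr p (borel_of (ergodic_topology a)) fst = distr q (borel_of (ergodic_topology a)) F"
      unfolding p_def by (subst distr_distr[OF couplings_fst_snd_measurable(1) FG]) (simp add: comp_def)
    show "distr p (borel_of (ergodic_topology a)) fst \<in> prob_measures (borel_of (ergodic_topology a))"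
      unfolding eq using prob_space_distr[OF FT] by (simp add: prob_measures_def)
    show "is_barycenter (distr p (borel_of (ergodic_topology a)) fst) \<mu>"
      unfolding eq
    proof (rule is_barycenter_distr[OF prob_space_axioms FT])
      fix A :: "'a set" assume A: "A \<in> sets borel"
      have "fst -` A \<in> sets (borel :: ('a \<times> 'b) measure)" using measurable_sets[OF fst_snd_borel(1) A] by simp
      from bk(2)[OF this] show "emeasure \<mu> A = (\<integral>\<^sup>+ z. emeasure (F z) A \<partial>q)"
        unfolding F_def invariant_couplingsD(2)[OF q, symmetric]
        by (simp add: emeasure_marginal[OF q' fst_snd_borel(1) A] emeasure_marginal[OF K' fst_snd_borel(1) A])
    qed
  qed
  moreover have "distr p (borel_of (ergodic_topology b)) snd = ergodic_decomposition b \<nu>"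
  proof (rule ergodic_decomposition_eqI[OF b \<nu>])
    have eq: "distr p (borel_of (ergodic_topology b)) snd = distr q (borel_of (ergodic_topology b)) G"
      unfolding p_def by (subst distr_distr[OF couplings_fst_snd_measurable(2) FG]) (simp add: comp_def)
    show "distr p (borel_of (ergodic_topology b)) snd \<in> prob_measures (borel_of (ergodic_topology b))"
      unfolding eq using prob_space_distr[OF GT] by (simp add: prob_measures_def)
    show "is_barycenter (distr p (borel_of (ergodic_topology b)) snd) \<nu>"
      unfolding eq
    proof (rule is_barycenter_distr[OF prob_space_axioms GT])
      fix A :: "'b set" assume A: "A \<in> sets borel"
      have "snd -` A \<in> sets (borel :: ('a \<times> 'b) measure)" using measurable_sets[OF fst_snd_borel(2) A] by simp
      from bk(2)[OF this] show "emeasure \<nu> A = (\<integral>\<^sup>+ z. emeasure (G z) A \<partial>q)"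
        unfolding G_def invariant_couplingsD(3)[OF q, symmetric]
        by (simp add: emeasure_marginal[OF q' fst_snd_borel(2) A] emeasure_marginal[OF K' fst_snd_borel(2) A])
    qed
  qed
  moreover have "p \<in> prob_measures (borel_of ?T)"
    unfolding p_def using prob_space_distr[OF FG] by (simp add: prob_measures_def)
  ultimately have pc: "p \<in> couplings (ergodic_topology a) (ergodic_topology b) (ergodic_decomposition a \<mu>) (ergodic_decomposition b \<nu>)"
    by (simp add: couplings_def)
  have "(\<integral>\<^sup>+ e. pos_cost a b g (fst e) (snd e) \<partial>p) = (\<integral>\<^sup>+ z. pos_cost a b g (F z) (G z) \<partial>q)"
    unfolding p_def by (subst nn_integral_distr[OF FG]) (simp_all add: pos_cost_measurable[OF a b g])
  also have "\<dots> \<le> (\<integral>\<^sup>+ z. (\<integral>\<^sup>+ y. ennreal (g y) \<partial>K z) \<partial>q)"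
  proof (rule nn_integral_mono)
    fix z
    have "K z \<in> invariant_couplings a b (F z) (G z)"
      using ergodics_invariant[OF Ke] by (simp add: invariant_couplings_def F_def G_def)
    then show "pos_cost a b g (F z) (G z) \<le> (\<integral>\<^sup>+ y. ennreal (g y) \<partial>K z)"
      unfolding pos_cost_def by (rule INF_lower)
  qed
  also have "\<dots> = (\<integral>\<^sup>+ z. ennreal (g z) \<partial>q)"
    by (rule bk(3)[symmetric]) simp
  finally show ?thesis using pc by blast
qed

subsection \<open>Recombining ergodic couplings\<close>

lemma barycenter_integral_test:
  fixes a :: "int \<Rightarrow> 'a::{metric_space,second_countable_topology} \<Rightarrow> 'a"
  assumes m: "m \<in> prob_measures (borel_of (ergodic_topology a))" and P: "P \<in> prob_measures borel"
    and bary: "is_barycenter m P"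
  shows "(LINT Q|m. LINT x|Q. test j x) = (LINT x|P. test j x)"
proof -
  have K: "(\<lambda>Q. Q) \<in> m \<rightarrow>\<^sub>M prob_algebra borel"
    using kernel_ergodic_topology measurable_cong_sets[OF prob_measuresD(2)[OF m] refl] by blast
  note b = bind_kernel[OF prob_measuresD(1)[OF m] K]
  have "m \<bind> (\<lambda>Q. Q) = P"
  proof (rule borel_prob_eqI[OF b(1) P])
    fix U :: "'a set" assume "open U"
    then show "emeasure (m \<bind> (\<lambda>Q. Q)) U = emeasure P U"
      using b(2)[of U] bary by (simp add: is_barycenter_def)
  qed
  then show ?thesis using b(4)[OF measurable_test abs_test_le_bound] by metis
qed

lemma almost_INF:
  fixes h :: "'c \<Rightarrow> ennreal"
  assumes "G \<noteq> {}" "0 < e"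
  shows "\<exists>x\<in>G. h x \<le> (INF x\<in>G. h x) + ennreal e"
proof (cases "(INF x\<in>G. h x) = \<infinity>")
  case True
  then show ?thesis using assms(1) by auto
next
  case False
  then have "(INF x\<in>G. h x) < (INF x\<in>G. h x) + ennreal e"
    using assms(2) by (cases "INF x\<in>G. h x")
      (auto simp: ennreal_plus[symmetric] ennreal_less_iff simp del: ennreal_plus)
  then show ?thesis unfolding INF_less_iff by (meson less_imp_le)
qed

text \<open>The first \<open>n\<close> test integrals rounded down to multiples of
  \<open>1 / Suc n\<close>. Lists of integers are countable, so the cells form a countable
  partition.\<close>

definition cell :: "nat \<Rightarrow> 'a::{metric_space,second_countable_topology} measure \<Rightarrow> int list" where
  "cell n P = map (\<lambda>j. \<lfloor>real (Suc n) * (LINT x|P. test j x)\<rfloor>) [0..<n]"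

lemma cell_eqD:
  assumes "cell n P = cell n Q" "j < n"
  shows "\<bar>(LINT x|P. test j x) - (LINT x|Q. test j x)\<bar> \<le> 1 / Suc n"
proof -
  define u v where "u = real (Suc n) * (LINT x|P. test j x)" and "v = real (Suc n) * (LINT x|Q. test j x)"
  have "\<lfloor>u\<rfloor> = \<lfloor>v\<rfloor>" using assms arg_cong[of "cell n P" "cell n Q" "\<lambda>l. l ! j"] by (simp add: cell_def u_def v_def)
  then have "\<bar>u - v\<bar> \<le> 1" by linarith
  moreover have "u - v = real (Suc n) * ((LINT x|P. test j x) - (LINT x|Q. test j x))"
    by (simp add: u_def v_def right_diff_distrib)
  ultimately have "real (Suc n) * \<bar>(LINT x|P. test j x) - (LINT x|Q. test j x)\<bar> \<le> 1" by (simp add: abs_mult)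
  then show ?thesis by (simp add: pos_le_divide_eq mult.commute)
qed

lemma measurable_cell:
  assumes [measurable]: "\<And>j. (\<lambda>x. LINT y|f x. test j y) \<in> borel_measurable M"
  shows "(\<lambda>x. cell n (f x)) \<in> M \<rightarrow>\<^sub>M count_space UNIV"
proof -
  have "(\<lambda>x. cell n (f x)) -` {w} \<inter> space M \<in> sets M" for w
  proof (cases "length w = n")
    case True
    have "(\<lambda>x. cell n (f x)) -` {w} \<inter> space M =
        {x \<in> space M. \<forall>j\<in>{..<n}. \<lfloor>real (Suc n) * (LINT y|f x. test j y)\<rfloor> = w ! j}"
      using True by (simp add: cell_def list_eq_iff_nth_eq vimage_def Int_def conj_commute Ball_def del: of_nat_Suc)
    also have "\<dots> \<in> sets M" by measurable
    finally show ?thesis .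
  next
    case False
    then have "(\<lambda>x. cell n (f x)) -` {w} \<inter> space M = {}" by (auto simp: cell_def)
    then show ?thesis by simp
  qed
  then show ?thesis by (subst measurable_count_space_eq2_countable) auto
qed

lemma bind_invariant:
  assumes act: "continuous_int_action d" and p: "prob_space p" and K: "K \<in> p \<rightarrow>\<^sub>M prob_algebra borel"
    and inv: "\<And>e. e \<in> space p \<Longrightarrow> K e \<in> invariant_probs d"
  shows "p \<bind> K \<in> invariant_probs d"
proof (rule invariant_probsI[OF act bind_kernel(1)[OF p K]], rule measure_eqI)
  note b = bind_kernel[OF p K]
  show "sets (distr (p \<bind> K) borel (d 1)) = sets (p \<bind> K)" using prob_measuresD[OF b(1)] by simp
  fix A assume "A \<in> sets (distr (p \<bind> K) borel (d 1))"
  then have A: "A \<in> sets borel" by simp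
  have dA: "d 1 -` A \<in> sets borel" using measurable_sets[OF action_measurable[OF act] A] by simp
  have "emeasure (distr (p \<bind> K) borel (d 1)) A = emeasure (p \<bind> K) (d 1 -` A)"
    by (rule emeasure_marginal[OF b(1) action_measurable[OF act] A])
  also have "\<dots> = (\<integral>\<^sup>+ e. emeasure (K e) (d 1 -` A) \<partial>p)" by (rule b(2)[OF dA])
  also have "\<dots> = (\<integral>\<^sup>+ e. emeasure (K e) A \<partial>p)"
    by (intro nn_integral_cong emeasure_invariant[OF act inv A])
  also have "\<dots> = emeasure (p \<bind> K) A" by (rule b(2)[OF A, symmetric])
  finally show "emeasure (distr (p \<bind> K) borel (d 1)) A = emeasure (p \<bind> K) A" .
qed

text \<open>\<open>S n e\<close> shares the \<open>n\<close>-th cell of \<open>f e\<close>, so for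
  \<open>j < n\<close> their \<open>j\<close>-th test integrals differ by at most
  \<open>1 / Suc n\<close>; integrating over \<open>e\<close> compares \<open>R n\<close> with the
  barycenter \<open>P\<close>. In the application \<open>S n e\<close> is a marginal of the coupling
  chosen for the cell of \<open>e\<close>.\<close>

lemma wconv_cells:
  fixes a :: "int \<Rightarrow> 'a::{metric_space,second_countable_topology} \<Rightarrow> 'a"
    and R :: "nat \<Rightarrow> 'a measure" and S :: "nat \<Rightarrow> 'c \<Rightarrow> 'a measure"
  assumes p: "prob_space p" and f: "f \<in> p \<rightarrow>\<^sub>M borel_of (ergodic_topology a)"
    and P: "P \<in> prob_measures borel" and bary: "is_barycenter (distr p (borel_of (ergodic_topology a)) f) P"
    and R: "\<And>n. R n \<in> prob_measures borel" and S: "\<And>n e. e \<in> space p \<Longrightarrow> S n e \<in> prob_measures borel"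
    and Sm: "\<And>n j. (\<lambda>e. LINT x|S n e. test j x) \<in> borel_measurable p"
    and RS: "\<And>n j. (LINT x|R n. test j x) = (LINT e|p. LINT x|S n e. test j x)"
    and cell: "\<And>n e. e \<in> space p \<Longrightarrow> cell n (S n e) = cell n (f e)"
  shows "wconv R P"
proof (rule wconvI_test[OF R P])
  interpret prob_space p by (rule p)
  fix j and e :: real assume "0 < e"
  then obtain N where N: "1 / Suc N < e" using nat_approx_posE by blast
  have m: "(\<lambda>Q. LINT x|Q. test j x) \<in> borel_measurable (borel_of (ergodic_topology a))"
    by (rule integral_kernel_measurable[OF kernel_ergodic_topology]) simp
  have fm: "(\<lambda>e. LINT x|f e. test j x) \<in> borel_measurable p"
    by (rule measurable_compose[OF f m])
  have fe: "f e \<in> prob_measures borel" if "e \<in> space p" for e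
    using measurable_space[OF f that] ergodics_prob by auto
  have bd: "\<bar>LINT x|Q. test j x\<bar> \<le> test_bound TYPE('a) j" if "Q \<in> prob_measures borel" for Q :: "'a measure"
    by (rule abs_integral_le[OF that _ abs_test_le_bound]) simp
  have i1: "integrable p (\<lambda>e. LINT x|f e. test j x)"
    by (rule integrable_const_bound[where B="test_bound TYPE('a) j", OF AE_I2 fm]) (use bd fe in simp)
  have i2: "integrable p (\<lambda>e. LINT x|S n e. test j x)" for n
    by (rule integrable_const_bound[where B="test_bound TYPE('a) j", OF AE_I2 Sm]) (use bd S in simp)
  have "(LINT x|P. test j x) = (LINT Q|distr p (borel_of (ergodic_topology a)) f. LINT x|Q. test j x)"
    using prob_space_distr[OF f] by (intro barycenter_integral_test[OF _ P bary, symmetric]) (simp add: prob_measures_def)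
  also have "\<dots> = (LINT e|p. LINT x|f e. test j x)" by (rule integral_distr[OF f m])
  finally have Pj: "(LINT x|P. test j x) = (LINT e|p. LINT x|f e. test j x)" .
  show "\<forall>\<^sub>F n in sequentially. (LINT x|P. test j x) - e < (LINT x|R n. test j x)"
  proof (rule eventually_sequentiallyI)
    fix n assume n: "max N (Suc j) \<le> n"
    have "(LINT x|P. test j x) - 1 / Suc n = (LINT e|p. (LINT x|f e. test j x) - 1 / Suc n)"
      using i1 by (simp add: Pj prob_space)
    also have "\<dots> \<le> (LINT e|p. LINT x|S n e. test j x)"
    proof (rule integral_mono)
      fix e assume "e \<in> space p"
      from cell_eqD[OF cell[OF this], of j n] n
      show "(LINT x|f e. test j x) - 1 / Suc n \<le> (LINT x|S n e. test j x)" by (simp add: abs_le_iff)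
    qed (use i1 i2 in auto)
    finally have "(LINT x|P. test j x) - 1 / Suc n \<le> (LINT x|R n. test j x)" by (simp add: RS)
    moreover have "1 / Suc n \<le> 1 / Suc N" using n by (simp add: frac_le)
    ultimately show "(LINT x|P. test j x) - e < (LINT x|R n. test j x)" using N by linarith
  qed
qed

text \<open>Couplings of all ergodic pairs in a cell are pooled. The pooled infimum lies below the
  cost of each pair in the cell, so the mixture costs at most \<open>1 / Suc n\<close> too much, and
  its wrong marginals are off by no more than the size of the cell.\<close>

lemma recombined_coupling:
  fixes a :: "int \<Rightarrow> 'a::polish_space \<Rightarrow> 'a" and b :: "int \<Rightarrow> 'b::polish_space \<Rightarrow> 'b"
  assumes a: "continuous_int_action a" and b: "continuous_int_action b"
    and g: "lower_semicontinuous g" "\<And>z. 0 \<le> g z"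
    and \<mu>: "\<mu> \<in> invariant_probs a" and \<nu>: "\<nu> \<in> invariant_probs b"
    and p: "p \<in> couplings (ergodic_topology a) (ergodic_topology b) (ergodic_decomposition a \<mu>) (ergodic_decomposition b \<nu>)"
  shows "pos_cost a b g \<mu> \<nu> \<le> (\<integral>\<^sup>+ e. pos_cost a b g (fst e) (snd e) \<partial>p)"
proof -
  let ?d = "diag_action a b"
  let ?T = "prod_topology (ergodic_topology a) (ergodic_topology b)"
  note d = diag_continuous_action[OF a b]
  have gm [measurable]: "g \<in> borel_measurable borel" by (rule measurable_lsc[OF g(1)])
  have pp: "p \<in> prob_measures (borel_of ?T)"
    and p1: "distr p (borel_of (ergodic_topology a)) fst = ergodic_decomposition a \<mu>"
    and p2: "distr p (borel_of (ergodic_topology b)) snd = ergodic_decomposition b \<nu>"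
    using p by (auto simp: couplings_def)
  interpret prob_space p by (rule prob_measuresD(1)[OF pp])
  have sp: "sets p = sets (borel_of ?T)" "space p = ergodics a \<times> ergodics b" using prob_measuresD[OF pp] by auto
  have fp: "fst \<in> p \<rightarrow>\<^sub>M borel_of (ergodic_topology a)" "snd \<in> p \<rightarrow>\<^sub>M borel_of (ergodic_topology b)"
    using couplings_fst_snd_measurable measurable_cong_sets[OF sp(1) refl] by blast+
  have Fm: "(\<lambda>e. pos_cost a b g (fst e) (snd e)) \<in> borel_measurable p"
    using pos_cost_measurable[OF a b g] measurable_cong_sets[OF sp(1) refl] by blast
  have tm1: "(\<lambda>e. LINT x|fst e. test j x) \<in> borel_measurable p" for j
    by (rule measurable_compose[OF fp(1) integral_kernel_measurable[OF kernel_ergodic_topology]]) simp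
  have tm2: "(\<lambda>e. LINT x|snd e. test j x) \<in> borel_measurable p" for j
    by (rule measurable_compose[OF fp(2) integral_kernel_measurable[OF kernel_ergodic_topology]]) simp
  \<comment> \<open>The marginals are required only to be ergodic and to lie in the cells named by
    \<open>w\<close>; they need not be the pair at which the kernel is evaluated.\<close>
  define G where "G n w = {q. \<exists>P\<in>ergodics a. \<exists>Q\<in>ergodics b. q \<in> invariant_couplings a b P Q \<and> (cell n P, cell n Q) = w}"
    for n and w :: "int list \<times> int list"
  define c where "c n e = (cell n (fst e), cell n (snd e))" for n and e :: "'a measure \<times> 'b measure"
  have G: "P \<Otimes>\<^sub>M Q \<in> G n (c n (P, Q))" if "P \<in> ergodics a" "Q \<in> ergodics b" for n P Q
    unfolding G_def c_def
    using that product_coupling[OF a b ergodics_invariant[OF that(1)] ergodics_invariant[OF that(2)]] by auto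
  define \<rho> where "\<rho> n w = (SOME q. q \<in> G n w \<and>
      (\<integral>\<^sup>+ z. ennreal (g z) \<partial>q) \<le> (INF q\<in>G n w. \<integral>\<^sup>+ z. ennreal (g z) \<partial>q) + ennreal (1 / Suc n))" for n w
  define K where "K n e = \<rho> n (c n e)" for n e
  have K: "K n e \<in> G n (c n e)"
    "(\<integral>\<^sup>+ z. ennreal (g z) \<partial>K n e) \<le> (INF q\<in>G n (c n e). \<integral>\<^sup>+ z. ennreal (g z) \<partial>q) + ennreal (1 / Suc n)"
    if "e \<in> space p" for n e
  proof -
    have "G n (c n e) \<noteq> {}" using that G[of "fst e" "snd e" n] by (auto simp: sp)
    from almost_INF[OF this, of "1 / Suc n" "\<lambda>q. \<integral>\<^sup>+ z. ennreal (g z) \<partial>q"]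
    have "\<exists>q. q \<in> G n (c n e) \<and>
      (\<integral>\<^sup>+ z. ennreal (g z) \<partial>q) \<le> (INF q\<in>G n (c n e). \<integral>\<^sup>+ z. ennreal (g z) \<partial>q) + ennreal (1 / Suc n)" by auto
    from someI_ex[OF this] show "K n e \<in> G n (c n e)"
      "(\<integral>\<^sup>+ z. ennreal (g z) \<partial>K n e) \<le> (INF q\<in>G n (c n e). \<integral>\<^sup>+ z. ennreal (g z) \<partial>q) + ennreal (1 / Suc n)"
      unfolding K_def \<rho>_def by blast+
  qed
  have KI: "K n e \<in> invariant_probs ?d" if "e \<in> space p" for n e
    using K(1)[OF that, of n] by (auto simp: G_def dest: invariant_couplingsD)
  note KP = invariant_probsD(1)[OF KI]
  have K1: "cell n (distr (K n e) borel fst) = cell n (fst e)" and K2: "cell n (distr (K n e) borel snd) = cell n (snd e)"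
    if "e \<in> space p" for n e
    using K(1)[OF that, of n] by (auto simp: G_def c_def dest: invariant_couplingsD)
  have Kcost: "(\<integral>\<^sup>+ z. ennreal (g z) \<partial>K n e) \<le> pos_cost a b g (fst e) (snd e) + ennreal (1 / Suc n)" if e: "e \<in> space p" for n e
  proof -
    have "invariant_couplings a b (fst e) (snd e) \<subseteq> G n (c n e)"
      using e unfolding G_def c_def sp by (cases e) fastforce
    then have "(INF q\<in>G n (c n e). \<integral>\<^sup>+ z. ennreal (g z) \<partial>q) \<le> pos_cost a b g (fst e) (snd e)"
      unfolding pos_cost_def by (rule INF_superset_mono) simp
    then have "(INF q\<in>G n (c n e). \<integral>\<^sup>+ z. ennreal (g z) \<partial>q) + ennreal (1 / Suc n) \<le> pos_cost a b g (fst e) (snd e) + ennreal (1 / Suc n)"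
      by (rule add_right_mono)
    with K(2)[OF e] show ?thesis by (rule order_trans)
  qed
  have cm: "c n \<in> p \<rightarrow>\<^sub>M count_space UNIV" for n
  proof -
    have "(\<lambda>e. (cell n (fst e), cell n (snd e))) \<in> p \<rightarrow>\<^sub>M count_space UNIV \<Otimes>\<^sub>M count_space UNIV"
      by (intro measurable_Pair measurable_cell tm1 tm2)
    then show ?thesis by (simp add: c_def[abs_def] pair_measure_countable)
  qed
  \<comment> \<open>The kernel factors through the countable discrete space of cell pairs, so the
    arbitrary choice \<open>\<rho>\<close> does not endanger measurability.\<close>
  have Km: "K n \<in> p \<rightarrow>\<^sub>M prob_algebra borel" for n
  proof (rule measurable_testsI[OF KP])
    show "(\<lambda>e. LINT y|K n e. test j y) \<in> borel_measurable p" for j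
      unfolding K_def by (rule measurable_compose[OF cm]) simp
  qed
  define q where "q n = p \<bind> K n" for n
  note bk = bind_kernel[OF prob_space_axioms Km, folded q_def]
  have qI: "q n \<in> invariant_probs ?d" for n
    unfolding q_def by (rule bind_invariant[OF d prob_space_axioms Km KI])
  have marginal: "(LINT x|distr (q n) borel h. test j x) = (LINT e|p. LINT x|distr (K n e) borel h. test j x)"
    if h: "h \<in> borel \<rightarrow>\<^sub>M borel" for n j and h :: "'a \<times> 'b \<Rightarrow> 'c::{metric_space,second_countable_topology}"
  proof -
    have m: "(\<lambda>z. test j (h z)) \<in> borel_measurable borel" using h by measurable
    have "(LINT x|distr (q n) borel h. test j x) = (LINT z|q n. test j (h z))"
      by (rule integral_distr[OF measurable_prob_cong[OF bk(1) h]]) simp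
    also have "\<dots> = (LINT e|p. LINT z|K n e. test j (h z))" by (rule bk(4)[OF m abs_test_le_bound])
    also have "\<dots> = (LINT e|p. LINT x|distr (K n e) borel h. test j x)"
      by (intro Bochner_Integration.integral_cong refl integral_distr[symmetric] measurable_prob_cong[OF KP h]) auto
    finally show ?thesis .
  qed
  have Dm: "(\<lambda>e. LINT x|distr (K n e) borel h. test j x) \<in> borel_measurable p"
    if h: "h \<in> borel \<rightarrow>\<^sub>M borel" for n j and h :: "'a \<times> 'b \<Rightarrow> 'c::{metric_space,second_countable_topology}"
    by (rule integral_kernel_measurable[OF measurable_compose[OF Km measurable_distr_prob_space[OF h]]]) simp
  have "wconv (\<lambda>n. distr (q n) borel fst) \<mu>"
  proof (rule wconv_cells[OF prob_space_axioms fp(1) invariant_probsD(1)[OF \<mu>]])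
    show "is_barycenter (distr p (borel_of (ergodic_topology a)) fst) \<mu>"
      unfolding p1 by (rule ergodic_decompositionD(2)[OF a \<mu>])
  qed (rule distr_prob_measures[OF bk(1) fst_snd_borel(1)] distr_prob_measures[OF KP fst_snd_borel(1)]
        Dm[OF fst_snd_borel(1)] marginal[OF fst_snd_borel(1)] K1; assumption)+
  moreover have "wconv (\<lambda>n. distr (q n) borel snd) \<nu>"
  proof (rule wconv_cells[OF prob_space_axioms fp(2) invariant_probsD(1)[OF \<nu>]])
    show "is_barycenter (distr p (borel_of (ergodic_topology b)) snd) \<nu>"
      unfolding p2 by (rule ergodic_decompositionD(2)[OF b \<nu>])
  qed (rule distr_prob_measures[OF bk(1) fst_snd_borel(2)] distr_prob_measures[OF KP fst_snd_borel(2)]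
        Dm[OF fst_snd_borel(2)] marginal[OF fst_snd_borel(2)] K2; assumption)+
  moreover have "q n \<in> invariant_couplings a b (distr (q n) borel fst) (distr (q n) borel snd)" for n
    using qI by (simp add: invariant_couplings_def)
  moreover have "(\<integral>\<^sup>+ z. ennreal (g z) \<partial>q n) \<le> (\<integral>\<^sup>+ e. pos_cost a b g (fst e) (snd e) \<partial>p) + ennreal (1 / Suc n)" for n
  proof -
    have "(\<integral>\<^sup>+ z. ennreal (g z) \<partial>q n) = (\<integral>\<^sup>+ e. (\<integral>\<^sup>+ z. ennreal (g z) \<partial>K n e) \<partial>p)"
      by (rule bk(3)) simp
    also have "\<dots> \<le> (\<integral>\<^sup>+ e. pos_cost a b g (fst e) (snd e) + ennreal (1 / Suc n) \<partial>p)"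
      by (rule nn_integral_mono[OF Kcost])
    also have "\<dots> = (\<integral>\<^sup>+ e. pos_cost a b g (fst e) (snd e) \<partial>p) + ennreal (1 / Suc n)"
      using Fm by (simp add: nn_integral_add emeasure_space_1)
    finally show ?thesis .
  qed
  ultimately show ?thesis
    by (intro coupling_limit[OF a b g distr_prob_measures[OF bk(1) fst_snd_borel(1)] invariant_probsD(1)[OF \<mu>] _
          distr_prob_measures[OF bk(1) fst_snd_borel(2)] invariant_probsD(1)[OF \<nu>]])
qed

subsection \<open>Reduction to nonnegative costs\<close>

text \<open>Positive part minus negative part of \<open>y + C\<close>, rearranged into sums because
  subtraction in \<open>ennreal\<close> truncates; \<open>ennreal C\<close> and
  \<open>ennreal (- C)\<close> are the two parts of \<open>C\<close>.\<close>

lemma shift_identity: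
  "e2ennreal (enn2ereal y + ereal C) + ennreal (- C) = e2ennreal (- (enn2ereal y + ereal C)) + y + ennreal C"
proof (cases y)
  case (real r)
  then have y: "enn2ereal y = ereal r" by (simp add: enn2ereal_ennreal)
  have 1: "e2ennreal (ereal s) = ennreal s" for s by (simp add: ennreal.abs_eq)
  have "ennreal (r + C) + ennreal (- C) = ennreal (- (r + C)) + ennreal r + ennreal C"
  proof (cases "0 \<le> C")
    case True
    then show ?thesis using real by (simp add: ennreal_neg ennreal_plus)
  next
    case False
    show ?thesis
    proof (cases "0 \<le> r + C")
      case True
      have "ennreal (r + C) + ennreal (- C) = ennreal (r + C + (- C))"
        using True False by (intro ennreal_plus[symmetric]) auto
      then show ?thesis using True False by (simp add: ennreal_neg)
    next
      case F: False
      have "ennreal (- (r + C)) + ennreal r = ennreal (- (r + C) + r)"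
        using F real by (intro ennreal_plus[symmetric]) auto
      then show ?thesis using F False by (simp add: ennreal_neg)
    qed
  qed
  then show ?thesis unfolding y using real by (simp add: 1)
next
  case top
  then show ?thesis by (simp add: e2ennreal_infty)
qed

text \<open>Integrating \<open>shift_identity\<close> relates the two parts. The negative part is at
  most that of \<open>C\<close>, hence finite, and may be subtracted even when the positive part is
  infinite.\<close>

lemma ext_integral_shift:
  assumes M: "prob_space M" and h [measurable]: "h \<in> borel_measurable M"
  shows "ext_integral M (\<lambda>x. enn2ereal (h x) + ereal C) = enn2ereal (\<integral>\<^sup>+ x. h x \<partial>M) + ereal C"
proof -
  interpret prob_space M by (rule M)
  define A where "A = (\<integral>\<^sup>+ x. e2ennreal (enn2ereal (h x) + ereal C) \<partial>M)"
  define B where "B = (\<integral>\<^sup>+ x. e2ennreal (- (enn2ereal (h x) + ereal C)) \<partial>M)"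
  define H where "H = (\<integral>\<^sup>+ x. h x \<partial>M)"
  have "(\<integral>\<^sup>+ x. e2ennreal (enn2ereal (h x) + ereal C) + ennreal (- C) \<partial>M) =
      (\<integral>\<^sup>+ x. e2ennreal (- (enn2ereal (h x) + ereal C)) + h x + ennreal C \<partial>M)"
    by (intro nn_integral_cong shift_identity)
  then have eq: "A + ennreal (- C) = B + H + ennreal C"
    by (simp add: nn_integral_add A_def B_def H_def emeasure_space_1)
  have "B \<le> (\<integral>\<^sup>+ x. ennreal (- C) \<partial>M)"
    unfolding B_def
  proof (rule nn_integral_mono)
    fix x
    have "ereal C \<le> enn2ereal (h x) + ereal C" by (simp add: ereal_le_add_self2)
    then have "- (enn2ereal (h x) + ereal C) \<le> ereal (- C)" by (metis ereal_minus_le_minus uminus_ereal.simps(1))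
    then show "e2ennreal (- (enn2ereal (h x) + ereal C)) \<le> ennreal (- C)"
      using e2ennreal_mono by (fastforce simp: ennreal.abs_eq)
  qed
  then have Bf: "B \<noteq> \<top>" by (auto simp: emeasure_space_1 top_unique)
  have "enn2ereal A - enn2ereal B = enn2ereal H + ereal C"
  proof (cases H)
    case top
    then have "A = \<top>" using eq by (cases A) (auto simp: ennreal_plus[symmetric] simp del: ennreal_plus)
    then show ?thesis using top Bf by (cases B) (auto simp: enn2ereal_ennreal)
  next
    case (real r)
    obtain s where s: "B = ennreal s" "0 \<le> s" using Bf by (cases B) auto
    have "A + ennreal (- C) \<noteq> \<top>" unfolding eq using real s by simp
    then have "A \<noteq> \<top>" by auto
    then obtain u where u: "A = ennreal u" "0 \<le> u" by (cases A) auto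
    have "u + max 0 (- C) = s + r + max 0 C"
    proof -
      have e: "ennreal x = ennreal (max 0 x)" for x by (simp add: max_def ennreal_neg)
      have "ennreal (u + max 0 (- C)) = ennreal (s + r + max 0 C)"
        using eq unfolding u real s e[of C] e[of "- C"] using u s real by (simp add: ennreal_plus)
      then show ?thesis using u s real by (subst (asm) ennreal_inj) auto
    qed
    then show ?thesis using u s real by (simp add: enn2ereal_ennreal max_def split: if_splits)
  qed
  then show ?thesis by (simp add: ext_integral_def A_def B_def H_def)
qed

text \<open>Adding \<open>C\<close> is an order isomorphism from the nonnegative extended reals onto
  those above \<open>C\<close>; for empty \<open>S\<close> both sides are \<infinity>.\<close>

lemma INF_shift:
  "(INF x\<in>S. enn2ereal (h x) + ereal C) = enn2ereal (INF x\<in>S. h x) + ereal C"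
proof (rule antisym)
  define I where "I = (INF x\<in>S. enn2ereal (h x) + ereal C)"
  have "ereal C \<le> I" unfolding I_def by (rule INF_greatest) (simp add: ereal_le_add_self2)
  then have "0 \<le> I - ereal C" by (cases I) auto
  then have J: "enn2ereal (e2ennreal (I - ereal C)) + ereal C = I"
    by (subst enn2ereal_e2ennreal) (simp, cases I, auto)
  have "e2ennreal (I - ereal C) \<le> h x" if "x \<in> S" for x
  proof -
    have "I \<le> enn2ereal (h x) + ereal C" unfolding I_def by (rule INF_lower[OF that])
    then have "I - ereal C \<le> enn2ereal (h x)" by (simp add: ereal_minus_le)
    then have "e2ennreal (I - ereal C) \<le> e2ennreal (enn2ereal (h x))" by (rule e2ennreal_mono)
    then show ?thesis by (simp add: e2ennreal_enn2ereal)
  qed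
  then have "e2ennreal (I - ereal C) \<le> (INF x\<in>S. h x)" by (rule INF_greatest)
  then have "enn2ereal (e2ennreal (I - ereal C)) + ereal C \<le> enn2ereal (INF x\<in>S. h x) + ereal C"
    by (intro add_right_mono) (simp add: less_eq_ennreal.rep_eq)
  then show "(INF x\<in>S. enn2ereal (h x) + ereal C) \<le> enn2ereal (INF x\<in>S. h x) + ereal C"
    unfolding J I_def[symmetric] .
next
  show "enn2ereal (INF x\<in>S. h x) + ereal C \<le> (INF x\<in>S. enn2ereal (h x) + ereal C)"
    by (intro INF_greatest add_right_mono) (simp add: less_eq_ennreal.rep_eq[symmetric] INF_lower)
qed

lemma invariant_cost_shift:
  fixes a :: "int \<Rightarrow> 'a::polish_space \<Rightarrow> 'a" and b :: "int \<Rightarrow> 'b::polish_space \<Rightarrow> 'b"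
  assumes c: "c \<in> borel_measurable borel" and C: "\<And>z. C \<le> c z"
  shows "invariant_cost a b c \<mu> \<nu> = enn2ereal (pos_cost a b (\<lambda>z. c z - C) \<mu> \<nu>) + ereal C"
proof -
  have eq: "ereal (c z) = enn2ereal (ennreal (c z - C)) + ereal C" for z
    using C[of z] by (simp add: enn2ereal_ennreal)
  have "ext_integral p (\<lambda>z. ereal (c z)) = enn2ereal (\<integral>\<^sup>+ z. ennreal (c z - C) \<partial>p) + ereal C"
    if p: "p \<in> invariant_couplings a b \<mu> \<nu>" for p
  proof -
    note pI = invariant_couplingsD(1)[OF p]
    have "(\<lambda>z. ennreal (c z - C)) \<in> borel_measurable p"
      by (rule measurable_prob_cong[OF invariant_probsD(1)[OF pI]]) (use c in measurable)
    from ext_integral_shift[OF invariant_probsD(2)[OF pI] this] show ?thesis unfolding eq .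
  qed
  then show ?thesis unfolding invariant_cost_def pos_cost_def INF_shift[symmetric] by (rule INF_cong[OF refl])
qed

theorem theorem1p1:
  fixes a :: "int \<Rightarrow> 'a::polish_space \<Rightarrow> 'a"
    and b :: "int \<Rightarrow> 'b::polish_space \<Rightarrow> 'b"
    and c :: "'a \<times> 'b \<Rightarrow> real"
    and \<mu> :: "'a measure" and \<nu> :: "'b measure"
  assumes "continuous_int_action a" and "continuous_int_action b"
    and "lower_semicontinuous c" and "bdd_below (range c)"
    and "\<mu> \<in> invariant_probs a" and "\<nu> \<in> invariant_probs b"
  shows "invariant_cost a b c \<mu> \<nu> =
    (INF p \<in> couplings (ergodic_topology a) (ergodic_topology b)
               (ergodic_decomposition a \<mu>) (ergodic_decomposition b \<nu>).
       ext_integral p (\<lambda>(\<xi>, \<eta>). invariant_cost a b c \<xi> \<eta>))"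
proof -
  note ab = assms(1,2)
  let ?\<Pi> = "couplings (ergodic_topology a) (ergodic_topology b) (ergodic_decomposition a \<mu>) (ergodic_decomposition b \<nu>)"
  obtain C where C: "\<And>z. C \<le> c z" using assms(4) by (auto simp: bdd_below_def)
  define g where "g z = c z - C" for z
  have g0: "0 \<le> g z" for z using C by (simp add: g_def)
  have "{z. t < g z} = {z. t + C < c z}" for t by (auto simp: g_def)
  then have g: "lower_semicontinuous g" using assms(3) by (simp add: lower_semicontinuous_def)
  have cost: "invariant_cost a b c \<xi> \<eta> = enn2ereal (pos_cost a b g \<xi> \<eta>) + ereal C" for \<xi> \<eta>
    using invariant_cost_shift[OF measurable_lsc[OF assms(3)] C] by (simp add: g_def[abs_def])
  \<comment> \<open>With the lower bound subtracted, the identity concerns nonnegative costs only;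
    the constant is added back inside and outside the infima, since all couplings have mass
    1.\<close>
  have main: "pos_cost a b g \<mu> \<nu> = (INF p\<in>?\<Pi>. \<integral>\<^sup>+ e. pos_cost a b g (fst e) (snd e) \<partial>p)"
  proof (rule antisym)
    show "pos_cost a b g \<mu> \<nu> \<le> (INF p\<in>?\<Pi>. \<integral>\<^sup>+ e. pos_cost a b g (fst e) (snd e) \<partial>p)"
      by (rule INF_greatest[OF recombined_coupling[OF ab g g0 assms(5,6)]])
    show "(INF p\<in>?\<Pi>. \<integral>\<^sup>+ e. pos_cost a b g (fst e) (snd e) \<partial>p) \<le> pos_cost a b g \<mu> \<nu>"
      unfolding pos_cost_def[of a b g \<mu> \<nu>]
      by (rule INF_mono[OF decomposed_coupling[OF ab g g0 assms(5,6)]])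
  qed
  have "ext_integral p (\<lambda>(\<xi>, \<eta>). invariant_cost a b c \<xi> \<eta>) =
      enn2ereal (\<integral>\<^sup>+ e. pos_cost a b g (fst e) (snd e) \<partial>p) + ereal C" if "p \<in> ?\<Pi>" for p
  proof -
    have p: "p \<in> prob_measures (borel_of (prod_topology (ergodic_topology a) (ergodic_topology b)))"
      using that by (simp add: couplings_def)
    have "(\<lambda>e. pos_cost a b g (fst e) (snd e)) \<in> borel_measurable p"
      using pos_cost_measurable[OF ab g g0] measurable_cong_sets[OF prob_measuresD(2)[OF p] refl] by blast
    from ext_integral_shift[OF prob_measuresD(1)[OF p] this, of C] show ?thesis
      by (simp add: cost case_prod_beta')
  qed
  then have "(INF p\<in>?\<Pi>. ext_integral p (\<lambda>(\<xi>, \<eta>). invariant_cost a b c \<xi> \<eta>)) =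
      (INF p\<in>?\<Pi>. enn2ereal (\<integral>\<^sup>+ e. pos_cost a b g (fst e) (snd e) \<partial>p) + ereal C)"
    by (rule INF_cong[OF refl])
  then show ?thesis by (simp add: cost main INF_shift)
qed

end
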